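(* Let $d,k,\ell$ be positive integers, let $G=(V,E)$ be a minimally globally $[k,\ell,d]$-rigid graph, and let $D=d+k+\ell-2$. For each subset $X\subseteq V(G)$ with $|X|\ge D+2$, we have $$|E(G[X])|\le r_D(G[X])+|X|-D-1\le (D+1)|X|-\binom{D+2}{2}.$$ The first inequality is strict unless $G[X]=K_{D+2}$.
   Context: Graphs are finite and simple. $G[X]$ is the subgraph of $G$ induced by $X$; $G-S-F$ is obtained from $G$ by deleting the vertex set $S$ and the edge set $F$; $K_{n}$ is the complete graph on $n$ vertices. Let $G=(V,E)$ and let $d$ be a positive integer. A framework in $\mathbb{C}^d$ is a pair $(G,p)$ with $p:V\to\mathbb{C}^d$; it is generic if the $d|V|$ coordinates of $p$ do not satisfy any nonzero polynomial with rational coefficients. Put $m_{uv}(p)=\sum_{i=1}^d(p(u)_i-p(v)_i)^2$ and $m_{d,G}(p)=(m_{uv}(p))_{uv\in E}\in\mathbb{C}^E$. The generic rigidity matroid $\mathcal{R}_d(G)$ is the matroid on $E$ given by the rows of the Jacobian matrix of $m_{d,G}$ at any generic configuration $p$ (the result does not depend on $p$); $r_d(G)$ is its rank (zero if $E=\varnothing$). $G$ is globally $d$-rigid if for every generic framework $(G,p)$ in $\mathbb{C}^d$ and every framework $(G,q)$ in $\mathbb{C}^d$, $m_{d,G}(p)=m_{d,G}(q)$ implies $m_{uv}(p)=m_{uv}(q)$ for all $u,v\in V$. (This is known to be equivalent to the same condition with $\mathbb{R}^d$ in place of $\mathbb{C}^d$.) $G$ is globally $[k,\ell,d]$-rigid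 if $|V|\ge k$ and $G-S-F$ is globally $d$-rigid for any sets $S\subseteq V$ and $F\subseteq E$ with $|S|\le k-1$ and $|F|\le\ell-1$. It is minimally globally $[k,\ell,d]$-rigid if it is globally $[k,\ell,d]$-rigid but $G-e$ is not, for every $e\in E$. *)

theory Defs
  imports
    "HOL-Analysis.Analysis"
    "HOL-Library.Function_Algebras"
    "HOL-Library.Poly_Mapping"
begin

section \<open>Graphs\<close>

type_synonym 'a graph = "'a set \<times> 'a set set"

abbreviation verts :: "'a graph \<Rightarrow> 'a set" where "verts \<equiv> fst"
abbreviation edges :: "'a graph \<Rightarrow> 'a set set" where "edges \<equiv> snd"

definition fin_simple_graph :: "'a graph \<Rightarrow> bool" where
  "fin_simple_graph G \<longleftrightarrow>
     finite (verts G) \<and> (\<forall>e\<in>edges G. e \<subseteq> verts G \<and> card e = 2)"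

definition induced_subgraph :: "'a graph \<Rightarrow> 'a set \<Rightarrow> 'a graph" where
  "induced_subgraph G X = (X, {e \<in> edges G. e \<subseteq> X})"

definition delete_graph :: "'a graph \<Rightarrow> 'a set \<Rightarrow> 'a set set \<Rightarrow> 'a graph" where
  "delete_graph G S F = (verts G - S, {e \<in> edges G - F. e \<inter> S = {}})"

text \<open>Being a complete graph on \<open>n\<close> vertices; for unlabelled \<open>K\<^sub>n\<close>, ``\<open>H = K\<^sub>n\<close>'' is meant
  up to isomorphism.\<close>

definition is_complete_graph :: "nat \<Rightarrow> 'a graph \<Rightarrow> bool" where
  "is_complete_graph n H \<longleftrightarrow>
     finite (verts H) \<and> card (verts H) = n \<and> edges H = {e. e \<subseteq> verts H \<and> card e = 2}"

section \<open>Frameworks\<close>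

text \<open>A configuration of \<open>V\<close> in \<open>\<complex>\<^sup>d\<close> is a function \<open>p\<close> of which only the coordinates
  \<open>p v i\<close> with \<open>v \<in> V\<close> and \<open>i < d\<close> matter.\<close>

type_synonym 'a config = "'a \<Rightarrow> nat \<Rightarrow> complex"

text \<open>Polynomials with rational coefficients in indeterminates indexed by \<open>'x\<close>: finitely
  supported maps from monomials (themselves finitely supported exponent maps) to coefficients.\<close>

type_synonym 'x rat_mpoly = "('x \<Rightarrow>\<^sub>0 nat) \<Rightarrow>\<^sub>0 rat"

definition mpoly_eval :: "('x \<Rightarrow> complex) \<Rightarrow> 'x rat_mpoly \<Rightarrow> complex" where
  "mpoly_eval a P =
     (\<Sum>m\<in>Poly_Mapping.keys P.
        of_rat (Poly_Mapping.lookup P m) *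
        (\<Prod>x\<in>Poly_Mapping.keys m. a x ^ Poly_Mapping.lookup m x))"

definition mpoly_vars :: "'x rat_mpoly \<Rightarrow> 'x set" where
  "mpoly_vars P = (\<Union>m\<in>Poly_Mapping.keys P. Poly_Mapping.keys m)"

definition generic :: "nat \<Rightarrow> 'a set \<Rightarrow> 'a config \<Rightarrow> bool" where
  "generic d V p \<longleftrightarrow>
     (\<forall>P :: ('a \<times> nat) rat_mpoly.
        P \<noteq> 0 \<and> mpoly_vars P \<subseteq> V \<times> {..<d} \<longrightarrow> mpoly_eval (\<lambda>(v, i). p v i) P \<noteq> 0)"

definition sq_dist :: "nat \<Rightarrow> 'a config \<Rightarrow> 'a \<Rightarrow> 'a \<Rightarrow> complex" where
  "sq_dist d p u v = (\<Sum>i<d. (p u i - p v i)\<^sup>2)"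

text \<open>The component of the measurement map at an unordered pair; it is well defined because
  \<^const>\<open>sq_dist\<close> is symmetric in the two vertices.\<close>

definition measurement :: "nat \<Rightarrow> 'a config \<Rightarrow> 'a set \<Rightarrow> complex" where
  "measurement d p e = (THE c. \<exists>u v. e = {u, v} \<and> c = sq_dist d p u v)"

lemma sq_dist_commute: "sq_dist d p u v = sq_dist d p v u"
  unfolding sq_dist_def by (simp add: power2_commute)

lemma measurement_pair: "measurement d p {u, v} = sq_dist d p u v"
  unfolding measurement_def
  by (rule the_equality) (auto simp: doubleton_eq_iff sq_dist_commute)

section \<open>The generic rigidity matroid\<close>

text \<open>The row at \<open>e\<close> of the Jacobian matrix of the measurement map at \<open>p\<close>: the entry in column
  \<open>(w, i)\<close> is the partial derivative of \<open>measurement d _ e\<close> with respect to the coordinate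
  \<open>p w i\<close>. Columns with \<open>w \<notin> e\<close> or \<open>i \<ge> d\<close> vanish, so letting the column index
  range over the whole type, instead of \<open>V \<times> {..<d}\<close>, only adds zero columns.\<close>

definition jacobian_row :: "nat \<Rightarrow> 'a config \<Rightarrow> 'a set \<Rightarrow> ('a \<times> nat \<Rightarrow> complex)" where
  "jacobian_row d p e =
     (\<lambda>(w, i). deriv (\<lambda>z. measurement d (p(w := (p w)(i := z))) e) (p w i))"

lemma jacobian_row_pair:
  assumes "u \<noteq> v"
  shows "jacobian_row d p {u, v} (w, i) =
    (if i < d \<and> w = u then 2 * (p u i - p v i)
     else if i < d \<and> w = v then 2 * (p v i - p u i) else 0)"
proof -
  let ?q = "\<lambda>z. p(w := (p w)(i := z))"
  have "((\<lambda>z. (?q z u j - ?q z v j)\<^sup>2) has_field_derivative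
      (if j = i then (if w = u then 2 * (p u i - p v i)
         else if w = v then 2 * (p v i - p u i) else 0) else 0)) (at (p w i))" for j
    using assms by (auto intro!: derivative_eq_intros)
  then have "((\<lambda>z. sq_dist d (?q z) u v) has_field_derivative
      (\<Sum>j<d. if j = i then (if w = u then 2 * (p u i - p v i)
         else if w = v then 2 * (p v i - p u i) else 0) else 0)) (at (p w i))"
    unfolding sq_dist_def by (intro DERIV_sum)
  from DERIV_imp_deriv[OF this] show ?thesis
    by (simp add: jacobian_row_def measurement_pair)
qed

definition cscale :: "complex \<Rightarrow> ('b \<Rightarrow> complex) \<Rightarrow> ('b \<Rightarrow> complex)" where
  "cscale c f = (\<lambda>x. c * f x)"

interpretation cfun: vector_space "cscale :: complex \<Rightarrow> ('b \<Rightarrow> complex) \<Rightarrow> ('b \<Rightarrow> complex)"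
  by unfold_locales (auto simp: cscale_def fun_eq_iff algebra_simps)

text \<open>Independence of the rows as an indexed family, hence the injectivity requirement.\<close>

definition rigidity_indep :: "nat \<Rightarrow> 'a config \<Rightarrow> 'a set set \<Rightarrow> bool" where
  "rigidity_indep d p F \<longleftrightarrow>
     inj_on (jacobian_row d p) F \<and> cfun.independent (jacobian_row d p ` F)"

text \<open>The rank of the matroid is the size of a largest independent set; it is the same for all
  generic configurations, so an arbitrary one is chosen.\<close>

definition rigidity_rank :: "nat \<Rightarrow> 'a graph \<Rightarrow> nat" where
  "rigidity_rank d G =
     (let p = (SOME p. generic d (verts G) p)
      in Max {card F | F. F \<subseteq> edges G \<and> rigidity_indep d p F})"

section \<open>Global rigidity\<close>

definition globally_rigid :: "nat \<Rightarrow> 'a graph \<Rightarrow> bool" where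
  "globally_rigid d G \<longleftrightarrow>
     (\<forall>p q. generic d (verts G) p \<and> (\<forall>e\<in>edges G. measurement d p e = measurement d q e) \<longrightarrow>
        (\<forall>u\<in>verts G. \<forall>v\<in>verts G. sq_dist d p u v = sq_dist d q u v))"

definition globally_rigid_kl :: "nat \<Rightarrow> nat \<Rightarrow> nat \<Rightarrow> 'a graph \<Rightarrow> bool" where
  "globally_rigid_kl k l d G \<longleftrightarrow>
     card (verts G) \<ge> k \<and>
     (\<forall>S F. S \<subseteq> verts G \<and> F \<subseteq> edges G \<and> card S \<le> k - 1 \<and> card F \<le> l - 1 \<longrightarrow>
        globally_rigid d (delete_graph G S F))"

definition minimally_globally_rigid_kl :: "nat \<Rightarrow> nat \<Rightarrow> nat \<Rightarrow> 'a graph \<Rightarrow> bool" where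
  "minimally_globally_rigid_kl k l d G \<longleftrightarrow>
     globally_rigid_kl k l d G \<and>
     (\<forall>e\<in>edges G. \<not> globally_rigid_kl k l d (delete_graph G {} {e}))"

end

theory Submission
  imports Defs "HOL-Computational_Algebra.Fundamental_Theorem_Algebra"
begin

text \<open>
  Write \<open>H\<close> for the subgraph induced by \<open>X\<close>, let \<open>n = |X|\<close>, and fix a generic configuration \<open>P\<close> of \<open>X\<close>
  in dimension \<open>D\<close>. The number of edges of \<open>H\<close> exceeds the rank \<open>r\<close> by the dimension of the space of
  equilibrium stresses of \<open>(H, P)\<close>, so the first inequality says that this dimension is at most
  \<open>n - D - 1\<close>, the codimension of the affine functions among all functions on \<open>X\<close>.

  Stresses are treated as symmetric matrices. The main point is that minimality provides, for every
  stress \<open>W\<close> that uses an edge \<open>e\<close>, a \<^emph>\<open>witness\<close>: a function on \<open>X\<close> that is killed by all stresses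
  avoiding \<open>e\<close>, but on which the quadratic form of \<open>W\<close> is nonzero
  (\<open>minimal_edge_witness\<close>). Minimality gives sets \<open>S\<close>, \<open>F\<close> and frameworks \<open>p\<close>, \<open>q\<close> in dimension
  \<open>d\<close>, with \<open>p\<close> generic, whose lengths agree on the remaining edges but not at \<open>e\<close>. Replacing each edge of \<open>F\<close> by
  one of its ends, one deletes \<open>D - d\<close> vertices altogether; projecting \<open>P\<close> from these vertices turns
  stresses of \<open>P\<close> into stresses of a generic framework in dimension \<open>d\<close>, up to diagonal rescaling
  (\<open>iterated_projection\<close>). Two facts about complex frameworks complete the construction: a pair \<open>p\<close>, \<open>q\<close>
  can be transported to any other generic configuration in place of \<open>p\<close>, and if \<open>p\<close> is generic, a framework with
  the same edge lengths has the same stresses (\<open>transfer_equivalent_framework\<close>, \<open>stress_transfer\<close>).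
  Both come from extending a homomorphism, together with derivations along it, from the ring generated by the
  coordinates of \<open>p\<close> to the coordinates of \<open>q\<close> (\<open>extend_to_finite_set\<close>). The coordinates of \<open>q\<close> then
  supply the witness (\<open>essential_edge_witness\<close>).

  Witnesses for the edges outside a basis of the rigidity matroid are linearly independent modulo
  affine functions, which proves the first inequality. In the case of equality they diagonalise all
  stresses simultaneously; the fundamental stresses have rank one and are supported on \<open>n - D - 1\<close>
  edge-disjoint cliques with at least \<open>D + 2\<close> vertices (\<open>stress_space_structure\<close>). The bound
  \<open>r \<le> D n - (D + 1 choose 2)\<close> (\<open>independent_card_bound\<close>), which also gives the second inequality, allows only
  one such clique, and then \<open>n = D + 2\<close>.
\<close>

section \<open>Polynomial functions over the rationals\<close>

text \<open>Working with functions instead of formal polynomials makes closure properties immediate and lets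
  directional derivatives be taken analytically. Genericity of \<open>p\<close> then says that a polynomial
  function vanishing at \<open>p\<close> vanishes identically.\<close>

inductive_set polyfun :: "'x set \<Rightarrow> (('x \<Rightarrow> complex) \<Rightarrow> complex) set" for I :: "'x set" where
  const: "(\<lambda>a. of_rat c) \<in> polyfun I"
| var: "x \<in> I \<Longrightarrow> (\<lambda>a. a x) \<in> polyfun I"
| add: "f \<in> polyfun I \<Longrightarrow> g \<in> polyfun I \<Longrightarrow> (\<lambda>a. f a + g a) \<in> polyfun I"
| mult: "f \<in> polyfun I \<Longrightarrow> g \<in> polyfun I \<Longrightarrow> (\<lambda>a. f a * g a) \<in> polyfun I"

lemma polyfun_0: "(\<lambda>a. 0) \<in> polyfun I"
  and polyfun_1: "(\<lambda>a. 1) \<in> polyfun I"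
  and polyfun_numeral: "(\<lambda>a. numeral n) \<in> polyfun I"
  using polyfun.const[of 0] polyfun.const[of 1] polyfun.const[of "numeral n"] by simp_all

lemma polyfun_uminus: "f \<in> polyfun I \<Longrightarrow> (\<lambda>a. - f a) \<in> polyfun I"
  using polyfun.mult[OF polyfun.const[of "-1"], of f I] by simp

lemma polyfun_diff: "f \<in> polyfun I \<Longrightarrow> g \<in> polyfun I \<Longrightarrow> (\<lambda>a. f a - g a) \<in> polyfun I"
  using polyfun.add[OF _ polyfun_uminus, of f I g] by simp

lemma polyfun_sum: "(\<And>j. j \<in> J \<Longrightarrow> f j \<in> polyfun I) \<Longrightarrow> (\<lambda>a. \<Sum>j\<in>J. f j a) \<in> polyfun I"
  by (induction J rule: infinite_finite_induct) (auto intro: polyfun.add polyfun_0)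

lemma polyfun_prod: "(\<And>j. j \<in> J \<Longrightarrow> f j \<in> polyfun I) \<Longrightarrow> (\<lambda>a. \<Prod>j\<in>J. f j a) \<in> polyfun I"
  by (induction J rule: infinite_finite_induct) (auto intro: polyfun.mult polyfun_1)

lemma polyfun_power: "f \<in> polyfun I \<Longrightarrow> (\<lambda>a. f a ^ n) \<in> polyfun I"
  by (induction n) (auto intro: polyfun.mult polyfun_1)

lemma polyfun_cong:
  assumes "f \<in> polyfun I" "\<And>x. x \<in> I \<Longrightarrow> a x = b x"
  shows "f a = f b"
  using assms(1) by induction (use assms(2) in auto)

lemma mpoly_eval_in_polyfun:
  assumes "mpoly_vars P \<subseteq> I"
  shows "(\<lambda>a. mpoly_eval a P) \<in> polyfun I"
  unfolding mpoly_eval_def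
  by (intro polyfun_sum polyfun.mult polyfun.const polyfun_prod polyfun_power polyfun.var)
     (use assms in \<open>auto simp: mpoly_vars_def\<close>)

abbreviation lkp :: "('a \<Rightarrow>\<^sub>0 'b::zero) \<Rightarrow> 'a \<Rightarrow> 'b" where "lkp \<equiv> Poly_Mapping.lookup"

definition monom_eval :: "('x \<Rightarrow> complex) \<Rightarrow> ('x \<Rightarrow>\<^sub>0 nat) \<Rightarrow> complex" where
  "monom_eval a m = (\<Prod>x\<in>Poly_Mapping.keys m. a x ^ lkp m x)"

lemma monom_eval_superset:
  assumes "finite S" "Poly_Mapping.keys m \<subseteq> S"
  shows "monom_eval a m = (\<Prod>x\<in>S. a x ^ lkp m x)"
  unfolding monom_eval_def using assms
  by (intro prod.mono_neutral_left) (auto simp: in_keys_iff)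

lemma monom_eval_plus: "monom_eval a (m + n) = monom_eval a m * monom_eval a n"
proof -
  let ?S = "Poly_Mapping.keys m \<union> Poly_Mapping.keys n"
  have "Poly_Mapping.keys (m + n) \<subseteq> ?S" by (rule Poly_Mapping.keys_add)
  then show ?thesis
    by (simp add: monom_eval_superset[of ?S] lookup_add power_add prod.distrib)
qed

lemma monom_eval_0 [simp]: "monom_eval a 0 = 1"
  by (simp add: monom_eval_def)

lemma monom_eval_single [simp]: "monom_eval a (Poly_Mapping.single x n) = a x ^ n"
  by (simp add: monom_eval_def)

lemma mpoly_eval_superset:
  assumes "finite S" "Poly_Mapping.keys P \<subseteq> S"
  shows "mpoly_eval a P = (\<Sum>m\<in>S. of_rat (lkp P m) * monom_eval a m)"
  unfolding mpoly_eval_def monom_eval_def[symmetric] using assms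
  by (intro sum.mono_neutral_left) (auto simp: in_keys_iff)

lemma mpoly_eval_add: "mpoly_eval a (P + Q) = mpoly_eval a P + mpoly_eval a Q"
proof -
  let ?S = "Poly_Mapping.keys P \<union> Poly_Mapping.keys Q"
  have "Poly_Mapping.keys (P + Q) \<subseteq> ?S" by (rule Poly_Mapping.keys_add)
  then show ?thesis
    by (simp add: mpoly_eval_superset[of ?S] lookup_add of_rat_add distrib_right sum.distrib)
qed

lemma mpoly_eval_0 [simp]: "mpoly_eval a 0 = 0"
  by (simp add: mpoly_eval_def)

lemma mpoly_eval_sum: "mpoly_eval a (\<Sum>j\<in>J. P j) = (\<Sum>j\<in>J. mpoly_eval a (P j))"
  by (induction J rule: infinite_finite_induct) (auto simp: mpoly_eval_add)

lemma mpoly_eval_single [simp]: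
  "mpoly_eval a (Poly_Mapping.single m c) = of_rat c * monom_eval a m"
  by (cases "c = 0") (auto simp: mpoly_eval_def monom_eval_def)

lemma mpoly_sum_singles:
  "P = (\<Sum>m\<in>Poly_Mapping.keys P. Poly_Mapping.single m (lkp P m))"
proof (rule poly_mapping_eqI)
  fix n
  show "lkp P n = lkp (\<Sum>m\<in>Poly_Mapping.keys P. Poly_Mapping.single m (lkp P m)) n"
    by (auto simp: lookup_sum lookup_single when_def in_keys_iff)
qed

lemma mpoly_eval_mult: "mpoly_eval a (P * Q) = mpoly_eval a P * mpoly_eval a Q"
proof -
  have "P * Q = (\<Sum>m\<in>Poly_Mapping.keys P. \<Sum>n\<in>Poly_Mapping.keys Q.
      Poly_Mapping.single (m + n) (lkp P m * lkp Q n))"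
    by (subst mpoly_sum_singles[of P], subst mpoly_sum_singles[of Q])
       (simp add: sum_product mult_single)
  then have "mpoly_eval a (P * Q) = (\<Sum>m\<in>Poly_Mapping.keys P. \<Sum>n\<in>Poly_Mapping.keys Q.
      (of_rat (lkp P m) * monom_eval a m) * (of_rat (lkp Q n) * monom_eval a n))"
    by (simp add: mpoly_eval_sum of_rat_mult monom_eval_plus mult_ac)
  also have "\<dots> = mpoly_eval a P * mpoly_eval a Q"
    by (simp only: mpoly_eval_def monom_eval_def[symmetric] sum_product)
  finally show ?thesis .
qed

lemma mpoly_vars_mult: "mpoly_vars (P * Q) \<subseteq> mpoly_vars P \<union> mpoly_vars Q"
proof -
  have "Poly_Mapping.keys (P * Q) \<subseteq>
      {m + n | m n. m \<in> Poly_Mapping.keys P \<and> n \<in> Poly_Mapping.keys Q}"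
    by (rule keys_mult)
  then show ?thesis
    unfolding mpoly_vars_def using Poly_Mapping.keys_add by fastforce
qed

lemma mpoly_vars_add: "mpoly_vars (P + Q) \<subseteq> mpoly_vars P \<union> mpoly_vars Q"
  unfolding mpoly_vars_def using Poly_Mapping.keys_add[of P Q] by fastforce

lemma polyfun_is_mpoly_eval:
  assumes "f \<in> polyfun I"
  shows "\<exists>P. mpoly_vars P \<subseteq> I \<and> f = (\<lambda>a. mpoly_eval a P)"
  using assms
proof induction
  case (const c)
  show ?case
    by (intro exI[of _ "Poly_Mapping.single 0 c"]) (auto simp: mpoly_vars_def)
next
  case (var x)
  then show ?case
    by (intro exI[of _ "Poly_Mapping.single (Poly_Mapping.single x 1) 1"]) (auto simp: mpoly_vars_def)
next
  case (add f g)
  then obtain P Q where "mpoly_vars P \<subseteq> I" "f = (\<lambda>a. mpoly_eval a P)"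
    "mpoly_vars Q \<subseteq> I" "g = (\<lambda>a. mpoly_eval a Q)" by auto
  then show ?case using mpoly_vars_add[of P Q]
    by (intro exI[of _ "P + Q"]) (auto simp: mpoly_eval_add)
next
  case (mult f g)
  then obtain P Q where "mpoly_vars P \<subseteq> I" "f = (\<lambda>a. mpoly_eval a P)"
    "mpoly_vars Q \<subseteq> I" "g = (\<lambda>a. mpoly_eval a Q)" by auto
  then show ?case using mpoly_vars_mult[of P Q]
    by (intro exI[of _ "P * Q"]) (auto simp: mpoly_eval_mult)
qed

lemma countable_poly_mapping:
  assumes "countable A" "countable (UNIV :: 'b::zero set)"
  shows "countable {m :: 'a \<Rightarrow>\<^sub>0 'b. Poly_Mapping.keys m \<subseteq> A}"
proof (rule countable_image_inj_on)
  let ?g = "\<lambda>m :: 'a \<Rightarrow>\<^sub>0 'b. (\<lambda>x. (x, lkp m x)) ` Poly_Mapping.keys m"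
  have "countable {F. finite F \<and> F \<subseteq> A \<times> (UNIV :: 'b set)}"
    using assms by (intro countable_Collect_finite_subset countable_SIGMA) auto
  then show "countable (?g ` {m. Poly_Mapping.keys m \<subseteq> A})"
    by (rule countable_subset[rotated]) auto
  show "inj_on ?g {m. Poly_Mapping.keys m \<subseteq> A}"
  proof (rule inj_onI, rule poly_mapping_eqI)
    fix m n k assume eq: "?g m = ?g n"
    have one_way: "lkp m' k = lkp n' k" if "?g m' = ?g n'" "k \<in> Poly_Mapping.keys m'" for m' n'
    proof -
      have "(k, lkp m' k) \<in> ?g m'" using that(2) by blast
      then have "(k, lkp m' k) \<in> ?g n'" by (simp only: that(1))
      then show ?thesis by auto
    qed
    show "lkp m k = lkp n k"
    proof (cases "k \<in> Poly_Mapping.keys m \<or> k \<in> Poly_Mapping.keys n")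
      case True
      then show ?thesis using one_way[OF eq] one_way[OF eq[symmetric]] by auto
    next
      case False
      then show ?thesis by (simp add: in_keys_iff)
    qed
  qed
qed

lemma countable_mpoly:
  assumes "countable I"
  shows "countable {P :: 'x rat_mpoly. mpoly_vars P \<subseteq> I}"
proof -
  have "{P :: 'x rat_mpoly. mpoly_vars P \<subseteq> I} =
      {P. Poly_Mapping.keys P \<subseteq> {m. Poly_Mapping.keys m \<subseteq> I}}"
    by (auto simp: mpoly_vars_def)
  then show ?thesis
    using assms by (simp add: countable_poly_mapping)
qed

lemma countable_polyfun:
  assumes "countable I"
  shows "countable (polyfun I)"
proof -
  have "polyfun I \<subseteq> (\<lambda>P a. mpoly_eval a P) ` {P. mpoly_vars P \<subseteq> I}"
  proof
    fix f assume "f \<in> polyfun I"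
    then obtain P where "mpoly_vars P \<subseteq> I" "f = (\<lambda>a. mpoly_eval a P)"
      using polyfun_is_mpoly_eval by metis
    then show "f \<in> (\<lambda>P a. mpoly_eval a P) ` {P. mpoly_vars P \<subseteq> I}" by (rule_tac image_eqI[of _ _ P]) auto
  qed
  then show ?thesis
    by (rule countable_subset) (intro countable_image countable_mpoly assms)
qed

section \<open>Generic points\<close>

lemma ex_transcendental:
  assumes "countable F" "\<And>f. f \<in> F \<Longrightarrow> f \<noteq> (0 :: complex poly)"
  shows "\<exists>t. \<forall>f\<in>F. poly f t \<noteq> 0"
proof -
  have "countable (\<Union>f\<in>F. {t. poly f t = 0})"
    using assms by (intro countable_UN) (auto intro: countable_finite poly_roots_finite)
  then have "(\<Union>f\<in>F. {t. poly f t = 0}) \<noteq> (UNIV :: complex set)"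
    using uncountable_UNIV_complex by metis
  then show ?thesis by auto
qed

text \<open>Coordinates are chosen one at a time. Over the earlier coordinates a nonzero polynomial becomes a
  nonzero univariate polynomial in the new one, and only countably many of these have to be avoided.\<close>

lemma ex_algebraically_independent:
  assumes "finite I"
  shows "\<exists>a. \<forall>P. P \<noteq> 0 \<and> mpoly_vars P \<subseteq> I \<longrightarrow> mpoly_eval a P \<noteq> 0"
  using assms
proof induction
  case empty
  show ?case
  proof (intro exI allI impI)
    fix P :: "'a rat_mpoly" assume P: "P \<noteq> 0 \<and> mpoly_vars P \<subseteq> {}"
    then have "Poly_Mapping.keys P \<subseteq> {0}"
      by (auto simp: mpoly_vars_def)
    moreover have "Poly_Mapping.keys P \<noteq> {}" using P by simp
    ultimately have "Poly_Mapping.keys P = {0}" using subset_singletonD by metis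
    then show "mpoly_eval (\<lambda>_. 0) P \<noteq> 0"
      by (auto simp: mpoly_eval_def in_keys_iff)
  qed
next
  case (insert x I)
  then obtain a where a: "\<And>P. P \<noteq> 0 \<Longrightarrow> mpoly_vars P \<subseteq> I \<Longrightarrow> mpoly_eval a P \<noteq> 0" by blast
  define off where "off m = Poly_Mapping.update x 0 m" for m :: "'a \<Rightarrow>\<^sub>0 nat"
  have keys_off: "Poly_Mapping.keys (off m) = Poly_Mapping.keys m - {x}" for m
    by (simp add: off_def keys_update)
  have off_inj: "m = n" if "off m = off n" "lkp m x = lkp n x" for m n
  proof (rule poly_mapping_eqI)
    fix k show "lkp m k = lkp n k"
    proof (cases "k = x")
      case False
      then show ?thesis using arg_cong[OF that(1), of "\<lambda>m. lkp m k"]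
        by (simp add: off_def lookup_update)
    qed (use that in simp)
  qed
  define U where "U P = (\<Sum>m\<in>Poly_Mapping.keys P.
      Polynomial.monom (of_rat (lkp P m) * monom_eval a (off m)) (lkp m x))" for P :: "'a rat_mpoly"
  have U_eval: "poly (U P) t = mpoly_eval (a(x := t)) P" for P t
  proof -
    have "monom_eval a (off m) * t ^ lkp m x = monom_eval (a(x := t)) m" for m
    proof -
      have "monom_eval (a(x := t)) m = (\<Prod>y\<in>insert x (Poly_Mapping.keys m - {x}). (a(x := t)) y ^ lkp m y)"
        by (intro monom_eval_superset) auto
      also have "\<dots> = t ^ lkp m x * (\<Prod>y\<in>Poly_Mapping.keys m - {x}. a y ^ lkp m y)"
        by (subst prod.insert) (auto intro!: prod.cong)
      also have "(\<Prod>y\<in>Poly_Mapping.keys m - {x}. a y ^ lkp m y) = monom_eval a (off m)"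
        unfolding monom_eval_def keys_off by (intro prod.cong) (auto simp: off_def lookup_update)
      finally show ?thesis by (simp only: mult.commute)
    qed
    then show ?thesis
      by (simp add: U_def poly_sum poly_monom mpoly_eval_def monom_eval_def[symmetric] mult.assoc
          del: fun_upd_apply)
  qed
  have U_nonzero: "U P \<noteq> 0" if P: "P \<noteq> 0" "mpoly_vars P \<subseteq> insert x I" for P
  proof -
    have "Poly_Mapping.keys P \<noteq> {}" using P(1) by simp
    then obtain m0 where m0: "m0 \<in> Poly_Mapping.keys P" by blast
    define i where "i = lkp m0 x"
    define M where "M = {m \<in> Poly_Mapping.keys P. lkp m x = i}"
    define Q where "Q = (\<Sum>m\<in>M. Poly_Mapping.single (off m) (lkp P m))"
    have fM: "finite M" by (simp add: M_def)
    have lookup_Q: "lkp Q (off m) = lkp P m" if "m \<in> M" for m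
    proof -
      have "lkp (Poly_Mapping.single (off m') (lkp P m')) (off m) = (if m' = m then lkp P m else 0)"
        if "m' \<in> M" for m'
      proof (cases "m' = m")
        case False
        then have "off m' \<noteq> off m" using off_inj[of m' m] that \<open>m \<in> M\<close> by (auto simp: M_def)
        then show ?thesis using False by (simp add: lookup_single_not_eq)
      qed simp
      then have "lkp Q (off m) = (\<Sum>m'\<in>M. if m' = m then lkp P m else 0)"
        unfolding Q_def lookup_sum by (intro sum.cong refl)
      then show ?thesis using that fM by simp
    qed
    have "Q \<noteq> 0" using lookup_Q[of m0] m0 by (auto simp: M_def i_def in_keys_iff)
    moreover have "mpoly_vars Q \<subseteq> I"
    proof -
      have "Poly_Mapping.keys Q \<subseteq> (\<Union>m\<in>M. Poly_Mapping.keys (Poly_Mapping.single (off m) (lkp P m)))"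
        unfolding Q_def by (rule Poly_Mapping.keys_sum)
      also have "\<dots> \<subseteq> off ` M" by (auto split: if_splits)
      finally have keysQ: "Poly_Mapping.keys Q \<subseteq> off ` M" .
      show ?thesis
      proof
        fix y assume "y \<in> mpoly_vars Q"
        then obtain n where "n \<in> Poly_Mapping.keys Q" "y \<in> Poly_Mapping.keys n"
          unfolding mpoly_vars_def by blast
        then obtain m where m: "m \<in> M" "y \<in> Poly_Mapping.keys (off m)" using keysQ by blast
        then have "y \<noteq> x" "y \<in> Poly_Mapping.keys m" using keys_off[of m] by auto
        moreover have "Poly_Mapping.keys m \<subseteq> insert x I" using m P(2) by (auto simp: M_def mpoly_vars_def)
        ultimately show "y \<in> I" by blast
      qed
    qed
    ultimately have "mpoly_eval a Q \<noteq> 0" by (rule a)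
    moreover have "coeff (U P) i = mpoly_eval a Q"
    proof -
      have "coeff (U P) i = (\<Sum>m\<in>Poly_Mapping.keys P. if lkp m x = i
           then of_rat (lkp P m) * monom_eval a (off m) else 0)"
        unfolding U_def coeff_sum by (intro sum.cong) auto
      also have "\<dots> = (\<Sum>m\<in>M. of_rat (lkp P m) * monom_eval a (off m))"
        unfolding M_def by (intro sum.inter_filter[symmetric]) auto
      also have "\<dots> = mpoly_eval a Q" by (simp add: Q_def mpoly_eval_sum)
      finally show ?thesis .
    qed
    ultimately show ?thesis by auto
  qed
  let ?F = "U ` ({P. mpoly_vars P \<subseteq> insert x I} - {0})"
  have "countable {P. mpoly_vars P \<subseteq> insert x I}"
    using insert.hyps(1) by (intro countable_mpoly) (simp add: countable_finite)
  then have "countable ?F" by (intro countable_image countable_Diff)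
  moreover have "f \<noteq> 0" if "f \<in> ?F" for f
  proof -
    from that obtain P where "f = U P" "P \<noteq> 0" "mpoly_vars P \<subseteq> insert x I" by (elim imageE) simp
    then show ?thesis using U_nonzero by simp
  qed
  ultimately have "\<exists>t. \<forall>f\<in>?F. poly f t \<noteq> 0" by (rule ex_transcendental)
  then obtain t where t: "\<forall>f\<in>?F. poly f t \<noteq> 0" ..
  show ?case
  proof (intro exI[of _ "a(x := t)"] allI impI)
    fix P assume "P \<noteq> 0 \<and> mpoly_vars P \<subseteq> insert x I"
    then have "U P \<in> ?F" by (intro imageI) simp
    then show "mpoly_eval (a(x := t)) P \<noteq> 0" unfolding U_eval[symmetric] by (rule bspec[OF t])
  qed
qed

lemma mpoly_eval_nonzero:
  assumes "P \<noteq> 0"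
  shows "\<exists>a. mpoly_eval a P \<noteq> 0"
proof -
  have "finite (mpoly_vars P)" by (auto simp: mpoly_vars_def)
  from ex_algebraically_independent[OF this] show ?thesis using assms by blast
qed

lemma ex_generic:
  assumes "finite V"
  shows "\<exists>p. generic d V p"
proof -
  have "finite (V \<times> {..<d})" using assms by simp
  from ex_algebraically_independent[OF this] obtain a where
    a: "\<And>P. P \<noteq> 0 \<and> mpoly_vars P \<subseteq> V \<times> {..<d} \<longrightarrow> mpoly_eval a P \<noteq> 0" by blast
  have "(\<lambda>(v, i). curry a v i) = a" by auto
  then show ?thesis using a by (intro exI[of _ "curry a"]) (simp add: generic_def)
qed

abbreviation coords :: "'a config \<Rightarrow> 'a \<times> nat \<Rightarrow> complex" where
  "coords p \<equiv> (\<lambda>(v, i). p v i)"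

text \<open>The direction from right to left needs that a nonzero polynomial is a nonzero function; a point
  where it does not vanish is any point with algebraically independent coordinates.\<close>

lemma generic_iff_polyfun:
  "generic d V p \<longleftrightarrow> (\<forall>f\<in>polyfun (V \<times> {..<d}). f (coords p) = 0 \<longrightarrow> (\<forall>a. f a = 0))"
proof
  assume g: "generic d V p"
  show "\<forall>f\<in>polyfun (V \<times> {..<d}). f (coords p) = 0 \<longrightarrow> (\<forall>a. f a = 0)"
  proof (intro ballI impI)
    fix f assume f: "f \<in> polyfun (V \<times> {..<d})" "f (coords p) = 0"
    from polyfun_is_mpoly_eval[OF f(1)] obtain P where
      P: "mpoly_vars P \<subseteq> V \<times> {..<d}" "f = (\<lambda>a. mpoly_eval a P)" by metis
    have "mpoly_eval (coords p) P = 0" using f(2) by (simp only: P(2))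
    then have "P = 0" using g[unfolded generic_def, rule_format, of P] P(1) by blast
    then show "\<forall>a. f a = 0" by (simp add: P(2))
  qed
next
  assume *: "\<forall>f\<in>polyfun (V \<times> {..<d}). f (coords p) = 0 \<longrightarrow> (\<forall>a. f a = 0)"
  show "generic d V p"
    unfolding generic_def
  proof (intro allI impI notI)
    fix P :: "('a \<times> nat) rat_mpoly"
    assume P: "P \<noteq> 0 \<and> mpoly_vars P \<subseteq> V \<times> {..<d}" "mpoly_eval (coords p) P = 0"
    then have "\<forall>a. mpoly_eval a P = 0"
      using bspec[OF *, OF mpoly_eval_in_polyfun[of P]] by simp
    then show False using mpoly_eval_nonzero[of P] P(1) by simp
  qed
qed

lemma generic_polyfun:
  assumes "generic d V p" "f \<in> polyfun (V \<times> {..<d})" "f (coords p) = 0"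
  shows "f a = 0"
  using bspec[OF assms(1)[unfolded generic_iff_polyfun] assms(2)] assms(3) by simp

lemma generic_subset:
  assumes "generic d V p" "W \<subseteq> V"
  shows "generic d W p"
proof -
  have sub: "W \<times> {..<d} \<subseteq> V \<times> {..<d}" using assms(2) by auto
  show ?thesis unfolding generic_def
  proof (intro allI impI)
    fix P :: "('a \<times> nat) rat_mpoly"
    assume "P \<noteq> 0 \<and> mpoly_vars P \<subseteq> W \<times> {..<d}"
    then have "P \<noteq> 0 \<and> mpoly_vars P \<subseteq> V \<times> {..<d}" using sub by blast
    then show "mpoly_eval (coords p) P \<noteq> 0" using assms(1) unfolding generic_def by blast
  qed
qed

section \<open>Extending ring homomorphisms together with their derivations\<close>

text \<open>The embeddings and derivations are only required to behave on \<open>K\<close>; their values elsewhere are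
  junk. Rings suffice, because division by a leading coefficient can be replaced by pseudo-division.\<close>

definition subring_of :: "complex set \<Rightarrow> bool" where
  "subring_of K \<longleftrightarrow> 0 \<in> K \<and> 1 \<in> K \<and> (\<forall>x\<in>K. \<forall>y\<in>K. x + y \<in> K \<and> x * y \<in> K) \<and> (\<forall>x\<in>K. - x \<in> K)"

definition ring_embedding :: "complex set \<Rightarrow> (complex \<Rightarrow> complex) \<Rightarrow> bool" where
  "ring_embedding K \<sigma> \<longleftrightarrow> \<sigma> 1 = 1 \<and>
     (\<forall>x\<in>K. \<forall>y\<in>K. \<sigma> (x + y) = \<sigma> x + \<sigma> y \<and> \<sigma> (x * y) = \<sigma> x * \<sigma> y) \<and>
     (\<forall>x\<in>K. \<sigma> x = 0 \<longrightarrow> x = 0)"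

definition derivation_along ::
    "complex set \<Rightarrow> (complex \<Rightarrow> complex) \<Rightarrow> (complex \<Rightarrow> complex) \<Rightarrow> bool" where
  "derivation_along K \<sigma> \<delta> \<longleftrightarrow>
     (\<forall>x\<in>K. \<forall>y\<in>K. \<delta> (x + y) = \<delta> x + \<delta> y \<and> \<delta> (x * y) = \<sigma> x * \<delta> y + \<delta> x * \<sigma> y)"

definition polys_over :: "complex set \<Rightarrow> complex poly set" where
  "polys_over K = {f. \<forall>i. coeff f i \<in> K}"

locale embedded_ring =
  fixes K \<sigma>
  assumes K: "subring_of K" and \<sigma>: "ring_embedding K \<sigma>"
begin

lemma K_closed [intro, simp]:
  "0 \<in> K" "1 \<in> K" "x \<in> K \<Longrightarrow> y \<in> K \<Longrightarrow> x + y \<in> K" "x \<in> K \<Longrightarrow> y \<in> K \<Longrightarrow> x * y \<in> K"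
  "x \<in> K \<Longrightarrow> - x \<in> K"
  using K by (auto simp: subring_of_def)

lemma K_diff [intro, simp]: "x \<in> K \<Longrightarrow> y \<in> K \<Longrightarrow> x - y \<in> K"
  using K_closed(3)[of x "- y"] by simp

lemma K_sum [intro]: "(\<And>j. j \<in> J \<Longrightarrow> f j \<in> K) \<Longrightarrow> sum f J \<in> K"
  by (induction J rule: infinite_finite_induct) auto

lemma K_power [intro]: "x \<in> K \<Longrightarrow> x ^ n \<in> K"
  by (induction n) auto

lemma \<sigma>_add: "x \<in> K \<Longrightarrow> y \<in> K \<Longrightarrow> \<sigma> (x + y) = \<sigma> x + \<sigma> y"
  and \<sigma>_mult: "x \<in> K \<Longrightarrow> y \<in> K \<Longrightarrow> \<sigma> (x * y) = \<sigma> x * \<sigma> y"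
  and \<sigma>_1 [simp]: "\<sigma> 1 = 1"
  and \<sigma>_inj: "x \<in> K \<Longrightarrow> \<sigma> x = 0 \<Longrightarrow> x = 0"
  using \<sigma> by (auto simp: ring_embedding_def)

lemma \<sigma>_0 [simp]: "\<sigma> 0 = 0"
  using \<sigma>_add[of 0 0] by simp

lemma \<sigma>_uminus: "x \<in> K \<Longrightarrow> \<sigma> (- x) = - \<sigma> x"
  using \<sigma>_add[of x "- x"] by (simp add: add_eq_0_iff2)

lemma \<sigma>_diff: "x \<in> K \<Longrightarrow> y \<in> K \<Longrightarrow> \<sigma> (x - y) = \<sigma> x - \<sigma> y"
  using \<sigma>_add[of x "- y"] by (simp add: \<sigma>_uminus)

lemma \<sigma>_sum: "(\<And>j. j \<in> J \<Longrightarrow> f j \<in> K) \<Longrightarrow> \<sigma> (sum f J) = (\<Sum>j\<in>J. \<sigma> (f j))"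
proof (induction J rule: infinite_finite_induct)
  case (insert x F)
  then show ?case by (simp add: \<sigma>_add K_sum)
qed auto

lemma \<sigma>_power: "x \<in> K \<Longrightarrow> \<sigma> (x ^ n) = \<sigma> x ^ n"
  by (induction n) (auto simp: \<sigma>_mult K_power)

lemma \<sigma>_of_nat: "\<sigma> (of_nat n) = of_nat n"
  and K_of_nat: "of_nat n \<in> K"
  by (induction n) (auto simp: \<sigma>_add)

abbreviation PK where "PK \<equiv> polys_over K"

lemma PKI: "(\<And>i. coeff f i \<in> K) \<Longrightarrow> f \<in> PK"
  by (simp add: polys_over_def)

lemma PKD [simp]: "f \<in> PK \<Longrightarrow> coeff f i \<in> K"
  by (simp add: polys_over_def)

lemma PK_0: "0 \<in> PK" by (rule PKI) simp

lemma PK_add: "f \<in> PK \<Longrightarrow> g \<in> PK \<Longrightarrow> f + g \<in> PK"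
  by (rule PKI) simp

lemma PK_diff: "f \<in> PK \<Longrightarrow> g \<in> PK \<Longrightarrow> f - g \<in> PK"
  by (rule PKI) simp

lemma PK_uminus: "f \<in> PK \<Longrightarrow> - f \<in> PK"
  by (rule PKI) simp

lemma PK_mult: "f \<in> PK \<Longrightarrow> g \<in> PK \<Longrightarrow> f * g \<in> PK"
  by (rule PKI) (auto simp: coeff_mult)

lemma PK_const: "c \<in> K \<Longrightarrow> [:c:] \<in> PK"
  by (rule PKI) (auto simp: coeff_pCons split: nat.split)

lemma PK_monom: "c \<in> K \<Longrightarrow> Polynomial.monom c n \<in> PK"
  by (rule PKI) auto

lemma PK_pderiv: "f \<in> PK \<Longrightarrow> pderiv f \<in> PK"
  by (rule PKI) (auto simp: coeff_pderiv K_of_nat simp del: of_nat_Suc)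

lemma countable_PK:
  assumes "countable K"
  shows "countable PK"
proof -
  have "PK \<subseteq> Poly ` lists K"
  proof
    fix f assume "f \<in> PK"
    then have "coeffs f \<in> lists K" by (auto simp: coeffs_def)
    then show "f \<in> Poly ` lists K" by (metis Poly_coeffs image_eqI)
  qed
  then show ?thesis using assms by (meson countable_image countable_lists countable_subset)
qed

abbreviation sg :: "complex poly \<Rightarrow> complex poly" where "sg \<equiv> map_poly \<sigma>"

lemma coeff_sg [simp]: "coeff (sg f) i = \<sigma> (coeff f i)"
  by (simp add: coeff_map_poly)

lemma sg_add: "f \<in> PK \<Longrightarrow> g \<in> PK \<Longrightarrow> sg (f + g) = sg f + sg g"
  by (rule poly_eqI) (simp add: \<sigma>_add)

lemma sg_mult: "f \<in> PK \<Longrightarrow> g \<in> PK \<Longrightarrow> sg (f * g) = sg f * sg g"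
proof (rule poly_eqI)
  fix n assume "f \<in> PK" "g \<in> PK"
  then have "\<sigma> (coeff (f * g) n) = (\<Sum>i\<le>n. \<sigma> (coeff f i * coeff g (n - i)))"
    unfolding coeff_mult by (intro \<sigma>_sum) auto
  then show "coeff (sg (f * g)) n = coeff (sg f * sg g) n"
    using \<open>f \<in> PK\<close> \<open>g \<in> PK\<close> by (simp add: coeff_mult \<sigma>_mult)
qed

lemma sg_const [simp]: "sg [:c:] = [:\<sigma> c:]"
  by (rule poly_eqI) (auto simp: coeff_pCons split: nat.split)

lemma sg_pderiv: "f \<in> PK \<Longrightarrow> sg (pderiv f) = pderiv (sg f)"
  by (rule poly_eqI) (simp add: coeff_pderiv \<sigma>_mult \<sigma>_of_nat K_of_nat del: of_nat_Suc)

lemma sg_eq_0: "f \<in> PK \<Longrightarrow> sg f = 0 \<Longrightarrow> f = 0"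
  using \<sigma>_inj by (metis PKD coeff_0 coeff_sg poly_eqI)

lemma degree_sg: "f \<in> PK \<Longrightarrow> degree (sg f) = degree f"
proof (rule antisym)
  assume f: "f \<in> PK"
  show "degree (sg f) \<le> degree f" by (rule degree_le) (simp add: coeff_eq_0)
  show "degree f \<le> degree (sg f)"
  proof (cases "degree f = 0")
    case False
    then have nz: "lead_coeff f \<noteq> 0" by auto
    have "coeff (sg f) (degree f) \<noteq> 0"
    proof
      assume "coeff (sg f) (degree f) = 0"
      then have "\<sigma> (lead_coeff f) = 0" by (simp only: coeff_sg)
      with PKD[OF f] have "lead_coeff f = 0" by (rule \<sigma>_inj)
      with nz show False by contradiction
    qed
    then show ?thesis by (rule le_degree)
  qed simp
qed

text \<open>Division without inverses: \<open>K\<close> need not be a field, so a power of the leading coefficient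
  of the divisor is multiplied in.\<close>

lemma pseudo_division:
  assumes m: "m \<in> PK" "m \<noteq> 0" and "f \<in> PK"
  shows "\<exists>c g r. c \<in> K \<and> c \<noteq> 0 \<and> g \<in> PK \<and> r \<in> PK \<and> [:c:] * f = m * g + r \<and> (r = 0 \<or> degree r < degree m)"
  using \<open>f \<in> PK\<close>
proof (induction "degree f" arbitrary: f rule: less_induct)
  case less
  show ?case
  proof (cases "f = 0 \<or> degree f < degree m")
    case True
    then show ?thesis using less.prems
      by (intro exI[of _ 1] exI[of _ 0] exI[of _ f]) (auto simp: PK_0)
  next
    case False
    define h where "h = Polynomial.monom (lead_coeff f) (degree f - degree m)"
    define f' where "f' = [:lead_coeff m:] * f - m * h"
    have h: "h \<in> PK" unfolding h_def using less.prems by (intro PK_monom) simp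
    have f': "f' \<in> PK" unfolding f'_def using less.prems h m(1)
      by (intro PK_diff PK_mult PK_const) auto
    have deg: "degree f' < degree f \<or> f' = 0"
    proof -
      have deg_h: "degree h = degree f - degree m"
        unfolding h_def by (rule degree_monom_eq) (use False in simp)
      moreover have "h \<noteq> 0" using False by (simp add: h_def monom_eq_0_iff)
      ultimately have dh: "degree (m * h) = degree f"
        using False m(2) by (simp add: degree_mult_eq)
      have "lead_coeff h = lead_coeff f" unfolding deg_h by (simp add: h_def)
      then have lh: "lead_coeff (m * h) = lead_coeff m * lead_coeff f"
        by (simp only: lead_coeff_mult)
      have top: "coeff f' (degree f) = 0"
        using lh unfolding dh by (simp add: f'_def)
      have "degree f' \<le> degree f"
        unfolding f'_def using dh by (intro degree_diff_le) auto
      then show ?thesis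
        using top leading_coeff_0_iff[of f'] by (metis le_neq_implies_less)
    qed
    have "\<exists>c g r. c \<in> K \<and> c \<noteq> 0 \<and> g \<in> PK \<and> r \<in> PK \<and> [:c:] * f' = m * g + r \<and> (r = 0 \<or> degree r < degree m)"
    proof (cases "f' = 0")
      case True
      then show ?thesis
        by (intro exI[of _ 1] exI[of _ 0]) (auto simp: PK_0)
    next
      case False
      then show ?thesis using less.hyps[OF _ f'] deg by blast
    qed
    then obtain c g r where c: "c \<in> K" "c \<noteq> 0" and g: "g \<in> PK" and r: "r \<in> PK" "r = 0 \<or> degree r < degree m"
      and eq: "[:c:] * f' = m * g + r" by blast
    have "[:c * lead_coeff m:] * f = [:c:] * (f' + m * h)"
      by (simp add: f'_def mult.commute[of c])
    also have "\<dots> = m * (g + [:c:] * h) + r"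
      using eq by (simp add: algebra_simps)
    finally show ?thesis
      using c g r m h PK_add[OF g PK_mult[OF PK_const[OF c(1)] h]]
      by (intro exI[of _ "c * lead_coeff m"] exI[of _ "g + [:c:] * h"] exI[of _ r]) auto
  qed
qed

text \<open>The element \<open>t'\<close> satisfies the image of exactly those equations over \<open>K\<close> that \<open>t\<close> satisfies, so that
  \<open>\<sigma>\<close> extends to \<open>K[t]\<close> by sending \<open>t\<close> to \<open>t'\<close>.\<close>

definition corresponding :: "complex \<Rightarrow> complex \<Rightarrow> bool" where
  "corresponding t t' \<longleftrightarrow> (\<forall>f\<in>PK. poly f t = 0 \<longleftrightarrow> poly (sg f) t' = 0)"

text \<open>An extension of \<open>\<delta>\<close> with value \<open>b\<close> at \<open>t\<close> is forced to take the displayed value at \<open>f(t)\<close>, so it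
  is well defined exactly if this value is zero whenever \<open>f(t)\<close> is.\<close>

definition liftable :: "complex \<Rightarrow> complex \<Rightarrow> (complex \<Rightarrow> complex) \<Rightarrow> bool" where
  "liftable t t' \<delta> \<longleftrightarrow> (\<exists>b. \<forall>f\<in>PK. poly f t = 0 \<longrightarrow>
     poly (map_poly \<delta> f) t' + b * poly (pderiv (sg f)) t' = 0)"

end

locale embedded_ring_derivation = embedded_ring +
  fixes \<delta> assumes \<delta>: "derivation_along K \<sigma> \<delta>"
begin

lemma \<delta>_add: "x \<in> K \<Longrightarrow> y \<in> K \<Longrightarrow> \<delta> (x + y) = \<delta> x + \<delta> y"
  and \<delta>_mult: "x \<in> K \<Longrightarrow> y \<in> K \<Longrightarrow> \<delta> (x * y) = \<sigma> x * \<delta> y + \<delta> x * \<sigma> y"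
  using \<delta> by (auto simp: derivation_along_def)

lemma \<delta>_0 [simp]: "\<delta> 0 = 0"
  using \<delta>_add[of 0 0] by simp

lemma \<delta>_sum: "(\<And>j. j \<in> J \<Longrightarrow> f j \<in> K) \<Longrightarrow> \<delta> (sum f J) = (\<Sum>j\<in>J. \<delta> (f j))"
proof (induction J rule: infinite_finite_induct)
  case (insert x F)
  then show ?case by (simp add: \<delta>_add K_sum)
qed auto

abbreviation dl :: "complex poly \<Rightarrow> complex poly" where "dl \<equiv> map_poly \<delta>"

lemma coeff_dl [simp]: "coeff (dl f) i = \<delta> (coeff f i)"
  by (simp add: coeff_map_poly)

lemma dl_add: "f \<in> PK \<Longrightarrow> g \<in> PK \<Longrightarrow> dl (f + g) = dl f + dl g"
  by (rule poly_eqI) (simp add: \<delta>_add)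

lemma dl_mult: "f \<in> PK \<Longrightarrow> g \<in> PK \<Longrightarrow> dl (f * g) = sg f * dl g + dl f * sg g"
proof (rule poly_eqI)
  fix n assume "f \<in> PK" "g \<in> PK"
  then have "\<delta> (coeff (f * g) n) = (\<Sum>i\<le>n. \<delta> (coeff f i * coeff g (n - i)))"
    unfolding coeff_mult by (intro \<delta>_sum) auto
  then show "coeff (dl (f * g)) n = coeff (sg f * dl g + dl f * sg g) n"
    using \<open>f \<in> PK\<close> \<open>g \<in> PK\<close> by (simp add: coeff_mult \<delta>_mult sum.distrib)
qed

lemma dl_const: "dl [:c:] = [:\<delta> c:]"
  by (rule poly_eqI) (auto simp: coeff_pCons split: nat.split)

text \<open>The value that an extension of \<open>\<delta>\<close> with value \<open>b\<close> at \<open>t\<close> must take at \<open>f(t)\<close>; as a function of \<open>f\<close>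
  it obeys the product rule.\<close>

definition ext_at :: "complex \<Rightarrow> complex \<Rightarrow> complex poly \<Rightarrow> complex" where
  "ext_at t' b f = poly (dl f) t' + b * poly (pderiv (sg f)) t'"

lemma ext_at_add: "f \<in> PK \<Longrightarrow> g \<in> PK \<Longrightarrow> ext_at t' b (f + g) = ext_at t' b f + ext_at t' b g"
  by (simp add: ext_at_def dl_add sg_add pderiv_add algebra_simps)

lemma ext_at_mult: "f \<in> PK \<Longrightarrow> g \<in> PK \<Longrightarrow>
    ext_at t' b (f * g) = poly (sg f) t' * ext_at t' b g + ext_at t' b f * poly (sg g) t'"
  by (simp add: ext_at_def dl_mult sg_mult pderiv_mult algebra_simps)

end

context embedded_ring
begin

lemma minimal_annihilator:
  assumes "\<exists>m\<in>PK. m \<noteq> 0 \<and> poly m t = 0"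
  obtains m where "m \<in> PK" "m \<noteq> 0" "poly m t = 0"
    "\<And>f. f \<in> PK \<Longrightarrow> poly f t = 0 \<Longrightarrow> degree f < degree m \<Longrightarrow> f = 0"
proof -
  let ?P = "\<lambda>m. m \<in> PK \<and> m \<noteq> 0 \<and> poly m t = 0"
  obtain m where "?P m" "\<And>f. ?P f \<Longrightarrow> degree m \<le> degree f"
    using assms ex_has_least_nat[of ?P _ degree] by blast
  then show ?thesis using that by (meson leD)
qed

text \<open>Here \<open>t'\<close> is a root of the image of a minimal annihilator \<open>m\<close> of \<open>t\<close>. A polynomial of
  smaller degree whose image vanishes at \<open>t'\<close> would, taken of least degree, pseudo-divide \<open>m\<close>, and
  one of the two factors would annihilate \<open>t\<close>.\<close>

lemma algebraic_correspondence:
  assumes m: "m \<in> PK" "m \<noteq> 0" "poly m t = 0"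
    and min: "\<And>f. f \<in> PK \<Longrightarrow> poly f t = 0 \<Longrightarrow> degree f < degree m \<Longrightarrow> f = 0"
    and t': "poly (sg m) t' = 0"
  shows "corresponding t t'"
proof -
  have small: "r = 0" if "r \<in> PK" "degree r < degree m" "poly (sg r) t' = 0" for r
  proof (rule ccontr)
    assume "r \<noteq> 0"
    let ?P = "\<lambda>r. r \<in> PK \<and> r \<noteq> 0 \<and> poly (sg r) t' = 0"
    obtain s where s: "?P s" and least: "\<And>f. ?P f \<Longrightarrow> degree s \<le> degree f"
      using \<open>r \<in> PK\<close> \<open>poly (sg r) t' = 0\<close> \<open>r \<noteq> 0\<close> ex_has_least_nat[of ?P r degree] by auto
    have ds: "degree s < degree m" using least[of r] that \<open>r \<noteq> 0\<close> by auto
    have s0: "degree s > 0"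
    proof (rule ccontr)
      assume "\<not> degree s > 0"
      then obtain c where "s = [:c:]" using degree_eq_zeroE by blast
      then show False using s \<sigma>_inj[of c] PKD[of s 0] by auto
    qed
    obtain c g r' where c: "c \<in> K" "c \<noteq> 0" and g: "g \<in> PK" and r': "r' \<in> PK" "r' = 0 \<or> degree r' < degree s"
      and eq: "[:c:] * m = s * g + r'"
      using pseudo_division[of s m] s m by blast
    have "sg ([:c:] * m) = sg s * sg g + sg r'"
      unfolding eq using s g r' by (simp add: sg_add sg_mult PK_mult)
    then have "poly (sg r') t' = 0"
      using s t' sg_mult[OF PK_const[OF c(1)] m(1)] by (metis add_cancel_left_left mult_zero_left mult_zero_right poly_add poly_mult)
    then have "r' = 0" using least[of r'] r' by fastforce
    then have eq': "[:c:] * m = s * g" using eq by simp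
    have g0: "g \<noteq> 0" using eq' c m by auto
    have "degree m = degree s + degree g"
      using arg_cong[OF eq', of degree] c m s g0 by (simp add: degree_mult_eq)
    moreover have "poly s t * poly g t = 0"
      using arg_cong[OF eq', of "\<lambda>f. poly f t"] m(3) by simp
    ultimately show False
      using min[of s] min[of g] s g g0 s0 ds by auto
  qed
  show ?thesis
    unfolding corresponding_def
  proof
    fix f assume f: "f \<in> PK"
    obtain c g r where c: "c \<in> K" "c \<noteq> 0" and g: "g \<in> PK" and r: "r \<in> PK" "r = 0 \<or> degree r < degree m"
      and eq: "[:c:] * f = m * g + r"
      using pseudo_division[of m f] m f by blast
    have sc: "\<sigma> c \<noteq> 0" using c \<sigma>_inj by blast
    have "sg ([:c:] * f) = sg m * sg g + sg r"
      unfolding eq using m g r by (simp add: sg_add sg_mult PK_mult)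
    then have "[:\<sigma> c:] * sg f = sg m * sg g + sg r"
      using sg_mult[OF PK_const[OF c(1)] f] by simp
    from arg_cong[OF this, of "\<lambda>f. poly f t'"] have "\<sigma> c * poly (sg f) t' = poly (sg r) t'"
      using t' by simp
    moreover have "c * poly f t = poly r t"
      using m(3) arg_cong[OF eq, of "\<lambda>f. poly f t"] by simp
    moreover have "poly r t = 0 \<longleftrightarrow> r = 0" using min[of r] r by auto
    moreover have "poly (sg r) t' = 0 \<longleftrightarrow> r = 0" using small[of r] r by auto
    ultimately show "poly f t = 0 \<longleftrightarrow> poly (sg f) t' = 0" using c sc by auto
  qed
qed

text \<open>The derivative of a minimal annihilator does not vanish at \<open>t'\<close> (its degree is too small), so
  the value \<open>b\<close> of the derivation at \<open>t\<close> can be solved for.\<close>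

lemma algebraic_liftable:
  assumes m: "m \<in> PK" "m \<noteq> 0" "poly m t = 0"
    and min: "\<And>f. f \<in> PK \<Longrightarrow> poly f t = 0 \<Longrightarrow> degree f < degree m \<Longrightarrow> f = 0"
    and t': "poly (sg m) t' = 0" and corr: "corresponding t t'"
    and "derivation_along K \<sigma> \<delta>"
  shows "liftable t t' \<delta>"
proof -
  interpret embedded_ring_derivation K \<sigma> \<delta>
    using K \<sigma> assms by unfold_locales
  have dm: "degree m > 0"
  proof (rule ccontr)
    assume "\<not> degree m > 0"
    then obtain c where "m = [:c:]" using degree_eq_zeroE by blast
    then show False using m by auto
  qed
  have "poly (pderiv m) t \<noteq> 0"
    using min[of "pderiv m"] PK_pderiv[OF m(1)] dm pderiv_eq_0_iff[of m] degree_pderiv[of m] by fastforce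
  then have nz: "poly (pderiv (sg m)) t' \<noteq> 0"
    using corr PK_pderiv[OF m(1)] sg_pderiv[OF m(1)] by (auto simp: corresponding_def)
  define b where "b = - poly (dl m) t' / poly (pderiv (sg m)) t'"
  have em: "ext_at t' b m = 0" using nz by (simp add: ext_at_def b_def)
  have "ext_at t' b f = 0" if f: "f \<in> PK" "poly f t = 0" for f
  proof -
    obtain c g r where c: "c \<in> K" "c \<noteq> 0" and g: "g \<in> PK" and r: "r \<in> PK" "r = 0 \<or> degree r < degree m"
      and eq: "[:c:] * f = m * g + r"
      using pseudo_division[of m f] m f by blast
    have "poly r t = 0" using arg_cong[OF eq, of "\<lambda>f. poly f t"] m f by simp
    then have "r = 0" using min[of r] r by auto
    then have eq': "[:c:] * f = m * g" using eq by simp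
    have "ext_at t' b (m * g) = 0" using em t' by (simp add: ext_at_mult[OF m(1) g])
    moreover have "ext_at t' b ([:c:] * f) = poly (sg [:c:]) t' * ext_at t' b f + ext_at t' b [:c:] * poly (sg f) t'"
      by (rule ext_at_mult[OF PK_const[OF c(1)] f(1)])
    moreover have "poly (sg f) t' = 0" using corr f by (auto simp: corresponding_def)
    ultimately have "\<sigma> c * ext_at t' b f = 0" unfolding eq' by simp
    then show ?thesis using \<sigma>_inj c by auto
  qed
  then show ?thesis unfolding liftable_def ext_at_def by blast
qed

text \<open>If \<open>t\<close> is transcendental over \<open>K\<close>, countability of \<open>K\<close> leaves room for a \<open>t'\<close> that is transcendental
  over the image, and every value of the derivation at \<open>t\<close> is allowed.\<close>

lemma ex_corresponding:
  assumes "countable K"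
  shows "\<exists>t'. corresponding t t' \<and> (\<forall>\<delta>. derivation_along K \<sigma> \<delta> \<longrightarrow> liftable t t' \<delta>)"
proof (cases "\<exists>m\<in>PK. m \<noteq> 0 \<and> poly m t = 0")
  case True
  then obtain m where m: "m \<in> PK" "m \<noteq> 0" "poly m t = 0"
    and min: "\<And>f. f \<in> PK \<Longrightarrow> poly f t = 0 \<Longrightarrow> degree f < degree m \<Longrightarrow> f = 0"
    by (rule minimal_annihilator) blast
  have "degree (sg m) \<noteq> 0"
  proof
    assume "degree (sg m) = 0"
    then have "degree m = 0" using degree_sg[OF m(1)] by simp
    then obtain c where "m = [:c:]" using degree_eq_zeroE by blast
    then show False using m by auto
  qed
  then have "\<not> constant (poly (sg m))" by (simp add: constant_degree)
  then obtain t' where t': "poly (sg m) t' = 0" using fundamental_theorem_of_algebra by blast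
  show ?thesis
    using algebraic_correspondence[OF m min t'] algebraic_liftable[OF m min t'] by blast
next
  case False
  then have transc: "f = 0" if "f \<in> PK" "poly f t = 0" for f using that by blast
  have "countable PK" by (rule countable_PK[OF assms])
  then have "countable (\<Union>f\<in>PK - {0}. {z. poly (sg f) z = 0})"
    using sg_eq_0 by (intro countable_UN countable_Diff) (auto intro: countable_finite poly_roots_finite)
  then have "(\<Union>f\<in>PK - {0}. {z. poly (sg f) z = 0}) \<noteq> (UNIV :: complex set)"
    using uncountable_UNIV_complex by metis
  then obtain t' where t': "\<And>f. f \<in> PK \<Longrightarrow> f \<noteq> 0 \<Longrightarrow> poly (sg f) t' \<noteq> 0" by blast
  have "corresponding t t'"
    unfolding corresponding_def using transc t' by (metis map_poly_0 poly_0)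
  moreover have "liftable t t' \<delta>" if "derivation_along K \<sigma> \<delta>" for \<delta>
    unfolding liftable_def using transc by (intro exI[of _ 0]) fastforce
  ultimately show ?thesis by blast
qed

text \<open>The embedding is extended before any derivation is chosen: one extension has to serve all
  derivations at once, since later the direction of the derivation varies while \<open>q'\<close> stays fixed.\<close>

lemma extend_by_one:
  assumes "countable K"
  shows "\<exists>K' \<sigma>'. K \<subseteq> K' \<and> t \<in> K' \<and> countable K' \<and> subring_of K' \<and> ring_embedding K' \<sigma>' \<and>
    (\<forall>x\<in>K. \<sigma>' x = \<sigma> x) \<and>
    (\<forall>\<delta>. derivation_along K \<sigma> \<delta> \<longrightarrow> (\<exists>\<delta>'. derivation_along K' \<sigma>' \<delta>' \<and> (\<forall>x\<in>K. \<delta>' x = \<delta> x)))"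
proof -
  obtain t' where corr: "corresponding t t'"
    and lift: "\<And>\<delta>. derivation_along K \<sigma> \<delta> \<Longrightarrow> liftable t t' \<delta>"
    using ex_corresponding[OF assms] by blast
  define K' where "K' = (\<lambda>f. poly f t) ` PK"
  define rep where "rep y = (SOME f. f \<in> PK \<and> poly f t = y)" for y
  have rep: "rep y \<in> PK" "poly (rep y) t = y" if "y \<in> K'" for y
    using that someI_ex[of "\<lambda>f. f \<in> PK \<and> poly f t = y"] unfolding K'_def rep_def by blast+
  have mem: "poly f t \<in> K'" if "f \<in> PK" for f using that by (auto simp: K'_def)
  define \<sigma>' where "\<sigma>' y = poly (sg (rep y)) t'" for y
  have vanish: "poly f t = 0 \<longleftrightarrow> poly (sg f) t' = 0" if "f \<in> PK" for f
    using corr that by (auto simp: corresponding_def)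
  have sg_sub: "sg (f - g) = sg f - sg g" if "f \<in> PK" "g \<in> PK" for f g
    using that by (intro poly_eqI) (simp add: \<sigma>_diff)
  have \<sigma>'_poly: "\<sigma>' (poly f t) = poly (sg f) t'" if f: "f \<in> PK" for f
    using vanish[OF PK_diff[OF rep(1)[OF mem[OF f]] f]] rep[OF mem[OF f]] sg_sub[OF rep(1)[OF mem[OF f]] f]
    by (simp add: \<sigma>'_def)
  have emb: "ring_embedding K' \<sigma>'"
    unfolding ring_embedding_def
  proof (intro conjI ballI impI)
    show "\<sigma>' 1 = 1" using \<sigma>'_poly[OF PK_const[of 1]] by simp
  next
    fix x y assume "x \<in> K'" "y \<in> K'"
    then obtain f g where fg: "f \<in> PK" "g \<in> PK" "x = poly f t" "y = poly g t" by (auto simp: K'_def)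
    show "\<sigma>' (x + y) = \<sigma>' x + \<sigma>' y"
      using \<sigma>'_poly[OF PK_add[OF fg(1,2)]] fg \<sigma>'_poly by (simp add: sg_add)
    show "\<sigma>' (x * y) = \<sigma>' x * \<sigma>' y"
      using \<sigma>'_poly[OF PK_mult[OF fg(1,2)]] fg \<sigma>'_poly by (simp add: sg_mult)
  next
    fix x assume "x \<in> K'" "\<sigma>' x = 0"
    then show "x = 0" using vanish \<sigma>'_poly by (auto simp: K'_def)
  qed
  have sub: "subring_of K'"
    unfolding subring_of_def
  proof (intro conjI ballI)
    show "0 \<in> K'" using mem[OF PK_0] by simp
    show "1 \<in> K'" using mem[OF PK_const[of 1]] by simp
  next
    fix x y assume "x \<in> K'" "y \<in> K'"
    then obtain f g where fg: "f \<in> PK" "g \<in> PK" "x = poly f t" "y = poly g t" by (auto simp: K'_def)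
    show "x + y \<in> K'" using mem[OF PK_add[OF fg(1,2)]] fg by simp
    show "x * y \<in> K'" using mem[OF PK_mult[OF fg(1,2)]] fg by simp
  next
    fix x assume "x \<in> K'"
    then obtain f where "f \<in> PK" "x = poly f t" by (auto simp: K'_def)
    then show "- x \<in> K'" using mem[OF PK_uminus[of f]] by simp
  qed
  have KK': "x \<in> K'" "\<sigma>' x = \<sigma> x" if "x \<in> K" for x
    using mem[OF PK_const[OF that]] \<sigma>'_poly[OF PK_const[OF that]] by simp_all
  have tK': "t \<in> K'" using mem[OF PK_monom[of 1 1]] by (simp add: poly_monom)
  have "countable PK" by (rule countable_PK[OF assms])
  then have cK': "countable K'" by (simp add: K'_def)
  have der: "\<exists>\<delta>'. derivation_along K' \<sigma>' \<delta>' \<and> (\<forall>x\<in>K. \<delta>' x = \<delta> x)" if "derivation_along K \<sigma> \<delta>" for \<delta>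
  proof -
    interpret embedded_ring_derivation K \<sigma> \<delta>
      using K \<sigma> that by unfold_locales
    obtain b where b: "\<And>f. f \<in> PK \<Longrightarrow> poly f t = 0 \<Longrightarrow> ext_at t' b f = 0"
      using lift[OF \<delta>] unfolding liftable_def ext_at_def by blast
    define \<delta>' where "\<delta>' y = ext_at t' b (rep y)" for y
    have \<delta>'_poly: "\<delta>' (poly f t) = ext_at t' b f" if f: "f \<in> PK" for f
    proof -
      have r: "rep (poly f t) \<in> PK" using rep(1)[OF mem[OF f]] .
      have "ext_at t' b (rep (poly f t) - f) = 0"
        using b[OF PK_diff[OF r f]] rep(2)[OF mem[OF f]] by simp
      then show ?thesis
        using ext_at_add[OF PK_diff[OF r f] f, of t' b] by (simp add: \<delta>'_def)
    qed
    have "derivation_along K' \<sigma>' \<delta>'"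
      unfolding derivation_along_def
    proof (intro ballI conjI)
      fix x y assume "x \<in> K'" "y \<in> K'"
      then obtain f g where fg: "f \<in> PK" "g \<in> PK" "x = poly f t" "y = poly g t" by (auto simp: K'_def)
      show "\<delta>' (x + y) = \<delta>' x + \<delta>' y"
        using \<delta>'_poly[OF PK_add[OF fg(1,2)]] fg \<delta>'_poly by (simp add: ext_at_add)
      show "\<delta>' (x * y) = \<sigma>' x * \<delta>' y + \<delta>' x * \<sigma>' y"
        using \<delta>'_poly[OF PK_mult[OF fg(1,2)]] fg \<delta>'_poly \<sigma>'_poly by (simp add: ext_at_mult)
    qed
    moreover have "\<delta>' x = \<delta> x" if "x \<in> K" for x
      using \<delta>'_poly[OF PK_const[OF that]] by (simp add: ext_at_def dl_const pderiv_pCons)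
    ultimately show ?thesis by blast
  qed
  show ?thesis using KK' tK' cK' sub emb der by blast
qed

end

lemma extend_to_finite_set:
  assumes "finite T" "countable K" "subring_of K" "ring_embedding K \<sigma>"
  shows "\<exists>K' \<sigma>'. K \<subseteq> K' \<and> T \<subseteq> K' \<and> countable K' \<and> subring_of K' \<and> ring_embedding K' \<sigma>' \<and>
    (\<forall>x\<in>K. \<sigma>' x = \<sigma> x) \<and>
    (\<forall>\<delta>. derivation_along K \<sigma> \<delta> \<longrightarrow> (\<exists>\<delta>'. derivation_along K' \<sigma>' \<delta>' \<and> (\<forall>x\<in>K. \<delta>' x = \<delta> x)))"
  using assms(1)
proof induction
  case empty
  show ?case using assms by (intro exI[of _ K] exI[of _ \<sigma>]) auto
next
  case (insert t T)
  then obtain K1 \<sigma>1 where 1: "K \<subseteq> K1" "T \<subseteq> K1" "countable K1" "subring_of K1" "ring_embedding K1 \<sigma>1"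
    "\<forall>x\<in>K. \<sigma>1 x = \<sigma> x"
    "\<And>\<delta>. derivation_along K \<sigma> \<delta> \<Longrightarrow> \<exists>\<delta>'. derivation_along K1 \<sigma>1 \<delta>' \<and> (\<forall>x\<in>K. \<delta>' x = \<delta> x)"
    by blast
  interpret embedded_ring K1 \<sigma>1 using 1 by unfold_locales
  obtain K2 \<sigma>2 where 2: "K1 \<subseteq> K2" "t \<in> K2" "countable K2" "subring_of K2" "ring_embedding K2 \<sigma>2"
    "\<forall>x\<in>K1. \<sigma>2 x = \<sigma>1 x"
    "\<And>\<delta>. derivation_along K1 \<sigma>1 \<delta> \<Longrightarrow> \<exists>\<delta>'. derivation_along K2 \<sigma>2 \<delta>' \<and> (\<forall>x\<in>K1. \<delta>' x = \<delta> x)"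
    using extend_by_one[OF 1(3), of t] by blast
  have "\<exists>\<delta>'. derivation_along K2 \<sigma>2 \<delta>' \<and> (\<forall>x\<in>K. \<delta>' x = \<delta> x)" if "derivation_along K \<sigma> \<delta>" for \<delta>
  proof -
    obtain \<delta>1 where d1: "derivation_along K1 \<sigma>1 \<delta>1" "\<forall>x\<in>K. \<delta>1 x = \<delta> x" using 1(7)[OF \<open>derivation_along K \<sigma> \<delta>\<close>] by blast
    obtain \<delta>2 where d2: "derivation_along K2 \<sigma>2 \<delta>2" "\<forall>x\<in>K1. \<delta>2 x = \<delta>1 x" using 2(7)[OF d1(1)] by blast
    have "\<forall>x\<in>K. \<delta>2 x = \<delta> x" using d1(2) d2(2) 1(1) by (metis subsetD)
    then show ?thesis using d2(1) by blast
  qed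
  moreover have "\<forall>x\<in>K. \<sigma>2 x = \<sigma> x" using 1(1,6) 2(6) by (metis subsetD)
  moreover have "K \<subseteq> K2" "insert t T \<subseteq> K2" using 1(1,2) 2(1,2) by auto
  ultimately show ?case using 2(3,4,5) by (intro exI[of _ K2] exI[of _ \<sigma>2]) blast
qed

section \<open>Families of vectors\<close>

text \<open>The set \<open>C\<close> of coordinates varies: for rows of the Jacobian all columns are needed, for dimension
  counts it has to be finite.\<close>

definition indep_family :: "'j set \<Rightarrow> 'c set \<Rightarrow> ('j \<Rightarrow> 'c \<Rightarrow> complex) \<Rightarrow> bool" where
  "indep_family J C f \<longleftrightarrow>
     (\<forall>u. (\<forall>c\<in>C. (\<Sum>j\<in>J. u j * f j c) = 0) \<longrightarrow> (\<forall>j\<in>J. u j = 0))"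

lemma indep_familyD:
  "indep_family J C f \<Longrightarrow> (\<And>c. c \<in> C \<Longrightarrow> (\<Sum>j\<in>J. u j * f j c) = 0) \<Longrightarrow> j \<in> J \<Longrightarrow> u j = 0"
  unfolding indep_family_def by blast

lemma sum_cscale: "(\<Sum>j\<in>J. cscale (u j) (f j)) x = (\<Sum>j\<in>J. u j * f j x)"
  by (induction J rule: infinite_finite_induct) (auto simp: cscale_def)

lemma indep_family_iff_independent:
  assumes "finite J"
  shows "indep_family J UNIV f \<longleftrightarrow> inj_on f J \<and> cfun.independent (f ` J)"
proof
  assume *: "indep_family J UNIV f"
  have inj: "inj_on f J"
  proof (rule inj_onI, rule ccontr)
    fix i j assume ij: "i \<in> J" "j \<in> J" "f i = f j" "i \<noteq> j"
    let ?u = "\<lambda>k. if k = i then 1 else if k = j then - 1 else 0 :: complex"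
    have "(\<Sum>k\<in>J. ?u k * f k c) = 0" for c
    proof -
      have "(\<Sum>k\<in>J. ?u k * f k c) = (\<Sum>k\<in>{i, j}. ?u k * f k c)"
        using assms ij by (intro sum.mono_neutral_right) auto
      then show ?thesis using ij by simp
    qed
    then have "?u i = 0" using indep_familyD[OF *, of ?u i] ij by blast
    then show False by simp
  qed
  have "cfun.independent (f ` J)"
  proof
    assume "cfun.dependent (f ` J)"
    then obtain w v where w: "v \<in> f ` J" "w v \<noteq> 0" "(\<Sum>v\<in>f ` J. cscale (w v) v) = 0"
      using cfun.dependent_finite[of "f ` J"] assms by auto
    have "(\<Sum>j\<in>J. w (f j) * f j c) = 0" for c
    proof -
      have "(\<Sum>v\<in>f ` J. cscale (w v) v) = (\<Sum>j\<in>J. cscale (w (f j)) (f j))"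
        by (rule sum.reindex[OF inj, unfolded o_def])
      then show ?thesis using w(3) sum_cscale[of "\<lambda>j. w (f j)" f J c] by simp
    qed
    then show False using indep_familyD[OF *, of "\<lambda>j. w (f j)"] w by blast
  qed
  with inj show "inj_on f J \<and> cfun.independent (f ` J)" by blast
next
  assume *: "inj_on f J \<and> cfun.independent (f ` J)"
  show "indep_family J UNIV f"
    unfolding indep_family_def
  proof (intro allI impI ballI)
    fix u j assume u: "\<forall>c\<in>UNIV. (\<Sum>j\<in>J. u j * f j c) = 0" and j: "j \<in> J"
    let ?w = "\<lambda>v. u (the_inv_into J f v)"
    have "(\<Sum>v\<in>f ` J. cscale (?w v) v) = (\<Sum>j\<in>J. cscale (?w (f j)) (f j))"
      by (rule sum.reindex[of f J, unfolded o_def]) (use * in simp)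
    also have "\<dots> = (\<Sum>j\<in>J. cscale (u j) (f j))"
      using * by (intro sum.cong) (auto simp: the_inv_into_f_f)
    also have "\<dots> = 0" using u sum_cscale[of u f J] by (auto simp: fun_eq_iff)
    finally have comb: "(\<Sum>v\<in>f ` J. cscale (?w v) v) = 0" .
    have "?w (f j) = 0"
    proof (rule ccontr)
      assume "?w (f j) \<noteq> 0"
      then have "cfun.dependent (f ` J)"
        using assms j comb
        by (intro cfun.dependent_finite[THEN iffD2] exI[of _ ?w] conjI bexI[of _ "f j"]) auto
      then show False using * by blast
    qed
    then show "u j = 0" using * j by (simp add: the_inv_into_f_f)
  qed
qed

text \<open>Functions on \<open>C\<close> form a space of dimension \<open>card C\<close>; the second part says that an independent
  family of this size spans it.\<close>

lemma indep_family_card: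
  assumes "finite J" "finite C" "indep_family J C f"
  shows "card J \<le> card C"
    and "card J = card C \<Longrightarrow> \<exists>u. \<forall>c\<in>C. (\<Sum>j\<in>J. u j * f j c) = g c"
proof -
  define r where "r h = (\<lambda>c. if c \<in> C then h c else 0 :: complex)" for h :: "'b \<Rightarrow> complex"
  have ind: "indep_family J UNIV (\<lambda>j. r (f j))"
    unfolding indep_family_def
  proof (intro allI impI ballI)
    fix u j assume u: "\<forall>c\<in>UNIV. (\<Sum>j\<in>J. u j * r (f j) c) = 0" and j: "j \<in> J"
    have "(\<Sum>j\<in>J. u j * f j c) = 0" if "c \<in> C" for c
      using bspec[OF u, of c] that by (simp add: r_def)
    then show "u j = 0" using indep_familyD[OF assms(3)] j by blast
  qed
  then have inj: "inj_on (\<lambda>j. r (f j)) J" and indep: "cfun.independent ((\<lambda>j. r (f j)) ` J)"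
    using indep_family_iff_independent[OF assms(1)] by blast+
  define D where "D = (\<lambda>c x. if x = c then 1 else 0 :: complex) ` C"
  have fD: "finite D" and cD: "card D \<le> card C"
    using assms(2) by (auto simp: D_def card_image_le)
  have span: "r h \<in> cfun.span D" for h
  proof -
    have "r h = (\<Sum>c\<in>C. cscale (h c) (\<lambda>x. if x = c then 1 else 0))"
    proof
      fix x show "r h x = (\<Sum>c\<in>C. cscale (h c) (\<lambda>x. if x = c then 1 else 0)) x"
        using assms(2) by (simp add: sum_cscale r_def if_distrib[of "(*) _"] cong: if_cong)
    qed
    also have "\<dots> \<in> cfun.span D"
      by (intro cfun.span_sum cfun.span_scale cfun.span_base) (auto simp: D_def)
    finally show ?thesis .
  qed
  have cJ: "card ((\<lambda>j. r (f j)) ` J) = card J" using inj by (rule card_image)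
  have bound: "card S \<le> card C" if "cfun.independent S" "S \<subseteq> cfun.span D" for S
    using cfun.independent_span_bound[OF fD that] cD by auto
  have sub: "(\<lambda>j. r (f j)) ` J \<subseteq> cfun.span D" using span by blast
  show "card J \<le> card C" using bound[OF indep sub] cJ by simp
  assume eq: "card J = card C"
  have "r g \<in> cfun.span ((\<lambda>j. r (f j)) ` J)"
  proof (rule ccontr)
    assume n: "r g \<notin> cfun.span ((\<lambda>j. r (f j)) ` J)"
    then have "cfun.independent (insert (r g) ((\<lambda>j. r (f j)) ` J))"
      using indep by (rule cfun.independent_insertI)
    moreover have "r g \<notin> (\<lambda>j. r (f j)) ` J"
    proof
      assume "r g \<in> (\<lambda>j. r (f j)) ` J"
      then have "r g \<in> cfun.span ((\<lambda>j. r (f j)) ` J)" by (rule cfun.span_base)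
      with n show False by contradiction
    qed
    then have "card (insert (r g) ((\<lambda>j. r (f j)) ` J)) = Suc (card J)"
      using assms(1) cJ by simp
    moreover have "insert (r g) ((\<lambda>j. r (f j)) ` J) \<subseteq> cfun.span D"
      using sub span by (intro insert_subsetI)
    ultimately show False using bound[of "insert (r g) ((\<lambda>j. r (f j)) ` J)"] eq by linarith
  qed
  then have "r g \<in> range (\<lambda>w. \<Sum>v\<in>(\<lambda>j. r (f j)) ` J. cscale (w v) v)"
    by (simp only: cfun.span_finite[OF finite_imageI[OF assms(1)]])
  then obtain w where w: "r g = (\<Sum>v\<in>(\<lambda>j. r (f j)) ` J. cscale (w v) v)"
    by (elim rangeE)
  also have "\<dots> = (\<Sum>j\<in>J. cscale (w (r (f j))) (r (f j)))"
    by (rule sum.reindex[OF inj, unfolded o_def])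
  finally have eq: "r g c = (\<Sum>j\<in>J. w (r (f j)) * r (f j) c)" for c
    using sum_cscale[of "\<lambda>j. w (r (f j))" "\<lambda>j. r (f j)" J c] by simp
  show "\<exists>u. \<forall>c\<in>C. (\<Sum>j\<in>J. u j * f j c) = g c"
  proof (intro exI ballI)
    fix c assume "c \<in> C"
    then show "(\<Sum>j\<in>J. w (r (f j)) * f j c) = g c" using eq[of c] by (simp add: r_def)
  qed
qed

section \<open>Equilibrium stresses\<close>

definition mv :: "'a set \<Rightarrow> ('a \<Rightarrow> 'a \<Rightarrow> complex) \<Rightarrow> ('a \<Rightarrow> complex) \<Rightarrow> 'a \<Rightarrow> complex" where
  "mv X W f x = (\<Sum>y\<in>X. W x y * f y)"

definition dot :: "'a set \<Rightarrow> ('a \<Rightarrow> complex) \<Rightarrow> ('a \<Rightarrow> complex) \<Rightarrow> complex" where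
  "dot X f g = (\<Sum>x\<in>X. f x * g x)"

text \<open>The matrix form of an equilibrium stress: the off-diagonal entries are the negated coefficients, the
  diagonal is determined by zero row sums, and the columns of coordinates lie in the kernel. This makes
  rescaling by a diagonal matrix, and hence projection from a vertex, a matrix operation.\<close>

definition stress :: "nat \<Rightarrow> 'a config \<Rightarrow> 'a set \<Rightarrow> 'a set set \<Rightarrow> ('a \<Rightarrow> 'a \<Rightarrow> complex) \<Rightarrow> bool" where
  "stress d p X E W \<longleftrightarrow>
     (\<forall>x y. W x y = W y x) \<and> (\<forall>x y. x \<notin> X \<longrightarrow> W x y = 0) \<and>
     (\<forall>x y. x \<noteq> y \<longrightarrow> {x, y} \<notin> E \<longrightarrow> W x y = 0) \<and>
     (\<forall>x\<in>X. mv X W (\<lambda>_. 1) x = 0) \<and> (\<forall>i<d. \<forall>x\<in>X. mv X W (\<lambda>y. p y i) x = 0)"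

text \<open>For a symmetric matrix this is the off-diagonal entry at an unordered pair; averaging over the two
  orders makes it visibly linear in the matrix.\<close>

definition entry :: "('a \<Rightarrow> 'a \<Rightarrow> complex) \<Rightarrow> 'a set \<Rightarrow> complex" where
  "entry W e = (\<Sum>x\<in>e. \<Sum>y\<in>e - {x}. W x y) / 2"

definition affine_functions :: "nat \<Rightarrow> 'a config \<Rightarrow> ('a \<Rightarrow> complex) set" where
  "affine_functions d p = {\<lambda>x. c + (\<Sum>i<d. b i * p x i) | c b. True}"

lemma stress_sym: "stress d p X E W \<Longrightarrow> W x y = W y x"
  and stress_outside: "stress d p X E W \<Longrightarrow> x \<notin> X \<Longrightarrow> W x y = 0"
  and stress_nonedge: "stress d p X E W \<Longrightarrow> x \<noteq> y \<Longrightarrow> {x, y} \<notin> E \<Longrightarrow> W x y = 0"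
  and stress_one: "stress d p X E W \<Longrightarrow> x \<in> X \<Longrightarrow> mv X W (\<lambda>_. 1) x = 0"
  and stress_coord: "stress d p X E W \<Longrightarrow> i < d \<Longrightarrow> x \<in> X \<Longrightarrow> mv X W (\<lambda>y. p y i) x = 0"
  unfolding stress_def by simp_all

lemma stress_outside': "stress d p X E W \<Longrightarrow> y \<notin> X \<Longrightarrow> W x y = 0"
  using stress_outside[of d p X E W y x] stress_sym[of d p X E W x y] by simp

lemma mv_outside: "stress d p X E W \<Longrightarrow> x \<notin> X \<Longrightarrow> mv X W f x = 0"
  by (simp add: mv_def stress_outside)

lemma entry_pair: "W u v = W v u \<Longrightarrow> u \<noteq> v \<Longrightarrow> entry W {u, v} = W u v"
  by (simp add: entry_def insert_Diff_if)

lemma entry_stress: "stress d p X E W \<Longrightarrow> u \<noteq> v \<Longrightarrow> entry W {u, v} = W u v"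
  by (rule entry_pair) (auto intro: stress_sym)

lemma entry_add: "entry (\<lambda>x y. A x y + B x y) e = entry A e + entry B e"
  by (simp add: entry_def sum.distrib add_divide_distrib)

lemma entry_scale: "entry (\<lambda>x y. c * A x y) e = c * entry A e"
  by (simp add: entry_def sum_distrib_left[symmetric])

lemma entry_sum: "entry (\<lambda>x y. \<Sum>j\<in>J. A j x y) e = (\<Sum>j\<in>J. entry (A j) e)"
proof (induction J rule: infinite_finite_induct)
  case (insert j J)
  then show ?case by (simp add: entry_add)
qed (simp_all add: entry_def)

lemma mv_add: "mv X (\<lambda>x y. A x y + B x y) f x = mv X A f x + mv X B f x"
  by (simp add: mv_def distrib_right sum.distrib)

lemma mv_scale: "mv X (\<lambda>x y. c * A x y) f x = c * mv X A f x"
  by (simp add: mv_def sum_distrib_left mult.assoc)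

lemma mv_diff: "mv X (\<lambda>x y. A x y - B x y) f x = mv X A f x - mv X B f x"
  by (simp add: mv_def left_diff_distrib sum_subtractf)

lemma mv_fun_add: "mv X W (\<lambda>y. f y + g y) x = mv X W f x + mv X W g x"
  by (simp add: mv_def distrib_left sum.distrib)

lemma mv_fun_diff: "mv X W (\<lambda>y. f y - g y) x = mv X W f x - mv X W g x"
  by (simp add: mv_def right_diff_distrib sum_subtractf)

lemma mv_fun_scale: "mv X W (\<lambda>y. c * f y) x = c * mv X W f x"
  by (simp add: mv_def sum_distrib_left mult_ac)

lemma mv_fun_sum: "mv X W (\<lambda>y. \<Sum>j\<in>J. f j y) x = (\<Sum>j\<in>J. mv X W (f j) x)"
  unfolding mv_def sum_distrib_left by (rule sum.swap)

lemma dot_mv_sym: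
  assumes "\<And>x y. W x y = W y x"
  shows "dot X f (mv X W g) = dot X g (mv X W f)"
proof -
  have "dot X f (mv X W g) = (\<Sum>x\<in>X. \<Sum>y\<in>X. f x * W x y * g y)"
    by (simp add: dot_def mv_def sum_distrib_left mult.assoc)
  also have "\<dots> = (\<Sum>y\<in>X. \<Sum>x\<in>X. f x * W x y * g y)" by (rule sum.swap)
  also have "\<dots> = dot X g (mv X W f)"
    unfolding dot_def mv_def sum_distrib_left
    by (intro sum.cong refl) (use assms in \<open>simp add: mult_ac\<close>)
  finally show ?thesis .
qed

lemma stress_zero: "stress d p X E (\<lambda>_ _. 0)"
  by (simp add: stress_def mv_def)

lemma stress_add: "stress d p X E A \<Longrightarrow> stress d p X E B \<Longrightarrow> stress d p X E (\<lambda>x y. A x y + B x y)"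
  unfolding stress_def by (auto simp: mv_add)

lemma stress_scale: "stress d p X E A \<Longrightarrow> stress d p X E (\<lambda>x y. c * A x y)"
  unfolding stress_def by (auto simp: mv_scale)

lemma stress_sum:
  "(\<And>j. j \<in> J \<Longrightarrow> stress d p X E (A j)) \<Longrightarrow> stress d p X E (\<lambda>x y. \<Sum>j\<in>J. A j x y)"
proof (induction J rule: infinite_finite_induct)
  case (insert j J)
  then show ?case using stress_add[of d p X E "A j" "\<lambda>x y. \<Sum>j\<in>J. A j x y"] by simp
qed (simp_all add: stress_zero)

lemma stress_diff:
  assumes "stress d p X E A" "stress d p X E B"
  shows "stress d p X E (\<lambda>x y. A x y - B x y)"
  using stress_add[OF assms(1) stress_scale[OF assms(2), of "- 1"]] by simp

lemma stress_restrict: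
  assumes "stress d p X E W" "\<And>x y. x \<noteq> y \<Longrightarrow> {x, y} \<in> E - E' \<Longrightarrow> W x y = 0"
  shows "stress d p X E' W"
proof -
  have "W x y = 0" if "x \<noteq> y" "{x, y} \<notin> E'" for x y
    using assms(2) stress_nonedge[OF assms(1)] that by (cases "{x, y} \<in> E") auto
  then show ?thesis using assms(1) unfolding stress_def by simp
qed

lemma stress_mono: "stress d p X E W \<Longrightarrow> E \<subseteq> E' \<Longrightarrow> stress d p X E' W"
  by (rule stress_restrict) auto

lemma stress_affine:
  assumes "stress d p X E W" "a \<in> affine_functions d p"
  shows "mv X W a x = 0"
proof (cases "x \<in> X")
  case True
  obtain c b where a: "a = (\<lambda>x. c + (\<Sum>i<d. b i * p x i))" using assms(2) by (auto simp: affine_functions_def)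
  have "mv X W (\<lambda>_. c) x = 0"
    using mv_fun_scale[of X W c "\<lambda>_. 1" x] stress_one[OF assms(1) True] by simp
  then show ?thesis
    using stress_coord[OF assms(1) _ True] unfolding a by (simp add: mv_fun_add mv_fun_sum mv_fun_scale)
qed (use mv_outside[OF assms(1)] in blast)

lemma affine_add:
  assumes "a \<in> affine_functions d p" "b \<in> affine_functions d p"
  shows "(\<lambda>x. a x + b x) \<in> affine_functions d p"
proof -
  obtain c u where a: "a = (\<lambda>x. c + (\<Sum>i<d. u i * p x i))" using assms(1) by (auto simp: affine_functions_def)
  obtain c' u' where b: "b = (\<lambda>x. c' + (\<Sum>i<d. u' i * p x i))" using assms(2) by (auto simp: affine_functions_def)
  have "(\<lambda>x. a x + b x) = (\<lambda>x. (c + c') + (\<Sum>i<d. (u i + u' i) * p x i))"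
    by (simp add: a b fun_eq_iff algebra_simps sum.distrib)
  then show ?thesis by (auto simp: affine_functions_def)
qed

lemma affine_scale:
  assumes "a \<in> affine_functions d p"
  shows "(\<lambda>x. r * a x) \<in> affine_functions d p"
proof -
  obtain c u where a: "a = (\<lambda>x. c + (\<Sum>i<d. u i * p x i))" using assms(1) by (auto simp: affine_functions_def)
  have "(\<lambda>x. r * a x) = (\<lambda>x. r * c + (\<Sum>i<d. (r * u i) * p x i))"
    by (simp add: a fun_eq_iff algebra_simps sum_distrib_left)
  then show ?thesis
    unfolding affine_functions_def by (intro CollectI exI[of _ "r * c"] exI[of _ "\<lambda>i. r * u i"]) simp
qed

lemma affine_const: "(\<lambda>x. c) \<in> affine_functions d p"
  unfolding affine_functions_def by (intro CollectI exI[of _ c] exI[of _ "\<lambda>_. 0"]) simp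

lemma affine_coord:
  assumes "i < d"
  shows "(\<lambda>x. p x i) \<in> affine_functions d p"
  unfolding affine_functions_def
  by (intro CollectI exI[of _ 0] exI[of _ "\<lambda>j. if j = i then 1 else 0"])
     (use assms in \<open>simp add: if_distrib[of "\<lambda>c. c * _"] cong: if_cong\<close>)

lemma affine_sum:
  "(\<And>j. j \<in> J \<Longrightarrow> a j \<in> affine_functions d p) \<Longrightarrow> (\<lambda>x. \<Sum>j\<in>J. a j x) \<in> affine_functions d p"
  by (induction J rule: infinite_finite_induct) (auto intro: affine_const affine_add)

text \<open>The matrix is symmetric and kills affine functions, so its image is orthogonal to them.\<close>

lemma stress_dot_affine:
  assumes "stress d p X E W" "a \<in> affine_functions d p"
  shows "dot X a (mv X W f) = 0"
  using dot_mv_sym[of W X a f] stress_sym[OF assms(1)] stress_affine[OF assms] by (simp add: dot_def)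

text \<open>Zero row sums turn the bilinear form of a symmetric matrix into its Laplacian form.\<close>

lemma laplacian_form:
  assumes "\<And>x y. W x y = W y x" "\<And>x. x \<in> X \<Longrightarrow> mv X W (\<lambda>_. 1) x = 0"
  shows "(\<Sum>x\<in>X. \<Sum>y\<in>X. W x y * ((f x - f y) * (g x - g y))) = - 2 * dot X f (mv X W g)"
proof -
  have row: "(\<Sum>y\<in>X. W x y) = 0" if "x \<in> X" for x using assms(2)[OF that] by (simp add: mv_def)
  have col: "(\<Sum>x\<in>X. W x y) = 0" if "y \<in> X" for y using row[OF that] by (simp add: assms(1)[of _ y])
  have "(\<Sum>x\<in>X. \<Sum>y\<in>X. W x y * ((f x - f y) * (g x - g y))) =
      (\<Sum>x\<in>X. \<Sum>y\<in>X. f x * g x * W x y) + (\<Sum>x\<in>X. \<Sum>y\<in>X. f y * g y * W x y)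
      - (\<Sum>x\<in>X. \<Sum>y\<in>X. f x * (W x y * g y)) - (\<Sum>x\<in>X. \<Sum>y\<in>X. g x * (W x y * f y))"
    by (simp add: sum.distrib[symmetric] sum_subtractf[symmetric] algebra_simps)
  also have "(\<Sum>x\<in>X. \<Sum>y\<in>X. f x * g x * W x y) = 0"
    by (simp add: sum_distrib_left[symmetric] row)
  also have "(\<Sum>x\<in>X. \<Sum>y\<in>X. f y * g y * W x y) = 0"
    by (subst sum.swap) (simp add: sum_distrib_left[symmetric] col)
  also have "(\<Sum>x\<in>X. \<Sum>y\<in>X. f x * (W x y * g y)) = dot X f (mv X W g)"
    by (simp add: dot_def mv_def sum_distrib_left)
  also have "(\<Sum>x\<in>X. \<Sum>y\<in>X. g x * (W x y * f y)) = dot X g (mv X W f)"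
    by (simp add: dot_def mv_def sum_distrib_left)
  also have "dot X g (mv X W f) = dot X f (mv X W g)" by (rule dot_mv_sym[OF assms(1)])
  finally show ?thesis by simp
qed

section \<open>Stresses and the rigidity matroid\<close>

definition pairs :: "'a set \<Rightarrow> 'a set set" where
  "pairs X = {e. e \<subseteq> X \<and> card e = 2}"

lemma finite_pairs: "finite X \<Longrightarrow> finite (pairs X)"
  by (rule finite_subset[of _ "Pow X"]) (auto simp: pairs_def)

lemma pairsE:
  assumes "e \<in> pairs X"
  obtains u v where "e = {u, v}" "u \<noteq> v" "u \<in> X" "v \<in> X"
  using assms by (auto simp: pairs_def card_2_iff)

lemma stress_zero_iff_entries:
  assumes "stress d p X E W" "finite X" "\<And>e. e \<in> E \<Longrightarrow> entry W e = 0"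
  shows "W = (\<lambda>_ _. 0)"
proof -
  have off: "W x y = 0" if "x \<noteq> y" for x y
    using assms(3)[of "{x, y}"] entry_stress[OF assms(1) that] stress_nonedge[OF assms(1) that] by metis
  have "W x x = 0" for x
  proof (cases "x \<in> X")
    case True
    have "0 = (\<Sum>y\<in>X. W x y)" using stress_one[OF assms(1) True] by (simp add: mv_def)
    also have "\<dots> = W x x + (\<Sum>y\<in>X - {x}. W x y)" using True assms(2) by (rule sum.remove[rotated])
    also have "(\<Sum>y\<in>X - {x}. W x y) = 0" by (intro sum.neutral ballI off) auto
    finally show ?thesis by simp
  qed (use stress_outside[OF assms(1)] in blast)
  with off show ?thesis by (metis (no_types))
qed

lemma edge_ends:
  assumes "e \<in> E" "E \<subseteq> pairs X"
  shows "\<exists>u v. e = {u, v} \<and> u \<noteq> v \<and> u \<in> X \<and> v \<in> X"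
proof -
  have "e \<in> pairs X" using assms by blast
  then show ?thesis by (rule pairsE) blast
qed

text \<open>A linear dependence \<open>\<omega>\<close> between the rows of the Jacobian is the same as the stress matrix whose
  off-diagonal entries are \<open>- \<omega>\<close>.\<close>

lemma jacobian_row_sum:
  assumes "finite X" "E \<subseteq> pairs X" "x \<in> X"
  shows "(\<Sum>e\<in>E. w e * jacobian_row d p e (x, i)) =
    (if i < d then 2 * (\<Sum>y | y \<in> X \<and> {x, y} \<in> E. w {x, y} * (p x i - p y i)) else 0)"
proof -
  let ?Y = "{y \<in> X. {x, y} \<in> E}"
  have fE: "finite E" using assms finite_pairs finite_subset by metis
  have xne: "x \<noteq> y" if "{x, y} \<in> E" for y using assms(2) that by (auto simp: pairs_def)
  have away: "jacobian_row d p e (x, i) = 0" if "e \<in> E" "x \<notin> e" for e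
  proof -
    obtain u v where "e = {u, v}" "u \<noteq> v" using edge_ends[OF \<open>e \<in> E\<close> assms(2)] by blast
    then show ?thesis using that(2) by (auto simp: jacobian_row_pair)
  qed
  have "(\<Sum>e\<in>E. w e * jacobian_row d p e (x, i)) = (\<Sum>e\<in>(\<lambda>y. {x, y}) ` ?Y. w e * jacobian_row d p e (x, i))"
  proof (rule sum.mono_neutral_right[OF fE])
    show "\<forall>e\<in>E - (\<lambda>y. {x, y}) ` ?Y. w e * jacobian_row d p e (x, i) = 0"
    proof
      fix e assume e: "e \<in> E - (\<lambda>y. {x, y}) ` ?Y"
      obtain u v where uv: "e = {u, v}" "u \<noteq> v" "u \<in> X" "v \<in> X" using edge_ends[OF _ assms(2), of e] e by blast
      have "x \<notin> e" using e uv by (auto simp: insert_commute)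
      then show "w e * jacobian_row d p e (x, i) = 0" using away e by simp
    qed
  qed auto
  also have "\<dots> = (\<Sum>y\<in>?Y. w {x, y} * jacobian_row d p {x, y} (x, i))"
    by (rule sum.reindex[unfolded o_def]) (auto simp: inj_on_def doubleton_eq_iff)
  also have "\<dots> = (\<Sum>y\<in>?Y. if i < d then 2 * (w {x, y} * (p x i - p y i)) else 0)"
    by (intro sum.cong refl) (use xne in \<open>simp add: jacobian_row_pair\<close>)
  also have "\<dots> = (if i < d then 2 * (\<Sum>y | y \<in> X \<and> {x, y} \<in> E. w {x, y} * (p x i - p y i)) else 0)"
    by (simp add: sum_distrib_left)
  finally show ?thesis .
qed

lemma jacobian_row_outside:
  assumes "E \<subseteq> pairs X" "x \<notin> X" "e \<in> E"
  shows "jacobian_row d p e (x, i) = 0"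
proof -
  obtain u v where "e = {u, v}" "u \<noteq> v" "u \<in> X" "v \<in> X" using edge_ends[OF assms(3,1)] by blast
  then show ?thesis using assms(2) by (auto simp: jacobian_row_pair)
qed

lemma rigidity_indep_iff_family:
  "finite E \<Longrightarrow> rigidity_indep d p E \<longleftrightarrow> indep_family E UNIV (jacobian_row d p)"
  by (simp add: rigidity_indep_def indep_family_iff_independent)

lemma rigidity_indep_iff_stress:
  assumes X: "finite X" and E: "E \<subseteq> pairs X"
  shows "rigidity_indep d p E \<longleftrightarrow> (\<forall>W. stress d p X E W \<longrightarrow> W = (\<lambda>_ _. 0))"
proof -
  have fE: "finite E" using assms finite_pairs finite_subset by metis
  have xne: "x \<noteq> y" if "{x, y} \<in> E" for x y using assms(2) that by (auto simp: pairs_def)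
  have inX: "x \<in> X" "y \<in> X" if "{x, y} \<in> E" for x y using assms(2) that by (auto simp: pairs_def)
  show ?thesis
    unfolding rigidity_indep_iff_family[OF fE]
  proof
    assume ind: "indep_family E UNIV (jacobian_row d p)"
    show "\<forall>W. stress d p X E W \<longrightarrow> W = (\<lambda>_ _. 0)"
    proof (intro allI impI)
      fix W assume W: "stress d p X E W"
      have "(\<Sum>e\<in>E. entry W e * jacobian_row d p e c) = 0" for c
      proof -
        obtain x i where c: "c = (x, i)" by fastforce
        show ?thesis
        proof (cases "x \<in> X \<and> i < d")
          case True
          have "(\<Sum>y | y \<in> X \<and> {x, y} \<in> E. entry W {x, y} * (p x i - p y i)) =
              (\<Sum>y\<in>X. W x y * (p x i - p y i))"
          proof (rule sum.mono_neutral_cong_left)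
            show "\<forall>y\<in>X - {y \<in> X. {x, y} \<in> E}. W x y * (p x i - p y i) = 0"
            proof
              fix y assume "y \<in> X - {y \<in> X. {x, y} \<in> E}"
              then show "W x y * (p x i - p y i) = 0"
                by (cases "x = y") (auto simp: stress_nonedge[OF W])
            qed
          qed (use X xne entry_stress[OF W] in auto)
          also have "\<dots> = p x i * mv X W (\<lambda>_. 1) x - mv X W (\<lambda>y. p y i) x"
            by (simp add: mv_def algebra_simps sum_subtractf sum_distrib_left)
          also have "\<dots> = 0" using stress_one[OF W] stress_coord[OF W] True by simp
          finally show ?thesis using jacobian_row_sum[OF X E, of x "entry W" d p i] True c by simp
        next
          case False
          then show ?thesis
            using jacobian_row_sum[OF X E, of x "entry W" d p i] jacobian_row_outside[OF E, of x _ d p i] c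
            by (cases "x \<in> X") auto
        qed
      qed
      then have "entry W e = 0" if "e \<in> E" for e using indep_familyD[OF ind] that by blast
      then show "W = (\<lambda>_ _. 0)" using stress_zero_iff_entries[OF W X] by blast
    qed
  next
    assume *: "\<forall>W. stress d p X E W \<longrightarrow> W = (\<lambda>_ _. 0)"
    show "indep_family E UNIV (jacobian_row d p)"
      unfolding indep_family_def
    proof (intro allI impI)
      fix w assume w: "\<forall>c\<in>UNIV. (\<Sum>e\<in>E. w e * jacobian_row d p e c) = 0"
      define off where "off x y = (if {x, y} \<in> E then w {x, y} else 0)" for x y
      define W where "W x y = (if x = y then - (\<Sum>z\<in>X. off x z) else off x y)" for x y
      have off_sym: "off x y = off y x" for x y by (simp add: off_def insert_commute)
      have off_diag: "off x x = 0" for x using xne[of x x] by (auto simp: off_def)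
      have mvW: "mv X W f x = (\<Sum>y\<in>X. off x y * (f y - f x))" if "x \<in> X" for f x
      proof -
        have "mv X W f x = W x x * f x + (\<Sum>y\<in>X - {x}. W x y * f y)"
          unfolding mv_def using that X by (rule sum.remove[rotated])
        also have "(\<Sum>y\<in>X - {x}. W x y * f y) = (\<Sum>y\<in>X. off x y * f y)"
          using X that by (intro sum.mono_neutral_cong_left) (auto simp: W_def off_diag)
        finally have "mv X W f x = - (\<Sum>z\<in>X. off x z) * f x + (\<Sum>y\<in>X. off x y * f y)"
          by (simp add: W_def[of x x])
        also have "\<dots> = (\<Sum>y\<in>X. off x y * (f y - f x))"
          by (simp add: algebra_simps sum_subtractf sum_distrib_left)
        finally show ?thesis .
      qed
      have "stress d p X E W"
        unfolding stress_def
      proof (intro conjI allI ballI impI)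
        show "W x y = W y x" for x y by (simp add: W_def off_sym)
        show "W x y = 0" if "x \<notin> X" for x y
        proof -
          have off0: "off x z = 0" for z using that inX(1)[of x z] by (auto simp: off_def)
          then show ?thesis by (simp only: W_def off0 sum.neutral_const minus_zero if_cancel)
        qed
        show "W x y = 0" if "x \<noteq> y" "{x, y} \<notin> E" for x y using that by (simp add: W_def off_def)
        show "mv X W (\<lambda>_. 1) x = 0" if "x \<in> X" for x by (simp add: mvW that)
        fix i x assume i: "i < d" and x: "x \<in> X"
        have "(\<Sum>y\<in>X. off x y * (p x i - p y i)) = (\<Sum>y | y \<in> X \<and> {x, y} \<in> E. w {x, y} * (p x i - p y i))"
          using X by (intro sum.mono_neutral_cong_right) (auto simp: off_def)
        also have "\<dots> = 0" using jacobian_row_sum[OF X E x, of w d p i] i w by simp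
        finally have "(\<Sum>y\<in>X. off x y * (p x i - p y i)) = 0" .
        then have "- (\<Sum>y\<in>X. off x y * (p x i - p y i)) = 0" by simp
        then show "mv X W (\<lambda>y. p y i) x = 0"
          unfolding mvW[OF x] sum_negf[symmetric] by (simp add: algebra_simps)
      qed
      then have W0: "W = (\<lambda>_ _. 0)" using * by blast
      show "\<forall>e\<in>E. w e = 0"
      proof
        fix e assume e: "e \<in> E"
        then obtain x y where xy: "e = {x, y}" "x \<noteq> y" using edge_ends[OF _ E, of e] by blast
        have "W x y = w e" using e xy by (simp add: W_def off_def)
        then show "w e = 0" using W0 by simp
      qed
    qed
  qed
qed

text \<open>Independence of \<open>B\<close> forces a dependence of \<open>insert e B\<close> to use \<open>e\<close>, so it can be normalised there.\<close>

lemma fundamental_stresses: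
  assumes X: "finite X" and E: "E \<subseteq> pairs X" and B: "B \<subseteq> E" "rigidity_indep d p B"
    and max: "\<And>e. e \<in> E - B \<Longrightarrow> \<not> rigidity_indep d p (insert e B)"
  obtains F where "\<And>e. e \<in> E - B \<Longrightarrow> stress d p X (insert e B) (F e)" "\<And>e. e \<in> E - B \<Longrightarrow> entry (F e) e = 1"
proof -
  have "\<exists>W. stress d p X (insert e B) W \<and> entry W e = 1" if e: "e \<in> E - B" for e
  proof -
    have sub: "insert e B \<subseteq> pairs X" using e B E by auto
    obtain W where W: "stress d p X (insert e B) W" "W \<noteq> (\<lambda>_ _. 0)"
      using max[OF e] rigidity_indep_iff_stress[OF X sub] by blast
    have "entry W e \<noteq> 0"
    proof
      assume z: "entry W e = 0"
      have "stress d p X B W"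
      proof (rule stress_restrict[OF W(1)])
        fix x y assume "x \<noteq> y" "{x, y} \<in> insert e B - B"
        then show "W x y = 0" using z entry_stress[OF W(1)] by auto
      qed
      then show False using B(2) W(2) rigidity_indep_iff_stress[OF X, of B d p] B E by blast
    qed
    then show ?thesis using stress_scale[OF W(1), of "1 / entry W e"] entry_scale[of "1 / entry W e" W e]
      by (intro exI[of _ "\<lambda>x y. (1 / entry W e) * W x y"]) auto
  qed
  then show ?thesis using that by metis
qed

lemma entry_nonedge:
  assumes "stress d p X E W" "e \<in> pairs X" "e \<notin> E"
  shows "entry W e = 0"
proof -
  obtain u v where "e = {u, v}" "u \<noteq> v" using assms(2) by (rule pairsE)
  then show ?thesis using entry_stress[OF assms(1)] stress_nonedge[OF assms(1)] assms(3) by auto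
qed

text \<open>Once the coefficients outside \<open>B\<close> are subtracted off, what remains is a stress of the independent set \<open>B\<close>.\<close>

lemma fundamental_stresses_span:
  assumes X: "finite X" and E: "E \<subseteq> pairs X" and B: "B \<subseteq> E" "rigidity_indep d p B"
    and F: "\<And>e. e \<in> E - B \<Longrightarrow> stress d p X (insert e B) (F e)" "\<And>e. e \<in> E - B \<Longrightarrow> entry (F e) e = 1"
    and W: "stress d p X E W"
  shows "W = (\<lambda>x y. \<Sum>e\<in>E - B. entry W e * F e x y)"
proof -
  let ?S = "\<lambda>x y. \<Sum>e\<in>E - B. entry W e * F e x y"
  have fE: "finite (E - B)" using X E finite_pairs finite_subset by (metis finite_Diff)
  have FE: "stress d p X E (F e)" if "e \<in> E - B" for e
    using stress_mono[OF F(1)[OF that]] that B by auto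
  have S: "stress d p X E ?S" by (intro stress_sum stress_scale FE)
  let ?R = "\<lambda>x y. W x y - ?S x y"
  have R: "stress d p X E ?R" by (rule stress_diff[OF W S])
  have F0: "entry (F f) e = (if e = f then 1 else 0)" if "e \<in> E - B" "f \<in> E - B" for e f
    using that F(2)[of f] entry_nonedge[OF F(1)[OF that(2)], of e] E by auto
  have "stress d p X B ?R"
  proof (rule stress_restrict[OF R])
    fix x y assume xy: "x \<noteq> y" "{x, y} \<in> E - B"
    have "entry ?S {x, y} = (\<Sum>e\<in>E - B. entry W e * entry (F e) {x, y})"
      by (simp add: entry_sum entry_scale)
    also have "\<dots> = (\<Sum>e\<in>E - B. if e = {x, y} then entry W {x, y} else 0)"
      using F0[OF xy(2)] by (intro sum.cong) auto
    also have "\<dots> = entry W {x, y}" using fE xy by simp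
    finally have "entry ?S {x, y} = entry W {x, y}" .
    then show "?R x y = 0" using entry_stress[OF W xy(1)] entry_stress[OF S xy(1)] by simp
  qed
  then have "?R = (\<lambda>_ _. 0)" using B rigidity_indep_iff_stress[OF X, of B d p] E by blast
  then show ?thesis by (simp add: fun_eq_iff)
qed

section \<open>Projecting generic frameworks from their vertices\<close>

text \<open>Affine general position: any \<open>d + 1\<close> points impose independent conditions on affine functions.\<close>

definition interpolating :: "nat \<Rightarrow> 'a set \<Rightarrow> 'a config \<Rightarrow> bool" where
  "interpolating d X p \<longleftrightarrow> (\<forall>T g. T \<subseteq> X \<and> finite T \<and> card T \<le> d + 1 \<longrightarrow>
     (\<exists>a\<in>affine_functions d p. \<forall>t\<in>T. a t = g t))"

text \<open>A polynomial relation between the projected coordinates becomes, after multiplication by a power of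
  the denominators, a polynomial relation between the original ones.\<close>

lemma polyfun_clear_denominators:
  fixes w :: 'a
  assumes X: "finite X" and f: "f \<in> polyfun ((X - {w}) \<times> {..<d})" and w: "w \<in> X"
  shows "\<exists>N. \<exists>g\<in>polyfun (X \<times> {..<Suc d}). \<forall>a. (\<forall>x\<in>X - {w}. a (x, d) \<noteq> a (w, d)) \<longrightarrow>
    (\<Prod>x\<in>X - {w}. a (x, d) - a (w, d)) ^ N *
      f (\<lambda>(x, i). (a (x, i) - a (w, i)) / (a (x, d) - a (w, d))) = g a"
  using f
proof induction
  case (const c)
  show ?case by (rule exI[of _ 0], rule bexI[OF _ polyfun.const[of c]]) simp
next
  case (var z)
  then obtain x i where z: "z = (x, i)" "x \<in> X - {w}" "i < d" by auto
  define g where "g = (\<lambda>a :: 'a \<times> nat \<Rightarrow> complex. (\<Prod>y\<in>X - {w} - {x}. a (y, d) - a (w, d)) * (a (x, i) - a (w, i)))"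
  have "g \<in> polyfun (X \<times> {..<Suc d})"
    unfolding g_def using z w by (intro polyfun.mult polyfun_prod polyfun_diff polyfun.var) auto
  moreover have "(\<Prod>x\<in>X - {w}. a (x, d) - a (w, d)) ^ 1 *
      (\<lambda>(x, i). (a (x, i) - a (w, i)) / (a (x, d) - a (w, d))) z = g a"
    if "\<forall>x\<in>X - {w}. a (x, d) \<noteq> a (w, d)" for a
  proof -
    have "(\<Prod>x\<in>X - {w}. a (x, d) - a (w, d)) = (a (x, d) - a (w, d)) * (\<Prod>y\<in>X - {w} - {x}. a (y, d) - a (w, d))"
      using X z(2) by (intro prod.remove) auto
    then show ?thesis using that z by (simp add: g_def)
  qed
  ultimately show ?case by blast
next
  case (add f1 f2)
  let ?P = "\<lambda>a :: 'a \<times> nat \<Rightarrow> complex. \<Prod>x\<in>X - {w}. a (x, d) - a (w, d)"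
  have P: "?P \<in> polyfun (X \<times> {..<Suc d})"
    using w by (intro polyfun_prod polyfun_diff polyfun.var) auto
  obtain N1 g1 N2 g2 where g: "g1 \<in> polyfun (X \<times> {..<Suc d})" "g2 \<in> polyfun (X \<times> {..<Suc d})"
    and e1: "\<And>a :: 'a \<times> nat \<Rightarrow> complex. \<forall>x\<in>X - {w}. a (x, d) \<noteq> a (w, d) \<Longrightarrow>
      ?P a ^ N1 * f1 (\<lambda>(x, i). (a (x, i) - a (w, i)) / (a (x, d) - a (w, d))) = g1 a"
    and e2: "\<And>a :: 'a \<times> nat \<Rightarrow> complex. \<forall>x\<in>X - {w}. a (x, d) \<noteq> a (w, d) \<Longrightarrow>
      ?P a ^ N2 * f2 (\<lambda>(x, i). (a (x, i) - a (w, i)) / (a (x, d) - a (w, d))) = g2 a"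
    using add.IH by blast
  show ?case
  proof (intro exI bexI allI impI)
    show "(\<lambda>a. ?P a ^ N2 * g1 a + ?P a ^ N1 * g2 a) \<in> polyfun (X \<times> {..<Suc d})"
      using P g by (intro polyfun.add polyfun.mult polyfun_power)
    fix a :: "'a \<times> nat \<Rightarrow> complex" assume a: "\<forall>x\<in>X - {w}. a (x, d) \<noteq> a (w, d)"
    show "?P a ^ (N1 + N2) * (f1 (\<lambda>(x, i). (a (x, i) - a (w, i)) / (a (x, d) - a (w, d))) +
        f2 (\<lambda>(x, i). (a (x, i) - a (w, i)) / (a (x, d) - a (w, d)))) =
        ?P a ^ N2 * g1 a + ?P a ^ N1 * g2 a"
      unfolding e1[OF a, symmetric] e2[OF a, symmetric] by (simp add: power_add algebra_simps)
  qed
next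
  case (mult f1 f2)
  let ?P = "\<lambda>a :: 'a \<times> nat \<Rightarrow> complex. \<Prod>x\<in>X - {w}. a (x, d) - a (w, d)"
  obtain N1 g1 N2 g2 where g: "g1 \<in> polyfun (X \<times> {..<Suc d})" "g2 \<in> polyfun (X \<times> {..<Suc d})"
    and e1: "\<And>a :: 'a \<times> nat \<Rightarrow> complex. \<forall>x\<in>X - {w}. a (x, d) \<noteq> a (w, d) \<Longrightarrow>
      ?P a ^ N1 * f1 (\<lambda>(x, i). (a (x, i) - a (w, i)) / (a (x, d) - a (w, d))) = g1 a"
    and e2: "\<And>a :: 'a \<times> nat \<Rightarrow> complex. \<forall>x\<in>X - {w}. a (x, d) \<noteq> a (w, d) \<Longrightarrow>
      ?P a ^ N2 * f2 (\<lambda>(x, i). (a (x, i) - a (w, i)) / (a (x, d) - a (w, d))) = g2 a"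
    using mult.IH by blast
  show ?case
  proof (intro exI bexI allI impI)
    show "(\<lambda>a. g1 a * g2 a) \<in> polyfun (X \<times> {..<Suc d})"
      using g by (intro polyfun.mult)
    fix a :: "'a \<times> nat \<Rightarrow> complex" assume a: "\<forall>x\<in>X - {w}. a (x, d) \<noteq> a (w, d)"
    show "?P a ^ (N1 + N2) * (f1 (\<lambda>(x, i). (a (x, i) - a (w, i)) / (a (x, d) - a (w, d))) *
        f2 (\<lambda>(x, i). (a (x, i) - a (w, i)) / (a (x, d) - a (w, d)))) = g1 a * g2 a"
      unfolding e1[OF a, symmetric] e2[OF a, symmetric] by (simp add: power_add algebra_simps)
  qed
qed

lemma generic_coord_neq:
  assumes p: "generic d X p" and "x \<in> X" "y \<in> X" "x \<noteq> y" "i < d"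
  shows "p x i \<noteq> p y i"
proof
  assume "p x i = p y i"
  then have zero: "(\<lambda>a. a (x, i) - a (y, i)) (coords p) = 0" by simp
  have "(\<lambda>a. a (x, i) - a (y, i)) \<in> polyfun (X \<times> {..<d})"
    using assms by (intro polyfun_diff polyfun.var) auto
  from generic_polyfun[OF p this zero, of "\<lambda>z. if z = (x, i) then 1 else 0"]
  show False using \<open>x \<noteq> y\<close> by simp
qed

text \<open>Every configuration in dimension \<open>d\<close> is a projection: place \<open>w\<close> at the origin and the other points
  at height one. So a relation that holds after projecting a generic configuration holds identically.\<close>

lemma generic_projection:
  fixes X :: "'a set"
  assumes X: "finite X" and p: "generic (Suc d) X p" and w: "w \<in> X"
  shows "generic d (X - {w}) (\<lambda>x i. (p x i - p w i) / (p x d - p w d))"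
  unfolding generic_iff_polyfun
proof (intro ballI impI allI)
  fix f b assume f: "f \<in> polyfun ((X - {w}) \<times> {..<d})"
    and 0: "f (coords (\<lambda>x i. (p x i - p w i) / (p x d - p w d))) = 0"
  obtain N g where g: "g \<in> polyfun (X \<times> {..<Suc d})" and eq: "\<And>a :: 'a \<times> nat \<Rightarrow> complex. \<forall>x\<in>X - {w}. a (x, d) \<noteq> a (w, d) \<Longrightarrow>
      (\<Prod>x\<in>X - {w}. a (x, d) - a (w, d)) ^ N *
      f (\<lambda>(x, i). (a (x, i) - a (w, i)) / (a (x, d) - a (w, d))) = g a"
    using polyfun_clear_denominators[OF X f w] by blast
  have "p x d \<noteq> p w d" if "x \<in> X - {w}" for x
    using generic_coord_neq[OF p, of x w d] that w by auto
  then have "g (coords p) = 0" using eq[of "coords p"] 0 by simp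
  then have g0: "g a = 0" for a using generic_polyfun[OF p g] by blast
  define a :: "'a \<times> nat \<Rightarrow> complex" where "a = (\<lambda>(x, i). if x = w then 0 else if i = d then 1 else b (x, i))"
  have "f (\<lambda>(x, i). (a (x, i) - a (w, i)) / (a (x, d) - a (w, d))) = 0"
    using eq[of a] g0[of a] by (simp add: a_def)
  moreover have "f (\<lambda>(x, i). (a (x, i) - a (w, i)) / (a (x, d) - a (w, d))) = f b"
  proof (rule polyfun_cong[OF f])
    fix z assume "z \<in> (X - {w}) \<times> {..<d}"
    then obtain x i where "z = (x, i)" "x \<noteq> w" "i < d" by auto
    then show "(\<lambda>(x, i). (a (x, i) - a (w, i)) / (a (x, d) - a (w, d))) z = b z"
      by (simp add: a_def)
  qed
  ultimately show "f b = 0" by simp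
qed

text \<open>In homogeneous coordinates projection is a quotient: affine functions downstairs, multiplied by the
  denominators, are the affine functions upstairs that vanish at \<open>w\<close>.\<close>

lemma affine_cone:
  assumes "a \<in> affine_functions d (\<lambda>x i. (p x i - p w i) / (p x d - p w d))"
  shows "\<exists>a'\<in>affine_functions (Suc d) p. \<forall>x. p x d \<noteq> p w d \<or> x = w \<longrightarrow> a' x = (p x d - p w d) * a x"
proof -
  obtain c b where a: "a = (\<lambda>x. c + (\<Sum>i<d. b i * ((p x i - p w i) / (p x d - p w d))))"
    using assms by (auto simp: affine_functions_def)
  define a' where "a' = (\<lambda>x. (c * p x d + - c * p w d) + (\<Sum>i<d. b i * p x i + - b i * p w i))"
  have "a' \<in> affine_functions (Suc d) p"
    unfolding a'_def by (intro affine_add affine_sum affine_scale affine_const affine_coord) auto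
  moreover have "a' x = (p x d - p w d) * a x" if "p x d \<noteq> p w d \<or> x = w" for x
    using that
  proof
    assume nz: "p x d \<noteq> p w d"
    have "(p x d - p w d) * a x = c * (p x d - p w d) + (\<Sum>i<d. b i * (p x i - p w i))"
      unfolding a distrib_left sum_distrib_left using nz by (intro arg_cong2[where f = "(+)"] sum.cong) auto
    then show ?thesis by (simp add: a'_def algebra_simps)
  qed (simp add: a'_def)
  ultimately show ?thesis by blast
qed

text \<open>Projecting from a vertex \<open>w\<close> lowers the dimension by one and rescales by nonzero factors that
  vanish at \<open>w\<close>; iterating this projects from a whole set of vertices.\<close>

lemma iterated_projection:
  assumes "finite S" "finite X" "S \<subseteq> X" "generic (d + card S) X p"
  shows "\<exists>p' s. generic d (X - S) p' \<and> (\<forall>x\<in>S. s x = 0) \<and> (\<forall>x\<in>X - S. s x \<noteq> 0) \<and>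
    (\<forall>a\<in>affine_functions d p'. \<exists>b\<in>affine_functions (d + card S) p. \<forall>x\<in>X. b x = s x * a x) \<and>
    (\<forall>g. \<exists>b\<in>affine_functions (d + card S) p. \<forall>x\<in>S. b x = g x)"
  using assms
proof (induction S arbitrary: X p rule: finite_induct)
  case empty
  show ?case
    using empty by (intro exI[of _ p] exI[of _ "\<lambda>_. 1"]) (auto intro: affine_const)
next
  case (insert w S)
  define D where "D = d + card S"
  define q where "q = (\<lambda>x i. (p x i - p w i) / (p x D - p w D))"
  have D: "d + card (insert w S) = Suc D" using insert.hyps by (simp add: D_def)
  have p: "generic (Suc D) X p" using insert.prems D by simp
  have w: "w \<in> X" using insert.prems by simp
  have l: "p x D \<noteq> p w D" if "x \<in> X" "x \<noteq> w" for x
    using generic_coord_neq[OF p that(1) w that(2)] by simp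
  have q: "generic D (X - {w}) q" unfolding q_def by (rule generic_projection[OF insert.prems(1) p w])
  have sub: "S \<subseteq> X - {w}" using insert by auto
  have fXw: "finite (X - {w})" using insert.prems(1) by simp
  obtain p' s where p': "generic d (X - {w} - S) p'" and s0: "\<forall>x\<in>S. s x = 0"
    and s: "\<forall>x\<in>X - {w} - S. s x \<noteq> 0"
    and aff: "\<forall>a\<in>affine_functions d p'. \<exists>b\<in>affine_functions D q. \<forall>x\<in>X - {w}. b x = s x * a x"
    and interp: "\<forall>g. \<exists>b\<in>affine_functions D q. \<forall>x\<in>S. b x = g x"
    using insert.IH[OF fXw sub q[unfolded D_def], folded D_def] by (elim exE conjE)
  define s' where "s' x = (p x D - p w D) * s x" for x
  have cone: "\<exists>b\<in>affine_functions (Suc D) p. \<forall>x\<in>X. b x = (p x D - p w D) * a x"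
    if "a \<in> affine_functions D q" for a
    using affine_cone[of a D p w] that l unfolding q_def by metis
  have "\<exists>b\<in>affine_functions (Suc D) p. \<forall>x\<in>X. b x = s' x * a x" if a: "a \<in> affine_functions d p'" for a
  proof -
    obtain b where b: "b \<in> affine_functions D q" "\<forall>x\<in>X - {w}. b x = s x * a x" using bspec[OF aff a] by blast
    obtain b' where b': "b' \<in> affine_functions (Suc D) p" "\<forall>x\<in>X. b' x = (p x D - p w D) * b x"
      using cone[OF b(1)] by blast
    have "b' x = s' x * a x" if "x \<in> X" for x
      using b'(2) b(2) that by (cases "x = w") (auto simp: s'_def)
    then show ?thesis using b'(1) by blast
  qed
  moreover have "\<exists>b\<in>affine_functions (Suc D) p. \<forall>x\<in>insert w S. b x = g x" for g
  proof -
    obtain b where b: "b \<in> affine_functions D q" "\<forall>x\<in>S. b x = (g x - g w) / (p x D - p w D)"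
      using spec[OF interp, of "\<lambda>x. (g x - g w) / (p x D - p w D)"] by blast
    obtain b' where b': "b' \<in> affine_functions (Suc D) p" "\<forall>x\<in>X. b' x = (p x D - p w D) * b x"
      using cone[OF b(1)] by blast
    have "(\<lambda>x. g w + b' x) \<in> affine_functions (Suc D) p" by (intro affine_add affine_const b'(1))
    moreover have "g w + b' x = g x" if "x \<in> insert w S" for x
    proof (cases "x = w")
      case True
      then show ?thesis using b'(2) w by simp
    next
      case False
      then have "x \<in> S" "x \<in> X" using that sub by auto
      then show ?thesis using b'(2) b(2) l[of x] False by simp
    qed
    ultimately show ?thesis by (intro bexI[of _ "\<lambda>x. g w + b' x"] ballI)
  qed
  moreover have "generic d (X - insert w S) p'"
  proof -
    have "X - insert w S = X - {w} - S" by blast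
    then show ?thesis using p' by (simp only:)
  qed
  moreover have "s' x = 0" if "x \<in> insert w S" for x using that s0 by (auto simp: s'_def)
  moreover have "s' x \<noteq> 0" if "x \<in> X - insert w S" for x
    using that s l[of x] by (auto simp: s'_def)
  ultimately show ?case unfolding D
    by (intro exI[of _ p'] exI[of _ s']) blast
qed

text \<open>After projecting from all but one of the points, the constant function downstairs lifts to an affine
  function that is nonzero at the last point and zero at the others.\<close>

lemma generic_interpolating:
  assumes X: "finite X" and p: "generic D X p"
  shows "interpolating D X p"
  unfolding interpolating_def
proof (intro allI impI)
  fix T g assume T: "T \<subseteq> X \<and> finite T \<and> card T \<le> D + 1"
  show "\<exists>a\<in>affine_functions D p. \<forall>t\<in>T. a t = g t"
  proof (cases "T = {}")
    case True
    then show ?thesis using affine_const by blast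
  next
    case False
    then obtain t where t: "t \<in> T" by blast
    define S where "S = T - {t}"
    have S: "finite S" "S \<subseteq> X" "card S \<le> D" "T = insert t S" "t \<notin> S" "t \<in> X"
      using T t by (auto simp: S_def)
    define d where "d = D - card S"
    have D: "d + card S = D" using S by (simp add: d_def)
    obtain p' s where s0: "\<And>x. x \<in> S \<Longrightarrow> s x = 0" and s: "\<And>x. x \<in> X - S \<Longrightarrow> s x \<noteq> 0"
      and aff: "\<And>a. a \<in> affine_functions d p' \<Longrightarrow> \<exists>b\<in>affine_functions D p. \<forall>x\<in>X. b x = s x * a x"
      and interp: "\<And>g. \<exists>b\<in>affine_functions D p. \<forall>x\<in>S. b x = g x"
      using iterated_projection[OF S(1) X S(2), of d p] p unfolding D by blast
    obtain b where b: "b \<in> affine_functions D p" "\<forall>x\<in>S. b x = g x" using interp by blast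
    obtain b' where b': "b' \<in> affine_functions D p" "\<forall>x\<in>X. b' x = s x * 1"
      using aff[OF affine_const[of 1]] by blast
    let ?c = "(g t - b t) / s t"
    have "(\<lambda>x. b x + ?c * b' x) \<in> affine_functions D p" by (intro affine_add affine_scale b(1) b'(1))
    moreover have "b x + ?c * b' x = g x" if "x \<in> T" for x
    proof (cases "x = t")
      case True
      then show ?thesis using b'(2) s[of t] S by simp
    next
      case False
      then have "x \<in> S" using that S by auto
      then have "x \<in> X" "s x = 0" "b x = g x" using S(2) s0 b(2) by blast+
      then show ?thesis using b'(2) by simp
    qed
    ultimately show ?thesis by (intro bexI[of _ "\<lambda>x. b x + ?c * b' x"] ballI)
  qed
qed

section \<open>Equivalent frameworks have the same stresses\<close>

text \<open>The rank of a matrix of polynomials is largest at a generic point. The induction is one step of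
  Gaussian elimination, carried out without division.\<close>

lemma indep_family_at_generic:
  assumes "finite J" and p: "generic d V p"
    and "\<And>j c. j \<in> J \<Longrightarrow> F j c \<in> polyfun (V \<times> {..<d})"
    and "indep_family J UNIV (\<lambda>j c. F j c a)"
  shows "indep_family J UNIV (\<lambda>j c. F j c (coords p))"
  using assms(1,3,4)
proof (induction J arbitrary: F rule: finite_induct)
  case empty
  show ?case by (simp add: indep_family_def)
next
  case (insert i J)
  have "\<exists>c0. F i c0 a \<noteq> 0"
  proof (rule ccontr)
    assume "\<not> ?thesis"
    then have "(\<Sum>j\<in>insert i J. (if j = i then 1 else 0) * F j c a) = 0" for c
      using insert.hyps by (intro sum.neutral) auto
    then have "(if i = i then 1 else 0 :: complex) = 0"
      using indep_familyD[OF insert.prems(2), of "\<lambda>j. if j = i then 1 else 0" i] by blast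
    then show False by simp
  qed
  then obtain c0 where c0: "F i c0 a \<noteq> 0" by blast
  define G where "G j c = (\<lambda>b. F i c0 b * F j c b - F j c0 b * F i c b)" for j c
  have "indep_family J UNIV (\<lambda>j c. G j c (coords p))"
  proof (rule insert.IH)
    show "G j c \<in> polyfun (V \<times> {..<d})" if "j \<in> J" for j c
      unfolding G_def using that insert.prems(1) by (intro polyfun_diff polyfun.mult) auto
    show "indep_family J UNIV (\<lambda>j c. G j c a)"
      unfolding indep_family_def
    proof (intro allI impI ballI)
      fix u j assume u: "\<forall>c\<in>UNIV. (\<Sum>j\<in>J. u j * G j c a) = 0" and j: "j \<in> J"
      \<comment> \<open>the coefficients of the eliminated family, rewritten for the original one\<close>
      define v where "v = (\<lambda>j. if j = i then - (\<Sum>j\<in>J. u j * F j c0 a) else F i c0 a * u j)"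
      have "(\<Sum>j\<in>insert i J. v j * F j c a) = 0" for c
      proof -
        have "(\<Sum>j\<in>insert i J. v j * F j c a) = v i * F i c a + (\<Sum>j\<in>J. v j * F j c a)"
          using insert.hyps by simp
        also have "(\<Sum>j\<in>J. v j * F j c a) = (\<Sum>j\<in>J. F i c0 a * u j * F j c a)"
          using insert.hyps by (intro sum.cong) (auto simp: v_def)
        also have "v i * F i c a + \<dots> = (\<Sum>j\<in>J. u j * G j c a)"
          by (simp add: v_def G_def sum_distrib_left sum_distrib_right right_diff_distrib sum_subtractf mult_ac)
        finally show ?thesis using u by simp
      qed
      then have "v j = 0" using indep_familyD[OF insert.prems(2), of v j] j by blast
      then show "u j = 0" using j insert.hyps c0 by (auto simp: v_def split: if_splits)
    qed
  qed
  note ind = this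
  show ?case
    unfolding indep_family_def
  proof (intro allI impI)
    fix u assume u: "\<forall>c\<in>UNIV. (\<Sum>j\<in>insert i J. u j * F j c (coords p)) = 0"
    have F0: "F i c0 (coords p) \<noteq> 0"
      using generic_polyfun[OF p, of "F i c0" a] insert.prems(1)[of i c0] c0 by auto
    have eq: "u i * F i c (coords p) + (\<Sum>j\<in>J. u j * F j c (coords p)) = 0" for c
      using u insert.hyps by simp
    have "(\<Sum>j\<in>J. u j * G j c (coords p)) = 0" for c
    proof -
      have "(\<Sum>j\<in>J. u j * G j c (coords p)) =
          F i c0 (coords p) * (\<Sum>j\<in>J. u j * F j c (coords p)) - (\<Sum>j\<in>J. u j * F j c0 (coords p)) * F i c (coords p)"
        by (simp add: G_def sum_distrib_left sum_distrib_right right_diff_distrib sum_subtractf mult_ac)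
      also have "(\<Sum>j\<in>J. u j * F j c (coords p)) = - (u i * F i c (coords p))"
        using eq[of c] by (simp add: add_eq_0_iff)
      also have "(\<Sum>j\<in>J. u j * F j c0 (coords p)) = - (u i * F i c0 (coords p))"
        using eq[of c0] by (simp add: add_eq_0_iff)
      finally show ?thesis by simp
    qed
    then have uJ: "u j = 0" if "j \<in> J" for j using indep_familyD[OF ind] that by blast
    then have "u i = 0" using eq[of c0] F0 by simp
    with uJ show "\<forall>j\<in>insert i J. u j = 0" by simp
  qed
qed

lemma rigidity_indep_at_generic:
  fixes Y :: "'a set"
  assumes Y: "finite Y" and E: "E \<subseteq> pairs Y" and p: "generic d Y p" and q: "rigidity_indep d q E"
  shows "rigidity_indep d p E"
proof -
  have fE: "finite E" using Y E finite_pairs finite_subset by metis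
  define F where "F = (\<lambda>(e :: 'a set) c a. jacobian_row d (\<lambda>v i. a (v, i)) e c)"
  have "F e c \<in> polyfun (Y \<times> {..<d})" if e: "e \<in> E" for e c
  proof -
    obtain u v where uv: "e = {u, v}" "u \<noteq> v" "u \<in> Y" "v \<in> Y" using edge_ends[OF e E] by blast
    obtain w i where c: "c = (w, i)" by fastforce
    have F: "F e c = (\<lambda>a. if i < d \<and> w = u then 2 * (a (u, i) - a (v, i))
       else if i < d \<and> w = v then 2 * (a (v, i) - a (u, i)) else 0)"
      by (simp add: F_def uv c jacobian_row_pair fun_eq_iff)
    have lin: "(\<lambda>a. 2 * (a (x, i) - a (y, i))) \<in> polyfun (Y \<times> {..<d})" if "x \<in> Y" "y \<in> Y" "i < d" for x y
      using that by (intro polyfun.mult polyfun_numeral polyfun_diff polyfun.var) auto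
    show ?thesis
    proof (cases "i < d \<and> (w = u \<or> w = v)")
      case True
      then show ?thesis unfolding F using lin uv by (auto simp del: right_diff_distrib_numeral)
    next
      case False
      then have "F e c = (\<lambda>a. 0)" unfolding F by auto
      then show ?thesis by (simp only: polyfun_0)
    qed
  qed
  moreover have "indep_family E UNIV (\<lambda>e c. F e c (coords q))"
    using q by (simp add: rigidity_indep_iff_family[OF fE] F_def)
  ultimately have "indep_family E UNIV (\<lambda>e c. F e c (coords p))"
    by (rule indep_family_at_generic[OF fE p])
  then show ?thesis by (simp add: rigidity_indep_iff_family[OF fE] F_def)
qed

text \<open>The polarisation of the squared distance: half its derivative at \<open>p\<close> in the direction \<open>a\<close>.\<close>

definition polar_dist :: "nat \<Rightarrow> 'a config \<Rightarrow> 'a config \<Rightarrow> 'a \<Rightarrow> 'a \<Rightarrow> complex" where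
  "polar_dist d p a u v = (\<Sum>i<d. (p u i - p v i) * (a u i - a v i))"

lemma polyfun_line_differentiable:
  assumes "f \<in> polyfun I"
  shows "(\<lambda>z :: complex. f (\<lambda>x. b x + z * a x)) field_differentiable (at 0)"
  using assms by induction (auto intro!: derivative_intros field_differentiable_add field_differentiable_mult)

text \<open>Fix generic \<open>p\<close> and \<open>p'\<close> and an arbitrary \<open>q\<close>. Sending \<open>p\<close> to \<open>p'\<close> embeds the ring generated by
  the coordinates of \<open>p\<close>, and a direction \<open>a\<close> gives a derivation along this embedding (the directional
  derivative at \<open>p'\<close>). Extending both to the coordinates of \<open>q\<close> yields a \<open>q'\<close> that satisfies the same
  equations, and for every \<open>a\<close> a velocity \<open>b\<close> of \<open>q'\<close> that preserves them to first order.\<close>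

lemma transfer_equivalent_framework:
  assumes Y: "finite Y" and p: "generic d Y p" and p': "generic d Y p'"
  shows "\<exists>q'.
    (\<forall>u\<in>Y. \<forall>v\<in>Y. sq_dist d p u v = sq_dist d q u v \<longleftrightarrow> sq_dist d p' u v = sq_dist d q' u v) \<and>
    (\<forall>a. \<exists>b. \<forall>u\<in>Y. \<forall>v\<in>Y. sq_dist d p u v = sq_dist d q u v \<longrightarrow>
       polar_dist d p' a u v = polar_dist d q' b u v)"
proof -
  let ?I = "Y \<times> {..<d}"
  define K where "K = (\<lambda>f. f (coords p)) ` polyfun ?I"
  define rep where "rep y = (SOME f. f \<in> polyfun ?I \<and> f (coords p) = y)" for y
  have rep: "rep y \<in> polyfun ?I" "rep y (coords p) = y" if "y \<in> K" for y
    using that someI_ex[of "\<lambda>f. f \<in> polyfun ?I \<and> f (coords p) = y"] unfolding K_def rep_def by auto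
  have mem: "f (coords p) \<in> K" if "f \<in> polyfun ?I" for f using that by (auto simp: K_def)
  have eq_fun: "f = g" if "f \<in> polyfun ?I" "g \<in> polyfun ?I" "f (coords p) = g (coords p)" for f g
  proof
    fix a show "f a = g a"
      using generic_polyfun[OF p polyfun_diff[OF that(1,2)], of a] that(3) by simp
  qed
  have rep_eq: "rep (f (coords p)) = f" if "f \<in> polyfun ?I" for f
    using rep[OF mem[OF that]] by (intro eq_fun that)
  \<comment> \<open>well defined because a polynomial function is determined by its value at the generic point \<open>p\<close>\<close>
  define \<sigma>0 where "\<sigma>0 y = rep y (coords p')" for y
  have \<sigma>0: "\<sigma>0 (f (coords p)) = f (coords p')" if "f \<in> polyfun ?I" for f
    by (simp add: \<sigma>0_def rep_eq[OF that])
  have sub: "subring_of K"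
    unfolding subring_of_def
  proof (intro conjI ballI)
    show "0 \<in> K" using mem[OF polyfun_0] by simp
    show "1 \<in> K" using mem[OF polyfun_1] by simp
    show "x + y \<in> K" "x * y \<in> K" if "x \<in> K" "y \<in> K" for x y
      using mem[OF polyfun.add[OF rep(1)[OF that(1)] rep(1)[OF that(2)]]]
        mem[OF polyfun.mult[OF rep(1)[OF that(1)] rep(1)[OF that(2)]]] rep(2) that by auto
    show "- x \<in> K" if "x \<in> K" for x
      using mem[OF polyfun_uminus[OF rep(1)[OF that]]] rep(2)[OF that] by simp
  qed
  have emb: "ring_embedding K \<sigma>0"
    unfolding ring_embedding_def
  proof (intro conjI ballI impI)
    show "\<sigma>0 1 = 1" using \<sigma>0[OF polyfun_1] by simp
    show "\<sigma>0 (x + y) = \<sigma>0 x + \<sigma>0 y" "\<sigma>0 (x * y) = \<sigma>0 x * \<sigma>0 y" if "x \<in> K" "y \<in> K" for x y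
      using \<sigma>0[OF polyfun.add[OF rep(1)[OF that(1)] rep(1)[OF that(2)]]]
        \<sigma>0[OF polyfun.mult[OF rep(1)[OF that(1)] rep(1)[OF that(2)]]] rep(2) that
      by (simp_all add: \<sigma>0_def)
    show "x = 0" if "x \<in> K" "\<sigma>0 x = 0" for x
      using generic_polyfun[OF p' rep(1)[OF that(1)], of "coords p"] rep(2)[OF that(1)] that(2)
      by (simp add: \<sigma>0_def)
  qed
  have "countable (polyfun ?I)" using Y by (intro countable_polyfun countable_finite) simp
  then have cK: "countable K" by (simp add: K_def)
  let ?T = "(\<lambda>(v, i). q v i) ` ?I"
  have "finite ?T" using Y by simp
  from extend_to_finite_set[OF this cK sub emb] obtain L \<sigma> where
    L: "K \<subseteq> L" "?T \<subseteq> L" "subring_of L" and \<sigma>: "ring_embedding L \<sigma>" and \<sigma>K: "\<forall>x\<in>K. \<sigma> x = \<sigma>0 x"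
    and ext: "\<And>\<delta>. derivation_along K \<sigma>0 \<delta> \<Longrightarrow> \<exists>\<delta>'. derivation_along L \<sigma> \<delta>' \<and> (\<forall>x\<in>K. \<delta>' x = \<delta> x)"
    by blast
  interpret embedded_ring L \<sigma> using L \<sigma> by unfold_locales
  have pK: "p v i \<in> K" if "v \<in> Y" "i < d" for v i
    using mem[OF polyfun.var[of "(v, i)"]] that by simp
  have pL: "p v i \<in> L" "q v i \<in> L" if "v \<in> Y" "i < d" for v i
    using pK[OF that] L that by auto
  have \<sigma>p: "\<sigma> (p v i) = p' v i" if "v \<in> Y" "i < d" for v i
    using \<sigma>K pK[OF that] \<sigma>0[OF polyfun.var[of "(v, i)" ?I]] that by simp
  define q' where "q' = (\<lambda>v i. \<sigma> (q v i))"
  have dist_L: "sq_dist d p u v - sq_dist d q u v \<in> L"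
    and dist: "\<sigma> (sq_dist d p u v - sq_dist d q u v) = sq_dist d p' u v - sq_dist d q' u v" if "u \<in> Y" "v \<in> Y" for u v
  proof -
    have in_L: "(p u i - p v i)\<^sup>2 \<in> L" "(q u i - q v i)\<^sup>2 \<in> L" if "i < d" for i
      using pL \<open>u \<in> Y\<close> \<open>v \<in> Y\<close> that by (auto intro!: K_power)
    have sums: "sq_dist d p u v \<in> L" "sq_dist d q u v \<in> L"
      unfolding sq_dist_def using in_L by (auto intro!: K_sum)
    then show "sq_dist d p u v - sq_dist d q u v \<in> L" by simp
    have "\<sigma> (sq_dist d p u v) = sq_dist d p' u v"
      unfolding sq_dist_def using in_L pL \<sigma>p that by (subst \<sigma>_sum) (auto simp: \<sigma>_power \<sigma>_diff)
    moreover have "\<sigma> (sq_dist d q u v) = sq_dist d q' u v"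
      unfolding sq_dist_def using in_L pL that by (subst \<sigma>_sum) (auto simp: \<sigma>_power \<sigma>_diff q'_def)
    ultimately show "\<sigma> (sq_dist d p u v - sq_dist d q u v) = sq_dist d p' u v - sq_dist d q' u v"
      using sums by (simp add: \<sigma>_diff)
  qed
  show ?thesis
  proof (rule exI[of _ q'], intro conjI ballI allI)
    show "sq_dist d p u v = sq_dist d q u v \<longleftrightarrow> sq_dist d p' u v = sq_dist d q' u v" if uv: "u \<in> Y" "v \<in> Y" for u v
      using dist[OF uv] \<sigma>_inj[OF dist_L[OF uv]] by auto
    fix a :: "'a config"
    define dir where "dir f = deriv (\<lambda>z. f (\<lambda>x. coords p' x + z * coords a x)) 0" for f
    define \<delta>0 where "\<delta>0 y = dir (rep y)" for y
    have dl: "\<delta>0 (f (coords p)) = dir f" if "f \<in> polyfun ?I" for f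
      by (simp add: \<delta>0_def rep_eq[OF that])
    have at0: "(\<lambda>x. coords p' x + 0 * coords a x) = coords p'" by simp
    have dir_add: "dir (\<lambda>b. f b + g b) = dir f + dir g"
      and dir_mult: "dir (\<lambda>b. f b * g b) = f (coords p') * dir g + dir f * g (coords p')"
      if "f \<in> polyfun ?I" "g \<in> polyfun ?I" for f g
      using polyfun_line_differentiable[OF that(1), of "coords p'" "coords a"]
        polyfun_line_differentiable[OF that(2), of "coords p'" "coords a"]
      by (simp_all add: dir_def)
    have "derivation_along K \<sigma>0 \<delta>0"
      unfolding derivation_along_def
    proof (intro ballI conjI)
      fix x y assume xy: "x \<in> K" "y \<in> K"
      note r = rep(1)[OF xy(1)] rep(1)[OF xy(2)]
      show "\<delta>0 (x + y) = \<delta>0 x + \<delta>0 y"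
        using dl[OF polyfun.add[OF r]] dir_add[OF r] rep(2) xy by (simp add: \<delta>0_def)
      show "\<delta>0 (x * y) = \<sigma>0 x * \<delta>0 y + \<delta>0 x * \<sigma>0 y"
        using dl[OF polyfun.mult[OF r]] dir_mult[OF r] rep(2) xy by (simp add: \<delta>0_def \<sigma>0_def)
    qed
    from ext[OF this] obtain \<delta> where \<delta>: "derivation_along L \<sigma> \<delta>" and \<delta>K: "\<forall>x\<in>K. \<delta> x = \<delta>0 x" by blast
    interpret embedded_ring_derivation L \<sigma> \<delta> using \<delta> by unfold_locales
    have \<delta>p: "\<delta> (p v i) = a v i" if "v \<in> Y" "i < d" for v i
    proof -
      have "\<delta> (p v i) = dir (\<lambda>b. b (v, i))"
        using \<delta>K pK[OF that] dl[OF polyfun.var[of "(v, i)" ?I]] that by simp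
      also have "\<dots> = a v i"
        unfolding dir_def by (rule DERIV_imp_deriv) (auto intro!: derivative_eq_intros)
      finally show ?thesis .
    qed
    have \<delta>_diff: "\<delta> (x - y) = \<delta> x - \<delta> y" if "x \<in> L" "y \<in> L" for x y
      using \<delta>_add[of "x - y" y] that by simp
    have \<delta>_sq: "\<delta> (x\<^sup>2) = 2 * \<sigma> x * \<delta> x" if "x \<in> L" for x
      using \<delta>_mult[OF that that] by (simp add: power2_eq_square)
    show "\<exists>b. \<forall>u\<in>Y. \<forall>v\<in>Y. sq_dist d p u v = sq_dist d q u v \<longrightarrow>
       polar_dist d p' a u v = polar_dist d q' b u v"
    proof (intro exI[of _ "\<lambda>v i. \<delta> (q v i)"] ballI impI)
      fix u v assume uv: "u \<in> Y" "v \<in> Y" and eq: "sq_dist d p u v = sq_dist d q u v"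
      have in_L: "(p u i - p v i)\<^sup>2 \<in> L" "(q u i - q v i)\<^sup>2 \<in> L" if "i < d" for i
        using pL uv that by (auto intro!: K_power)
      have "\<delta> (sq_dist d p u v) = 2 * polar_dist d p' a u v"
        unfolding sq_dist_def polar_dist_def sum_distrib_left using in_L pL \<sigma>p \<delta>p uv
        by (subst \<delta>_sum) (auto simp: \<delta>_sq \<delta>_diff \<sigma>_diff intro!: sum.cong)
      moreover have "\<delta> (sq_dist d q u v) = 2 * polar_dist d q' (\<lambda>v i. \<delta> (q v i)) u v"
        unfolding sq_dist_def polar_dist_def sum_distrib_left using in_L pL uv
        by (subst \<delta>_sum) (auto simp: \<delta>_sq \<delta>_diff \<sigma>_diff q'_def intro!: sum.cong)
      ultimately show "polar_dist d p' a u v = polar_dist d q' (\<lambda>v i. \<delta> (q v i)) u v"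
        using eq by simp
    qed
  qed
qed

lemma stress_polar_dist:
  assumes W: "stress d q X E W"
  shows "(\<Sum>i<d. dot X (\<lambda>x. p x i) (mv X W (\<lambda>y. a y i))) =
    - (1/2) * (\<Sum>x\<in>X. \<Sum>y\<in>X. W x y * polar_dist d p a x y)"
proof -
  have "(\<Sum>x\<in>X. \<Sum>y\<in>X. W x y * polar_dist d p a x y) =
      (\<Sum>x\<in>X. \<Sum>i<d. \<Sum>y\<in>X. W x y * ((p x i - p y i) * (a x i - a y i)))"
    by (simp add: polar_dist_def sum_distrib_left sum.swap[of _ X "{..<d}"])
  also have "\<dots> = (\<Sum>i<d. \<Sum>x\<in>X. \<Sum>y\<in>X. W x y * ((p x i - p y i) * (a x i - a y i)))"
    by (rule sum.swap)
  also have "\<dots> = (\<Sum>i<d. - 2 * dot X (\<lambda>x. p x i) (mv X W (\<lambda>y. a y i)))"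
    by (intro sum.cong refl laplacian_form[where f = "\<lambda>x. p x _"] stress_sym[OF W] stress_one[OF W])
  finally show ?thesis by (simp add: sum_distrib_left[symmetric] sum_negf)
qed

text \<open>If every velocity of \<open>p\<close> is matched, to first order, by a velocity of \<open>q\<close>, then the differential
  of the measurement map at \<open>q\<close> has at least the image of the one at \<open>p\<close>, so every stress of \<open>q\<close> is one
  of \<open>p\<close>. By genericity of \<open>p\<close> the rank cannot go up, so the stresses agree.\<close>

lemma stress_transfer:
  assumes Y: "finite Y" and E: "E \<subseteq> pairs Y" and p: "generic d Y p"
    and vel: "\<And>a. \<exists>b. \<forall>u v. {u, v} \<in> E \<longrightarrow> polar_dist d p a u v = polar_dist d q b u v"
    and W: "stress d p Y E W"
  shows "stress d q Y E W"
proof -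
  have stress_p: "stress d p Y E U" if U: "stress d q Y E U" for U
    unfolding stress_def
  proof (intro conjI allI ballI impI)
    show "U x y = U y x" for x y by (rule stress_sym[OF U])
    show "U x y = 0" if "x \<notin> Y" for x y by (rule stress_outside[OF U that])
    show "U x y = 0" if "x \<noteq> y" "{x, y} \<notin> E" for x y by (rule stress_nonedge[OF U that])
    show "mv Y U (\<lambda>_. 1) x = 0" if "x \<in> Y" for x by (rule stress_one[OF U that])
    fix i x assume i: "i < d" and x: "x \<in> Y"
    \<comment> \<open>moving a single coordinate reads off a single equilibrium equation\<close>
    define a where "a = (\<lambda>y j. if y = x \<and> j = i then 1 else 0 :: complex)"
    obtain b where b: "\<And>u v. {u, v} \<in> E \<Longrightarrow> polar_dist d p a u v = polar_dist d q b u v"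
      using vel by blast
    have "U u v * polar_dist d p a u v = U u v * polar_dist d q b u v" for u v
    proof (cases "u = v")
      case True
      then show ?thesis by (simp add: polar_dist_def)
    next
      case False
      then show ?thesis using b[of u v] stress_nonedge[OF U False] by auto
    qed
    then have "(\<Sum>i<d. dot Y (\<lambda>x. p x i) (mv Y U (\<lambda>y. a y i))) =
        (\<Sum>i<d. dot Y (\<lambda>x. q x i) (mv Y U (\<lambda>y. b y i)))"
      by (simp only: stress_polar_dist[OF U])
    also have "\<dots> = 0"
    proof (intro sum.neutral ballI)
      fix j assume "j \<in> {..<d}"
      then show "dot Y (\<lambda>x. q x j) (mv Y U (\<lambda>y. b y j)) = 0"
        by (intro stress_dot_affine[OF U] affine_coord) simp
    qed
    finally have "(\<Sum>j<d. dot Y (\<lambda>x. p x j) (mv Y U (\<lambda>y. a y j))) = 0" .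
    moreover have "dot Y (\<lambda>x. p x j) (mv Y U (\<lambda>y. a y j)) = (if j = i then mv Y U (\<lambda>y. p y i) x else 0)" for j
    proof -
      have "dot Y (\<lambda>x. p x j) (mv Y U (\<lambda>y. a y j)) = dot Y (\<lambda>y. a y j) (mv Y U (\<lambda>x. p x j))"
        by (rule dot_mv_sym) (rule stress_sym[OF U])
      also have "\<dots> = (if j = i then mv Y U (\<lambda>y. p y i) x else 0)"
        using Y x by (simp add: dot_def a_def if_distrib[of "\<lambda>c. c * _"] cong: if_cong)
      finally show ?thesis .
    qed
    ultimately show "mv Y U (\<lambda>y. p y i) x = 0" using i by simp
  qed
  have fE: "finite E" using Y E finite_pairs finite_subset by metis
  let ?ind = "\<lambda>B. B \<subseteq> E \<and> rigidity_indep d p B"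
  have e0: "?ind {}" using rigidity_indep_iff_family[of "{}" d p] by (simp add: indep_family_def)
  have bound: "\<forall>B. ?ind B \<longrightarrow> card B < Suc (card E)" using card_mono[OF fE] by (simp add: less_Suc_eq_le)
  obtain B where B': "?ind B \<and> (\<forall>B'. ?ind B' \<longrightarrow> card B' \<le> card B)"
    using ex_has_greatest_nat[of ?ind, OF e0 bound] by (elim exE)
  then have B: "?ind B" and max: "\<And>B'. ?ind B' \<Longrightarrow> card B' \<le> card B" by simp_all
  have fB: "finite B" using B fE finite_subset[of B E] by simp
  have "\<not> rigidity_indep d q (insert e B)" if e: "e \<in> E - B" for e
  proof
    assume "rigidity_indep d q (insert e B)"
    then have "rigidity_indep d p (insert e B)"
      using rigidity_indep_at_generic[OF Y _ p] e B E by blast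
    then show False using max[of "insert e B"] e B fB by auto
  qed
  moreover have "rigidity_indep d q B"
  proof -
    have BY: "B \<subseteq> pairs Y" using B E by blast
    have "U = (\<lambda>_ _. 0)" if U: "stress d q Y B U" for U
    proof -
      have "stress d p Y B U"
        by (rule stress_restrict[OF stress_p[OF stress_mono[OF U]]]) (use B stress_nonedge[OF U] in auto)
      then show ?thesis using B rigidity_indep_iff_stress[OF Y BY] by blast
    qed
    then show ?thesis using rigidity_indep_iff_stress[OF Y BY] by blast
  qed
  ultimately obtain F where F: "\<And>e. e \<in> E - B \<Longrightarrow> stress d q Y (insert e B) (F e)"
      "\<And>e. e \<in> E - B \<Longrightarrow> entry (F e) e = 1"
    using fundamental_stresses[OF Y E, of B d q] B by blast
  have Fq: "stress d q Y E (F e)" if "e \<in> E - B" for e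
    using stress_mono[OF F(1)[OF that]] that B by auto
  have Fp: "stress d p Y (insert e B) (F e)" if "e \<in> E - B" for e
    by (rule stress_restrict[OF stress_p[OF Fq[OF that]]]) (use stress_nonedge[OF F(1)[OF that]] in auto)
  have "W = (\<lambda>x y. \<Sum>e\<in>E - B. entry W e * F e x y)"
    by (rule fundamental_stresses_span[OF Y E _ _ Fp F(2) W]) (use B in auto)
  moreover have "stress d q Y E (\<lambda>x y. \<Sum>e\<in>E - B. entry W e * F e x y)"
    by (intro stress_sum stress_scale Fq)
  ultimately show ?thesis by simp
qed

section \<open>Edges whose deletion destroys global rigidity\<close>

lemma polar_dist_self: "polar_dist d p p u v = sq_dist d p u v"
  by (simp add: polar_dist_def sq_dist_def power2_eq_square)

text \<open>This is where global rigidity enters. Let \<open>q\<close> have the same lengths as \<open>p\<close> except at \<open>{u, v}\<close>. After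
  transfer to a projection \<open>p'\<close> of \<open>P\<close>, the coordinates of \<open>q'\<close> are killed by every stress that avoids
  \<open>{u, v}\<close>, and rescaling them by \<open>s\<close> makes them killed by every such stress of \<open>P\<close>. A stress \<open>W0\<close> that
  uses \<open>{u, v}\<close> evaluates on \<open>p'\<close> to zero, so summed over all coordinates of \<open>q'\<close> its quadratic form
  only sees the change of length at \<open>{u, v}\<close>, which is nonzero; hence some coordinate is a witness.\<close>

lemma essential_edge_witness:
  assumes X: "finite X" and E: "E \<subseteq> pairs X" and S: "S \<subseteq> X" and P: "generic (d + card S) X P"
    and e: "{u, v} \<in> E" "u \<noteq> v" "u \<notin> S" "v \<notin> S"
    and p: "generic d (X - S) p"
    and eq: "\<And>x y. {x, y} \<in> E - {{u, v}} \<Longrightarrow> x \<notin> S \<Longrightarrow> y \<notin> S \<Longrightarrow> sq_dist d p x y = sq_dist d q x y"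
    and neq: "sq_dist d p u v \<noteq> sq_dist d q u v"
    and W0: "stress (d + card S) P X E W0" "entry W0 {u, v} \<noteq> 0"
  shows "\<exists>k. (\<forall>W. stress (d + card S) P X (E - {{u, v}}) W \<longrightarrow> (\<forall>x\<in>X. mv X W k x = 0)) \<and>
    dot X k (mv X W0 k) \<noteq> 0"
proof -
  let ?D = "d + card S" and ?Y = "X - S" and ?e = "{u, v}"
  have Y: "finite ?Y" and fS: "finite S" using X S finite_subset by auto
  have uvY: "u \<in> ?Y" "v \<in> ?Y" using e E by (auto simp: pairs_def)
  obtain p' s where p': "generic d ?Y p'" and s0: "\<forall>x\<in>S. s x = 0" and s: "\<forall>x\<in>?Y. s x \<noteq> 0"
    and aff: "\<forall>a\<in>affine_functions d p'. \<exists>b\<in>affine_functions ?D P. \<forall>x\<in>X. b x = s x * a x"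
    and interp: "\<forall>g. \<exists>b\<in>affine_functions ?D P. \<forall>x\<in>S. b x = g x"
    using iterated_projection[OF fS X S P] by (elim exE conjE)
  obtain q' where iff': "\<forall>x\<in>?Y. \<forall>y\<in>?Y.
      sq_dist d p x y = sq_dist d q x y \<longleftrightarrow> sq_dist d p' x y = sq_dist d q' x y"
    and vel: "\<forall>a. \<exists>b. \<forall>x\<in>?Y. \<forall>y\<in>?Y. sq_dist d p x y = sq_dist d q x y \<longrightarrow>
       polar_dist d p' a x y = polar_dist d q' b x y"
    using transfer_equivalent_framework[OF Y p p', of q] by (elim exE conjE)
  have iff: "sq_dist d p x y = sq_dist d q x y \<longleftrightarrow> sq_dist d p' x y = sq_dist d q' x y"
    if "x \<in> ?Y" "y \<in> ?Y" for x y using iff' that by blast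
  define V where "V W = (\<lambda>x y. s x * W x y * s y)" for W
  have mvV: "mv ?Y (V W) f x = s x * mv X W (\<lambda>y. s y * f y) x" for W f x
  proof -
    have "mv X W (\<lambda>y. s y * f y) x = (\<Sum>y\<in>?Y. W x y * (s y * f y))"
      unfolding mv_def using X s0 by (intro sum.mono_neutral_right) auto
    then show ?thesis by (simp add: mv_def V_def sum_distrib_left mult_ac)
  qed
  have V: "stress d p' ?Y {f \<in> F. f \<subseteq> ?Y} (V W)" if W: "stress ?D P X F W" for F W
    unfolding stress_def
  proof (intro conjI allI ballI impI)
    show "V W x y = V W y x" for x y using stress_sym[OF W, of x y] by (simp add: V_def)
    have out: "V W x y = 0" if "x \<notin> ?Y \<or> y \<notin> ?Y" for x y
      using that s0 stress_outside[OF W, of x y] stress_outside'[OF W, of y x] by (auto simp: V_def)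
    then show "V W x y = 0" if "x \<notin> ?Y" for x y using that by blast
    show "V W x y = 0" if "x \<noteq> y" "{x, y} \<notin> {f \<in> F. f \<subseteq> ?Y}" for x y
    proof (cases "x \<in> ?Y \<and> y \<in> ?Y")
      case True
      then have "{x, y} \<notin> F" using that by auto
      then show ?thesis using stress_nonedge[OF W that(1)] by (simp add: V_def)
    qed (use out in blast)
    have "mv ?Y (V W) a x = 0" if a: "a \<in> affine_functions d p'" for a x
    proof -
      obtain b where b: "b \<in> affine_functions ?D P" "\<forall>x\<in>X. b x = s x * a x" using bspec[OF aff a] by blast
      have "mv X W (\<lambda>y. s y * a y) x = mv X W b x"
        unfolding mv_def using b(2) by (intro sum.cong) auto
      then show ?thesis using stress_affine[OF W b(1)] by (simp add: mvV)
    qed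
    then show "mv ?Y (V W) (\<lambda>_. 1) x = 0" for x by (simp add: affine_const)
    fix i x assume "i < d"
    with \<open>\<And>a x. a \<in> affine_functions d p' \<Longrightarrow> mv ?Y (V W) a x = 0\<close>
    show "mv ?Y (V W) (\<lambda>y. p' y i) x = 0" by (simp add: affine_coord)
  qed
  let ?E' = "{f \<in> E - {?e}. f \<subseteq> ?Y}"
  have E'Y: "?E' \<subseteq> pairs ?Y" using E by (auto simp: pairs_def)
  have eqE: "sq_dist d p x y = sq_dist d q x y" if "{x, y} \<in> ?E'" for x y
    using that by (intro eq) auto
  have velE: "\<exists>b. \<forall>x y. {x, y} \<in> ?E' \<longrightarrow> polar_dist d p' a x y = polar_dist d q' b x y" for a
  proof -
    obtain b where b: "\<forall>x\<in>?Y. \<forall>y\<in>?Y. sq_dist d p x y = sq_dist d q x y \<longrightarrow>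
       polar_dist d p' a x y = polar_dist d q' b x y" using spec[OF vel, of a] by (elim exE)
    have "polar_dist d p' a x y = polar_dist d q' b x y" if xy: "{x, y} \<in> ?E'" for x y
    proof -
      have "x \<in> ?Y" "y \<in> ?Y" using xy by auto
      then show ?thesis using b eqE[OF xy] by blast
    qed
    then show ?thesis by blast
  qed
  define k where "k i = (\<lambda>x. s x * q' x i)" for i
  have kill: "mv X W (k i) x = 0" if W: "stress ?D P X (E - {?e}) W" and i: "i < d" and x: "x \<in> X" for W i x
  proof -
    have "stress d q' ?Y ?E' (V W)" by (rule stress_transfer[OF Y E'Y p' velE V[OF W]])
    then have onY: "mv X W (k i) x = 0" if "x \<in> ?Y" for x
      using stress_coord[of d q' ?Y ?E' "V W" i x] i that s by (simp add: mvV k_def)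
    show ?thesis
    proof (cases "x \<in> S")
      case True
      obtain b where b: "b \<in> affine_functions ?D P" "\<forall>y\<in>S. b y = (if y = x then 1 else 0)"
        using spec[OF interp, of "\<lambda>y. if y = x then 1 else 0"] by blast
      have "0 = dot X b (mv X W (k i))" using stress_dot_affine[OF W b(1)] by simp
      also have "\<dots> = (\<Sum>y\<in>{x}. b y * mv X W (k i) y)"
        unfolding dot_def
      proof (rule sum.mono_neutral_right[OF X])
        show "\<forall>y\<in>X - {x}. b y * mv X W (k i) y = 0"
        proof
          fix y assume "y \<in> X - {x}"
          then show "b y * mv X W (k i) y = 0" using b(2) onY[of y] by (cases "y \<in> S") auto
        qed
      qed (use x in auto)
      finally show ?thesis using b(2) True by simp
    qed (use onY x in simp)
  qed
  have dots: "dot X (k i) (mv X W0 (k i)) = dot ?Y (\<lambda>x. q' x i) (mv ?Y (V W0) (\<lambda>y. q' y i))" for i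
  proof -
    have "dot X (k i) (mv X W0 (k i)) = (\<Sum>x\<in>?Y. k i x * mv X W0 (k i) x)"
      unfolding dot_def using X s0 by (intro sum.mono_neutral_right) (auto simp: k_def)
    then show ?thesis by (simp add: dot_def mvV k_def mult_ac)
  qed
  note V0 = V[OF W0(1)]
  let ?T = "\<lambda>x y. V W0 x y * (sq_dist d q' x y - sq_dist d p' x y)"
  have T0: "?T x y = 0" if "x \<in> ?Y" "y \<in> ?Y" "{x, y} \<noteq> ?e" for x y
  proof (cases "x = y")
    case True
    then show ?thesis by (simp add: sq_dist_def)
  next
    case False
    show ?thesis
    proof (cases "{x, y} \<in> E")
      case True
      then show ?thesis using iff[OF that(1,2)] eqE[of x y] that by auto
    next
      case no: False
      then show ?thesis using stress_nonedge[OF V0 False] by auto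
    qed
  qed
  have "(\<Sum>x\<in>?Y. \<Sum>y\<in>?Y. ?T x y) = (\<Sum>x\<in>{u, v}. \<Sum>y\<in>?Y. ?T x y)"
  proof (rule sum.mono_neutral_right[OF Y])
    show "\<forall>x\<in>?Y - {u, v}. (\<Sum>y\<in>?Y. ?T x y) = 0"
      by (intro ballI sum.neutral T0) auto
  qed (use uvY in auto)
  also have "\<dots> = (\<Sum>y\<in>?Y. ?T u y) + (\<Sum>y\<in>?Y. ?T v y)" using e(2) by simp
  also have "(\<Sum>y\<in>?Y. ?T u y) = (\<Sum>y\<in>{v}. ?T u y)"
  proof (rule sum.mono_neutral_right[OF Y])
    show "\<forall>y\<in>?Y - {v}. ?T u y = 0"
      by (intro ballI T0) (use uvY in \<open>auto simp: doubleton_eq_iff\<close>)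
  qed (use uvY in auto)
  also have "(\<Sum>y\<in>?Y. ?T v y) = (\<Sum>y\<in>{u}. ?T v y)"
  proof (rule sum.mono_neutral_right[OF Y])
    show "\<forall>y\<in>?Y - {u}. ?T v y = 0"
      by (intro ballI T0) (use uvY in \<open>auto simp: doubleton_eq_iff\<close>)
  qed (use uvY in auto)
  finally have sumT: "(\<Sum>x\<in>?Y. \<Sum>y\<in>?Y. ?T x y) = 2 * ?T u v"
    using stress_sym[OF V0, of u v] by (simp add: sq_dist_commute[of d _ v u])
  have "W0 u v \<noteq> 0" using W0 entry_stress[OF W0(1) e(2)] by simp
  then have "?T u v \<noteq> 0" using s uvY iff[OF uvY] neq by (auto simp: V_def)
  then have T_nz: "(\<Sum>x\<in>?Y. \<Sum>y\<in>?Y. ?T x y) \<noteq> 0" unfolding sumT by simp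
  have "(\<Sum>i<d. dot ?Y (\<lambda>x. p' x i) (mv ?Y (V W0) (\<lambda>y. p' y i))) = 0"
    by (intro sum.neutral ballI) (auto intro!: stress_dot_affine[OF V0] affine_coord)
  then have "(\<Sum>x\<in>?Y. \<Sum>y\<in>?Y. V W0 x y * sq_dist d p' x y) = 0"
    using stress_polar_dist[OF V0, of p' p'] by (simp add: polar_dist_self)
  then have "(\<Sum>x\<in>?Y. \<Sum>y\<in>?Y. V W0 x y * sq_dist d q' x y) \<noteq> 0"
    using T_nz by (simp add: right_diff_distrib sum_subtractf)
  then have nz: "(\<Sum>i<d. dot X (k i) (mv X W0 (k i))) \<noteq> 0"
    unfolding dots using stress_polar_dist[OF V0, of q' q'] by (simp add: polar_dist_self)
  have "\<exists>i<d. dot X (k i) (mv X W0 (k i)) \<noteq> 0"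
  proof (rule ccontr)
    assume "\<not> ?thesis"
    then have "(\<Sum>i<d. dot X (k i) (mv X W0 (k i))) = 0" by (intro sum.neutral) auto
    with nz show False by contradiction
  qed
  then obtain i where "i < d" "dot X (k i) (mv X W0 (k i)) \<noteq> 0" by blast
  then show ?thesis using kill by (intro exI[of _ "k i"]) blast
qed

text \<open>Minimality supplies the data of the previous lemma: a set \<open>S\<close> of vertices and a set \<open>F\<close> of edges
  whose deletion together with \<open>e\<close> destroys global rigidity, while restoring \<open>e\<close> alone brings it back, so that
  a violating pair of frameworks must disagree at \<open>e\<close>. Deleting a vertex costs one dimension, and so
  does deleting an edge through one of its ends; padding to exactly \<open>(k - 1) + (l - 1)\<close> vertices of \<open>X\<close>
  makes the dimension come out as \<open>d\<close>.\<close>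

lemma minimal_edge_witness:
  assumes dkl: "k \<ge> 1" "l \<ge> 1" and G: "fin_simple_graph G" and min: "minimally_globally_rigid_kl k l d G"
    and XG: "X \<subseteq> verts G" and cX: "card X \<ge> d + (k - 1) + (l - 1) + 2"
    and P: "generic (d + (k - 1) + (l - 1)) X P"
    and e: "e \<in> edges (induced_subgraph G X)"
    and W0: "stress (d + (k - 1) + (l - 1)) P X (edges (induced_subgraph G X)) W0" "entry W0 e \<noteq> 0"
  shows "\<exists>h. (\<forall>W. stress (d + (k - 1) + (l - 1)) P X (edges (induced_subgraph G X) - {e}) W \<longrightarrow>
      (\<forall>x\<in>X. mv X W h x = 0)) \<and> dot X h (mv X W0 h) \<noteq> 0"
proof -
  let ?E = "edges (induced_subgraph G X)"
  have fV: "finite (verts G)" and edgeG: "\<And>f. f \<in> edges G \<Longrightarrow> f \<subseteq> verts G \<and> card f = 2"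
    using G by (auto simp: fin_simple_graph_def)
  have X: "finite X" using fV XG finite_subset by blast
  have fE: "finite (edges G)" by (rule finite_subset[of _ "Pow (verts G)"]) (use edgeG fV in auto)
  have E: "?E \<subseteq> pairs X" using edgeG by (auto simp: induced_subgraph_def pairs_def)
  have eG: "e \<in> edges G" "e \<subseteq> X" using e by (auto simp: induced_subgraph_def)
  obtain u v where uv: "e = {u, v}" "u \<noteq> v" using edgeG[OF eG(1)] by (auto simp: card_2_iff)
  let ?H = "delete_graph G {} {e}"
  have "globally_rigid_kl k l d G" "\<not> globally_rigid_kl k l d ?H"
    using min eG(1) by (auto simp: minimally_globally_rigid_kl_def)
  moreover have "verts ?H = verts G" "edges ?H = edges G - {e}" by (auto simp: delete_graph_def)
  ultimately have rigid: "\<And>S F. S \<subseteq> verts G \<Longrightarrow> F \<subseteq> edges G \<Longrightarrow> card S \<le> k - 1 \<Longrightarrow> card F \<le> l - 1 \<Longrightarrow>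
      globally_rigid d (delete_graph G S F)"
    and "\<exists>S F. S \<subseteq> verts G \<and> F \<subseteq> edges G - {e} \<and> card S \<le> k - 1 \<and> card F \<le> l - 1 \<and>
      \<not> globally_rigid d (delete_graph ?H S F)"
    unfolding globally_rigid_kl_def by simp_all
  then obtain S F where S: "S \<subseteq> verts G" "card S \<le> k - 1" and F: "F \<subseteq> edges G - {e}" "card F \<le> l - 1"
    and nr: "\<not> globally_rigid d (delete_graph ?H S F)" by blast
  have r: "globally_rigid d (delete_graph G S F)" using rigid S F by blast
  have H_eq: "delete_graph ?H S F = (verts G - S, {f \<in> edges G - F - {e}. f \<inter> S = {}})"
    by (auto simp: delete_graph_def)
  from nr obtain p q x y where p: "generic d (verts G - S) p"
    and meas: "\<And>f. f \<in> edges G - F - {e} \<Longrightarrow> f \<inter> S = {} \<Longrightarrow> measurement d p f = measurement d q f"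
    and xy: "x \<in> verts G - S" "y \<in> verts G - S" "sq_dist d p x y \<noteq> sq_dist d q x y"
    unfolding globally_rigid_def H_eq by auto
  have vS: "verts (delete_graph G S F) = verts G - S" by (simp add: delete_graph_def)
  have not_all: "\<not> (\<forall>f\<in>edges (delete_graph G S F). measurement d p f = measurement d q f)"
  proof
    assume "\<forall>f\<in>edges (delete_graph G S F). measurement d p f = measurement d q f"
    then have "\<forall>u\<in>verts G - S. \<forall>v\<in>verts G - S. sq_dist d p u v = sq_dist d q u v"
      using r[unfolded globally_rigid_def vS, rule_format, of p q] p by blast
    then show False using xy by blast
  qed
  then obtain f where f: "f \<in> edges G - F" "f \<inter> S = {}" "measurement d p f \<noteq> measurement d q f"
    by (auto simp: delete_graph_def)
  then have "f = e" using meas by blast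
  then have eS: "e \<inter> S = {}" and neq: "sq_dist d p u v \<noteq> sq_dist d q u v"
    using f by (auto simp: uv measurement_pair)
  \<comment> \<open>Every deleted edge is killed by deleting one of its ends, chosen outside the edge under consideration.\<close>
  have "\<exists>z. z \<in> f \<and> z \<notin> e" if "f \<in> F" for f
  proof (rule ccontr)
    assume "\<not> ?thesis"
    then have "f \<subseteq> e" by blast
    moreover have "card f = 2" "card e = 2" "finite e" using F that edgeG eG(1) uv by auto
    ultimately have "f = e" by (simp add: card_subset_eq)
    then show False using F that by blast
  qed
  then obtain z where z: "\<And>f. f \<in> F \<Longrightarrow> z f \<in> f \<and> z f \<notin> e" by metis
  define S0 where "S0 = (S \<union> z ` F) \<inter> X"
  have fF: "finite F" using F fE finite_subset by blast
  have fS: "finite S" using S fV finite_subset by blast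
  have "card S0 \<le> card (S \<union> z ` F)" unfolding S0_def using fS fF by (intro card_mono) auto
  also have "\<dots> \<le> card S + card F"
    using card_Un_le[of S "z ` F"] card_image_le[OF fF, of z] by linarith
  finally have cS0: "card S0 \<le> (k - 1) + (l - 1)" using S F by linarith
  have "S0 \<subseteq> X - e" using eS z by (auto simp: S0_def)
  moreover have room: "(k - 1) + (l - 1) \<le> card (X - e)"
  proof -
    have "card (X - e) = card X - 2" using eG uv X by (simp add: card_Diff_subset)
    then show ?thesis using cX by linarith
  qed
  ultimately obtain S' where S': "S0 \<subseteq> S'" "S' \<subseteq> X - e" "card S' = (k - 1) + (l - 1)"
    using exists_subset_between[OF cS0 room] X by blast
  have D: "d + card S' = d + (k - 1) + (l - 1)" using S' by simp
  have gen: "generic d (X - S') p"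
    by (rule generic_subset[OF p]) (use XG S'(1) in \<open>auto simp: S0_def\<close>)
  have dist: "sq_dist d p a b = sq_dist d q a b"
    if ab: "{a, b} \<in> ?E - {{u, v}}" "a \<notin> S'" "b \<notin> S'" for a b
  proof -
    have abX: "{a, b} \<in> edges G" "a \<in> X" "b \<in> X" "{a, b} \<noteq> e" using ab uv by (auto simp: induced_subgraph_def)
    have "a \<notin> S0" "b \<notin> S0" using ab S' by auto
    then have "a \<notin> S" "b \<notin> S" "a \<notin> z ` F" "b \<notin> z ` F" using abX by (auto simp: S0_def)
    moreover have "{a, b} \<notin> F"
    proof
      assume "{a, b} \<in> F"
      then have "z {a, b} = a \<or> z {a, b} = b" using z by blast
      then show False using \<open>{a, b} \<in> F\<close> \<open>a \<notin> z ` F\<close> \<open>b \<notin> z ` F\<close> by (metis imageI)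
    qed
    ultimately have "measurement d p {a, b} = measurement d q {a, b}"
      using meas[of "{a, b}"] abX by blast
    then show ?thesis by (simp add: measurement_pair)
  qed
  have S'X: "S' \<subseteq> X" and uS: "u \<notin> S'" and vS: "v \<notin> S'" using S'(2) uv(1) by auto
  show ?thesis
    unfolding uv(1)
    by (rule essential_edge_witness[OF X E S'X _ _ uv(2) uS vS gen dist neq, unfolded D])
       (use P e W0 uv(1) in simp_all)
qed

section \<open>The space of stresses\<close>

text \<open>Stresses do not see affine functions, so a witness may be made to vanish on \<open>D + 1\<close> given points.\<close>

lemma normalised_witness:
  assumes T: "T \<subseteq> X" "finite T" "card T \<le> D + 1" and P: "interpolating D X P"
    and W0: "stress D P X E W0"
    and kill: "\<And>W x. stress D P X E' W \<Longrightarrow> x \<in> X \<Longrightarrow> mv X W h x = 0"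
    and nz: "dot X h (mv X W0 h) \<noteq> 0"
  shows "\<exists>k. (\<forall>W. stress D P X E' W \<longrightarrow> (\<forall>x\<in>X. mv X W k x = 0)) \<and> (\<forall>t\<in>T. k t = 0) \<and>
    dot X k (mv X W0 k) \<noteq> 0"
proof -
  obtain a where a: "a \<in> affine_functions D P" "\<forall>t\<in>T. a t = h t"
    using P T unfolding interpolating_def by meson
  let ?k = "\<lambda>x. h x - a x"
  have "mv X W ?k x = 0" if "stress D P X E' W" "x \<in> X" for W x
    using kill[OF that] stress_affine[OF that(1) a(1)] by (simp add: mv_fun_diff)
  moreover have "dot X ?k (mv X W0 ?k) = dot X h (mv X W0 h)"
  proof -
    have "mv X W0 ?k = mv X W0 h"
      using stress_affine[OF W0 a(1)] by (simp add: mv_fun_diff fun_eq_iff)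
    then have "dot X ?k (mv X W0 ?k) = dot X h (mv X W0 h) - dot X a (mv X W0 h)"
      by (simp add: dot_def left_diff_distrib sum_subtractf)
    then show ?thesis using stress_dot_affine[OF W0 a(1)] by simp
  qed
  ultimately show ?thesis using a(2) nz by (intro exI[of _ ?k]) auto
qed

lemma dot_commute: "dot X f g = dot X g f"
  by (simp add: dot_def mult.commute)

lemma dot_sum_right: "dot X f (\<lambda>x. \<Sum>j\<in>J. u j * g j x) = (\<Sum>j\<in>J. u j * dot X f (g j))"
  unfolding dot_def sum_distrib_left by (subst sum.swap) (simp add: mult_ac)

lemma dot_add_right: "dot X f (\<lambda>x. g x + h x) = dot X f g + dot X f h"
  by (simp add: dot_def distrib_left sum.distrib)

lemma dot_cong: "(\<And>x. x \<in> X \<Longrightarrow> f x = f' x) \<Longrightarrow> (\<And>x. x \<in> X \<Longrightarrow> g x = g' x) \<Longrightarrow> dot X f g = dot X f' g'"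
  by (simp add: dot_def)

text \<open>For \<open>e\<close> outside a basis \<open>B\<close> let \<open>F e\<close> be the fundamental stress, \<open>k e\<close> a witness and \<open>v e\<close> the image of
  \<open>k e\<close> under \<open>F e\<close>. For \<open>e \<noteq> f\<close> the stress \<open>F f\<close> avoids \<open>e\<close> and kills \<open>k e\<close>; by symmetry \<open>v e\<close> is
  orthogonal to \<open>k f\<close>, but not to \<open>k e\<close>. So the witnesses are linearly independent even modulo affine
  functions, which gives the inequality.

  In the case of equality they form a basis modulo affine functions and diagonalise all stresses
  simultaneously. Each \<open>F e\<close> is a multiple of the rank-one matrix built from \<open>v e\<close>, and all off-diagonal entries on
  the support \<open>T e\<close> of \<open>v e\<close> are nonzero, so this support is a clique; being an affine dependence of
  points in general position, \<open>v e\<close> has at least \<open>D + 2\<close> nonzero entries. An edge \<open>g\<close> shared by two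
  cliques would have its own witness \<open>h\<close>, and the combination of the two stresses that avoids \<open>g\<close> kills
  \<open>h\<close>, which makes the two vectors \<open>v\<close> proportional.\<close>

lemma stress_space_structure:
  assumes X: "finite X" and E: "E \<subseteq> pairs X" and P: "interpolating D X P" and cX: "D + 1 \<le> card X"
    and B: "B \<subseteq> E" "rigidity_indep D P B"
    and max: "\<And>e. e \<in> E - B \<Longrightarrow> \<not> rigidity_indep D P (insert e B)"
    and witness: "\<And>e W0. e \<in> E \<Longrightarrow> stress D P X E W0 \<Longrightarrow> entry W0 e \<noteq> 0 \<Longrightarrow>
      \<exists>h. (\<forall>W. stress D P X (E - {e}) W \<longrightarrow> (\<forall>x\<in>X. mv X W h x = 0)) \<and> dot X h (mv X W0 h) \<noteq> 0"
  shows "card (E - B) + D + 1 \<le> card X"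
    and "card (E - B) + D + 1 = card X \<Longrightarrow> \<exists>T. \<forall>e\<in>E - B. T e \<subseteq> X \<and> D + 2 \<le> card (T e) \<and> pairs (T e) \<subseteq> E \<and>
      (\<forall>f\<in>E - B. f \<noteq> e \<longrightarrow> pairs (T e) \<inter> pairs (T f) = {})"
proof -
  let ?J = "E - B"
  have fE: "finite E" using X E finite_pairs finite_subset by metis
  then have fJ: "finite ?J" by simp
  obtain F where F: "\<And>e. e \<in> ?J \<Longrightarrow> stress D P X (insert e B) (F e)" "\<And>e. e \<in> ?J \<Longrightarrow> entry (F e) e = 1"
    using fundamental_stresses[OF X E B] max by blast
  have FE: "stress D P X E (F e)" if "e \<in> ?J" for e
    using stress_mono[OF F(1)[OF that]] that B by auto
  have F_avoid: "stress D P X (E - {e}) (F f)" if "e \<in> ?J" "f \<in> ?J" "e \<noteq> f" for e f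
    using stress_mono[OF F(1)[OF that(2)], of "E - {e}"] that B by auto
  obtain T0 where T0: "T0 \<subseteq> X" "card T0 = D + 1" "finite T0"
    using obtain_subset_with_card_n[OF cX] by blast
  have "\<exists>k. (\<forall>W. stress D P X (E - {e}) W \<longrightarrow> (\<forall>x\<in>X. mv X W k x = 0)) \<and> (\<forall>t\<in>T0. k t = 0) \<and>
      dot X k (mv X (F e) k) \<noteq> 0" if e: "e \<in> ?J" for e
  proof -
    obtain h where "\<forall>W. stress D P X (E - {e}) W \<longrightarrow> (\<forall>x\<in>X. mv X W h x = 0)" "dot X h (mv X (F e) h) \<noteq> 0"
      using witness[of e "F e"] e FE[OF e] F(2)[OF e] by auto
    then show ?thesis using normalised_witness[OF T0(1,3) _ P FE[OF e], of "E - {e}" h] T0(2) by simp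
  qed
  then obtain k where kill: "\<And>e W x. e \<in> ?J \<Longrightarrow> stress D P X (E - {e}) W \<Longrightarrow> x \<in> X \<Longrightarrow> mv X W (k e) x = 0"
    and k0: "\<And>e t. e \<in> ?J \<Longrightarrow> t \<in> T0 \<Longrightarrow> k e t = 0"
    and k_nz: "\<And>e. e \<in> ?J \<Longrightarrow> dot X (k e) (mv X (F e) (k e)) \<noteq> 0" by metis
  define v where "v e = mv X (F e) (k e)" for e
  have orth: "dot X (v e) (k f) = 0" if "e \<in> ?J" "f \<in> ?J" "e \<noteq> f" for e f
  proof -
    have "dot X (v e) (k f) = dot X (k e) (mv X (F e) (k f))"
      unfolding v_def dot_commute[of X "mv X (F e) (k e)"] by (rule dot_mv_sym) (rule stress_sym[OF FE[OF that(1)]])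
    also have "\<dots> = 0"
      using kill[OF that(2) F_avoid[OF that(2,1)]] that(3) by (auto simp: dot_def intro: sum.neutral)
    finally show ?thesis .
  qed
  define \<kappa> where "\<kappa> e = dot X (v e) (k e)" for e
  have \<kappa>: "\<kappa> e \<noteq> 0" if "e \<in> ?J" for e using k_nz[OF that] by (simp add: \<kappa>_def v_def dot_commute)
  have pick: "(\<Sum>f\<in>?J. u f * dot X (v e) (k f)) = u e * \<kappa> e" if e: "e \<in> ?J" for u e
  proof -
    have "(\<Sum>f\<in>?J. u f * dot X (v e) (k f)) = (\<Sum>f\<in>{e}. u f * dot X (v e) (k f))"
      using fJ e orth by (intro sum.mono_neutral_right) auto
    then show ?thesis by (simp add: \<kappa>_def)
  qed
  have ind: "indep_family ?J (X - T0) k"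
    unfolding indep_family_def
  proof (intro allI impI ballI)
    fix u e assume u: "\<forall>x\<in>X - T0. (\<Sum>f\<in>?J. u f * k f x) = 0" and e: "e \<in> ?J"
    have "(\<Sum>f\<in>?J. u f * k f x) = 0" if "x \<in> X" for x
    proof (cases "x \<in> T0")
      case True
      then show ?thesis using k0 by (intro sum.neutral) auto
    qed (use u that in blast)
    then have "dot X (v e) (\<lambda>x. \<Sum>f\<in>?J. u f * k f x) = 0" by (simp add: dot_def)
    then show "u e = 0" using pick[OF e] \<kappa>[OF e] by (simp add: dot_sum_right)
  qed
  have cM: "card (X - T0) = card X - (D + 1)" using T0 X by (simp add: card_Diff_subset)
  have "card ?J \<le> card (X - T0)" using indep_family_card(1)[OF fJ _ ind] X by simp
  then show "card ?J + D + 1 \<le> card X" using cM cX by simp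
  assume tight: "card ?J + D + 1 = card X"
  then have full: "card ?J = card (X - T0)" using cM by simp
  \<comment> \<open>Modulo affine functions the witnesses now form a basis, in which every fundamental stress is
    diagonal with a single nonzero entry.\<close>
  have rank_one: "F e y x = v e y * v e x / \<kappa> e" if e: "e \<in> ?J" and xy: "x \<in> X" "y \<in> X" for e x y
  proof -
    let ?\<delta> = "\<lambda>z. if z = x then 1 else 0 :: complex"
    have "\<exists>a\<in>affine_functions D P. \<forall>t\<in>T0. a t = ?\<delta> t"
      by (rule P[unfolded interpolating_def, rule_format]) (use T0 in simp)
    then obtain a where a: "a \<in> affine_functions D P" "\<forall>t\<in>T0. a t = ?\<delta> t" by (elim bexE)
    obtain u where u: "\<forall>z\<in>X - T0. (\<Sum>f\<in>?J. u f * k f z) = ?\<delta> z - a z"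
      using indep_family_card(2)[OF fJ _ ind full, of "\<lambda>z. ?\<delta> z - a z"] X by auto
    have \<delta>: "?\<delta> z = a z + (\<Sum>f\<in>?J. u f * k f z)" if "z \<in> X" for z
    proof (cases "z \<in> T0")
      case True
      have "(\<Sum>f\<in>?J. u f * k f z) = 0" using k0 True by (intro sum.neutral) auto
      then show ?thesis using a(2) True by simp
    next
      case False
      then show ?thesis using u that by simp
    qed
    have "v e x = dot X (v e) ?\<delta>"
      using X xy by (simp add: dot_def if_distrib[of "(*) _"] cong: if_cong)
    also have "\<dots> = dot X (v e) (\<lambda>z. a z + (\<Sum>f\<in>?J. u f * k f z))"
      by (rule dot_cong) (use \<delta> in auto)
    also have "\<dots> = dot X (v e) a + u e * \<kappa> e"
      by (simp only: dot_add_right dot_sum_right pick[OF e])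
    also have "dot X (v e) a = 0"
      using stress_dot_affine[OF FE[OF e] a(1)] by (simp add: v_def dot_commute)
    finally have ve: "v e x = u e * \<kappa> e" by simp
    have "F e y x = mv X (F e) ?\<delta> y"
      using X xy by (simp add: mv_def if_distrib[of "(*) _"] cong: if_cong)
    also have "\<dots> = mv X (F e) (\<lambda>z. a z + (\<Sum>f\<in>?J. u f * k f z)) y"
      unfolding mv_def by (intro sum.cong) (use \<delta> in auto)
    also have "\<dots> = (\<Sum>f\<in>?J. u f * mv X (F e) (k f) y)"
      using stress_affine[OF FE[OF e] a(1)] by (simp add: mv_fun_add mv_fun_sum mv_fun_scale)
    also have "\<dots> = (\<Sum>f\<in>{e}. u f * mv X (F e) (k f) y)"
      using fJ e xy kill F_avoid by (intro sum.mono_neutral_right) auto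
    finally show ?thesis using ve \<kappa>[OF e] by (simp add: v_def)
  qed
  have apply_F: "mv X (F e) h y = (dot X (v e) h / \<kappa> e) * v e y" if "e \<in> ?J" "y \<in> X" for e h y
  proof -
    have "mv X (F e) h y = (\<Sum>x\<in>X. v e y * v e x / \<kappa> e * h x)"
      unfolding mv_def using that by (intro sum.cong refl) (simp add: rank_one)
    then show ?thesis by (simp add: dot_def sum_distrib_left sum_divide_distrib mult_ac)
  qed
  define T where "T e = {x \<in> X. v e x \<noteq> 0}" for e
  have F_nz: "F e x y \<noteq> 0" if "e \<in> ?J" "x \<in> T e" "y \<in> T e" for e x y
    using rank_one[OF that(1), of y x] \<kappa>[OF that(1)] that by (auto simp: T_def)
  have clique: "pairs (T e) \<subseteq> E" if e: "e \<in> ?J" for e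
  proof
    fix g assume "g \<in> pairs (T e)"
    then obtain x y where g: "g = {x, y}" "x \<noteq> y" "x \<in> T e" "y \<in> T e" by (rule pairsE)
    then show "g \<in> E" using F_nz[OF e g(3,4)] stress_nonedge[OF FE[OF e] g(2)] by auto
  qed
  have large: "D + 2 \<le> card (T e)" if e: "e \<in> ?J" for e
  proof (rule ccontr)
    assume "\<not> D + 2 \<le> card (T e)"
    moreover have "T e \<subseteq> X" "finite (T e)" using X by (auto simp: T_def)
    moreover obtain x0 where x0: "x0 \<in> T e"
      using \<kappa>[OF e] sum.neutral[of X "\<lambda>x. v e x * k e x"] by (auto simp: \<kappa>_def dot_def T_def)
    ultimately obtain a where a: "a \<in> affine_functions D P" "\<forall>t\<in>T e. a t = (if t = x0 then 1 else 0)"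
      using P[unfolded interpolating_def, rule_format, of "T e" "\<lambda>t. if t = x0 then 1 else 0"] by auto
    have "0 = dot X a (v e)" using stress_dot_affine[OF FE[OF e] a(1)] by (simp add: v_def)
    also have "\<dots> = (\<Sum>x\<in>{x0}. a x * v e x)"
      unfolding dot_def using X x0 a(2) by (intro sum.mono_neutral_right) (auto simp: T_def)
    finally show False using a(2) x0 by (simp add: T_def)
  qed
  have disj: "pairs (T e) \<inter> pairs (T f) = {}" if e: "e \<in> ?J" and f: "f \<in> ?J" and "f \<noteq> e" for e f
  proof (rule ccontr)
    assume "pairs (T e) \<inter> pairs (T f) \<noteq> {}"
    then obtain g where g: "g \<in> pairs (T e)" "g \<in> pairs (T f)" by blast
    then obtain x y where xy: "g = {x, y}" "x \<noteq> y" "x \<in> T e" "y \<in> T e" by (auto elim: pairsE)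
    then have xyf: "x \<in> T f" "y \<in> T f" using g by (auto simp: pairs_def)
    have gE: "g \<in> E" using clique[OF e] g by blast
    have ent: "entry (F e) g \<noteq> 0" "entry (F f) g \<noteq> 0"
      using F_nz[OF e xy(3,4)] F_nz[OF f xyf] entry_stress[OF FE[OF e] xy(2)] entry_stress[OF FE[OF f] xy(2)] xy(1)
      by auto
    obtain h where h: "\<And>W z. stress D P X (E - {g}) W \<Longrightarrow> z \<in> X \<Longrightarrow> mv X W h z = 0"
      and h_nz: "dot X h (mv X (F e) h) \<noteq> 0"
      using witness[OF gE FE[OF e] ent(1)] by blast
    define r where "r = entry (F f) g / entry (F e) g"
    have r: "r \<noteq> 0" using ent by (simp add: r_def)
    let ?R = "\<lambda>x y. F f x y - r * F e x y"
    have R: "stress D P X E ?R" by (intro stress_diff stress_scale FE e f)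
    have Rg: "stress D P X (E - {g}) ?R"
    proof (rule stress_restrict[OF R])
      fix x' y' assume "x' \<noteq> y'" "{x', y'} \<in> E - (E - {g})"
      then have "{x', y'} = g" by auto
      then show "?R x' y' = 0"
        using entry_stress[OF FE[OF e] \<open>x' \<noteq> y'\<close>] entry_stress[OF FE[OF f] \<open>x' \<noteq> y'\<close>] ent
        by (simp add: r_def)
    qed
    have eq: "mv X (F f) h z = r * mv X (F e) h z" if "z \<in> X" for z
    proof -
      have "mv X ?R h z = 0" by (rule h[OF Rg that])
      then show ?thesis by (simp add: mv_diff mv_scale)
    qed
    define \<alpha> where "\<alpha> = dot X (v e) h / \<kappa> e"
    define \<beta> where "\<beta> = dot X (v f) h / \<kappa> f"
    have proportional: "\<beta> * v f z = r * \<alpha> * v e z" if "z \<in> X" for z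
      using eq[OF that] apply_F[OF e that] apply_F[OF f that] by (simp add: \<alpha>_def \<beta>_def)
    have "\<alpha> \<noteq> 0"
    proof
      assume "\<alpha> = 0"
      then have "mv X (F e) h z = 0" if "z \<in> X" for z
        using apply_F[OF e that, of h] unfolding \<alpha>_def[symmetric] by simp
      then have "dot X h (mv X (F e) h) = 0" by (simp add: dot_def)
      then show False using h_nz by blast
    qed
    moreover have "\<beta> * dot X (v f) (k e) = r * \<alpha> * dot X (v e) (k e)"
    proof -
      have "\<beta> * dot X (v f) (k e) = (\<Sum>z\<in>X. (\<beta> * v f z) * k e z)"
        by (simp add: dot_def sum_distrib_left mult.assoc)
      also have "\<dots> = (\<Sum>z\<in>X. (r * \<alpha> * v e z) * k e z)" by (intro sum.cong refl) (simp only: proportional)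
      also have "\<dots> = r * \<alpha> * dot X (v e) (k e)" by (simp add: dot_def sum_distrib_left mult.assoc)
      finally show ?thesis .
    qed
    ultimately show False using orth[OF f e \<open>f \<noteq> e\<close>] r \<kappa>[OF e] by (simp add: \<kappa>_def)
  qed
  show "\<exists>T. \<forall>e\<in>?J. T e \<subseteq> X \<and> D + 2 \<le> card (T e) \<and> pairs (T e) \<subseteq> E \<and>
      (\<forall>f\<in>?J. f \<noteq> e \<longrightarrow> pairs (T e) \<inter> pairs (T f) = {})"
    using clique large disj by (intro exI[of _ T]) (auto simp: T_def)
qed

lemma card_pairs: "finite X \<Longrightarrow> card (pairs X) = card X choose 2"
  unfolding pairs_def by (rule n_subsets)

text \<open>The rank of the complete graph, bounded from above by exhibiting stresses. A vertex set \<open>M\<close> whose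
  complement has \<open>D + 1\<close> points parametrises the affine dependences (\<open>w y\<close> is \<open>1\<close> at \<open>y\<close> and vanishes on
  the rest of \<open>M\<close>), and the squares of \<open>w y\<close> and of \<open>w y + w z\<close> are linearly independent stresses. A
  nonzero combination of them cannot be supported in the independent set \<open>B\<close>, so there are at most as
  many as there are pairs outside \<open>B\<close>.\<close>

lemma independent_card_bound:
  assumes X: "finite X" and P: "interpolating D X P" and cX: "D + 1 \<le> card X"
    and B: "B \<subseteq> pairs X" "rigidity_indep D P B"
  shows "card B + (card X - (D + 1)) + ((card X - (D + 1)) choose 2) \<le> card X choose 2"
proof -
  obtain T0 where T0: "T0 \<subseteq> X" "card T0 = D + 1" "finite T0"
    using obtain_subset_with_card_n[OF cX] by blast
  define M where "M = X - T0"
  have fM: "finite M" and cM: "card M = card X - (D + 1)" using T0 X by (auto simp: M_def card_Diff_subset)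
  define g where "g t i = (if i < D then P t i else 1)" for t i
  have indT: "indep_family T0 {..D} g"
    unfolding indep_family_def
  proof (intro allI impI ballI)
    fix u t assume u: "\<forall>i\<in>{..D}. (\<Sum>s\<in>T0. u s * g s i) = 0" and t: "t \<in> T0"
    obtain a where a: "a \<in> affine_functions D P" "\<forall>s\<in>T0. a s = (if s = t then 1 else 0)"
      using P[unfolded interpolating_def, rule_format, of T0 "\<lambda>s. if s = t then 1 else 0"] T0 by auto
    obtain c b where ab: "a = (\<lambda>x. c + (\<Sum>i<D. b i * P x i))" using a(1) by (auto simp: affine_functions_def)
    have "u t = (\<Sum>s\<in>T0. u s * a s)"
    proof -
      have "(\<Sum>s\<in>T0. u s * a s) = (\<Sum>s\<in>T0. if s = t then u t else 0)"
        using a(2) by (intro sum.cong) auto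
      then show ?thesis using t T0(3) by simp
    qed
    also have "\<dots> = c * (\<Sum>s\<in>T0. u s * g s D) + (\<Sum>i<D. b i * (\<Sum>s\<in>T0. u s * g s i))"
    proof -
      have "(\<Sum>s\<in>T0. u s * a s) = c * (\<Sum>s\<in>T0. u s) + (\<Sum>s\<in>T0. \<Sum>i<D. b i * (u s * P s i))"
        by (simp add: ab distrib_left sum.distrib sum_distrib_left mult_ac)
      also have "(\<Sum>s\<in>T0. \<Sum>i<D. b i * (u s * P s i)) = (\<Sum>i<D. b i * (\<Sum>s\<in>T0. u s * P s i))"
        unfolding sum_distrib_left by (rule sum.swap)
      finally show ?thesis by (simp add: g_def)
    qed
    also have "\<dots> = 0" using u by simp
    finally show "u t = 0" .
  qed
  have "\<exists>c. \<forall>i\<in>{..D}. (\<Sum>t\<in>T0. c t * g t i) = - g y i" for y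
    using indep_family_card(2)[OF T0(3) _ indT, of "\<lambda>i. - g y i"] T0(2) by simp
  then obtain c where c: "\<And>y i. i \<le> D \<Longrightarrow> (\<Sum>t\<in>T0. c y t * g t i) = - g y i" by (metis atMost_iff)
  define w where "w y x = (if x \<in> T0 then c y x else if x = y then 1 else 0)" for y x
  have w_g: "(\<Sum>x\<in>X. w y x * g x i) = 0" if "y \<in> M" "i \<le> D" for y i
  proof -
    have "(\<Sum>x\<in>X. w y x * g x i) = (\<Sum>x\<in>M. w y x * g x i) + (\<Sum>x\<in>T0. w y x * g x i)"
      unfolding M_def using T0 X by (rule_tac sum.subset_diff) auto
    also have "(\<Sum>x\<in>M. w y x * g x i) = (\<Sum>x\<in>M. if x = y then g y i else 0)"
      by (intro sum.cong) (auto simp: w_def M_def)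
    also have "\<dots> = g y i" using that fM by simp
    also have "(\<Sum>x\<in>T0. w y x * g x i) = - g y i"
      using c[OF that(2), of y] by (simp add: w_def)
    finally show ?thesis by simp
  qed
  define J where "J = {s. s \<subseteq> M \<and> card s = 1} \<union> {s. s \<subseteq> M \<and> card s = 2}"
  have fJ: "finite J" unfolding J_def by (rule finite_subset[of _ "Pow M"]) (use fM in auto)
  have cJ: "card J = card M + (card M choose 2)"
    unfolding J_def using fM by (subst card_Un_disjoint) (auto simp: n_subsets)
  define ws where "ws s x = (if x \<in> X then \<Sum>y\<in>s. w y x else 0)" for s x
  define \<Omega> where "\<Omega> s = (\<lambda>x y. ws s x * ws s y)" for s
  have ws_g: "(\<Sum>x\<in>X. ws s x * g x i) = 0" if "s \<in> J" "i \<le> D" for s i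
  proof -
    have "(\<Sum>x\<in>X. ws s x * g x i) = (\<Sum>y\<in>s. \<Sum>x\<in>X. w y x * g x i)"
      by (simp add: ws_def sum_distrib_right sum.swap[of _ X s])
    also have "\<dots> = 0" using that w_g by (intro sum.neutral) (auto simp: J_def)
    finally show ?thesis .
  qed
  have \<Omega>: "stress D P X (pairs X) (\<Omega> s)" if s: "s \<in> J" for s
    unfolding stress_def
  proof (intro conjI allI ballI impI)
    have mv\<Omega>: "mv X (\<Omega> s) f x = ws s x * (\<Sum>y\<in>X. ws s y * f y)" for f x
      by (simp add: mv_def \<Omega>_def sum_distrib_left mult.assoc)
    show "\<Omega> s x y = \<Omega> s y x" for x y by (simp add: \<Omega>_def)
    show out: "\<Omega> s x y = 0" if "x \<notin> X" for x y using that by (simp add: \<Omega>_def ws_def)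
    show "\<Omega> s x y = 0" if "x \<noteq> y" "{x, y} \<notin> pairs X" for x y
      using that by (auto simp: pairs_def \<Omega>_def ws_def)
    show "mv X (\<Omega> s) (\<lambda>_. 1) x = 0" for x
      using ws_g[OF s, of D] by (simp add: mv\<Omega> g_def)
    show "mv X (\<Omega> s) (\<lambda>y. P y i) x = 0" if "i < D" for x i
      using ws_g[OF s, of i] that by (simp add: mv\<Omega> g_def)
  qed
  have ws_M: "ws s x = (if x \<in> s then 1 else 0)" if "s \<in> J" "x \<in> M" for s x
  proof -
    have "finite s" using that fM finite_subset by (auto simp: J_def)
    have "ws s x = (\<Sum>y\<in>s. if y = x then 1 else 0)"
      using that by (auto simp: ws_def w_def M_def intro!: sum.cong)
    then show ?thesis using \<open>finite s\<close> by simp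
  qed
  have "indep_family J (pairs X - B) (\<lambda>s e. entry (\<Omega> s) e)"
    unfolding indep_family_def
  proof (intro allI impI)
    fix u assume u: "\<forall>e\<in>pairs X - B. (\<Sum>s\<in>J. u s * entry (\<Omega> s) e) = 0"
    let ?Z = "\<lambda>x y. \<Sum>s\<in>J. u s * \<Omega> s x y"
    have Z: "stress D P X (pairs X) ?Z" by (intro stress_sum stress_scale \<Omega>)
    have "stress D P X B ?Z"
    proof (rule stress_restrict[OF Z])
      fix x y assume xy: "x \<noteq> y" "{x, y} \<in> pairs X - B"
      have "?Z x y = entry ?Z {x, y}" using entry_stress[OF Z xy(1)] by simp
      also have "\<dots> = 0" using u xy(2) by (simp add: entry_sum entry_scale)
      finally show "?Z x y = 0" .
    qed
    then have "?Z = (\<lambda>_ _. 0)" using B rigidity_indep_iff_stress[OF X] by blast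
    then have Z0: "?Z x y = 0" for x y by (rule fun_cong[OF fun_cong])
    have Z_M: "?Z x y = (\<Sum>s\<in>J. if x \<in> s \<and> y \<in> s then u s else 0)" if "x \<in> M" "y \<in> M" for x y
      using that by (intro sum.cong) (auto simp: \<Omega>_def ws_M)
    have u2: "u {x, y} = 0" if "x \<noteq> y" "x \<in> M" "y \<in> M" for x y
    proof -
      have "{x, y} \<in> J" using that by (simp add: J_def)
      have only: "s = {x, y}" if "s \<in> J" "x \<in> s" "y \<in> s" for s
        using that \<open>x \<noteq> y\<close> by (auto simp: J_def card_1_singleton_iff card_2_iff)
      have "(if x \<in> s \<and> y \<in> s then u s else 0) = (if s = {x, y} then u {x, y} else 0)" if "s \<in> J" for s
      proof (cases "x \<in> s \<and> y \<in> s")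
        case True
        then have "s = {x, y}" using only[OF that] by blast
        then show ?thesis by simp
      next
        case False
        then have "s \<noteq> {x, y}" by blast
        then show ?thesis using False by auto
      qed
      then have "?Z x y = (\<Sum>s\<in>J. if s = {x, y} then u {x, y} else 0)"
        unfolding Z_M[OF that(2,3)] by (intro sum.cong refl)
      then have "(\<Sum>s\<in>J. if s = {x, y} then u {x, y} else 0) = 0" by (simp only: Z0)
      then show ?thesis using fJ \<open>{x, y} \<in> J\<close> by simp
    qed
    have u1: "u {x} = 0" if "x \<in> M" for x
    proof -
      have "{x} \<in> J" using that by (simp add: J_def)
      have "u s = 0" if "s \<in> J" "x \<in> s" "s \<noteq> {x}" for s
      proof -
        have "card s = 2" "s \<subseteq> M" using that by (auto simp: J_def card_1_singleton_iff)
        then obtain y z where "s = {y, z}" "y \<noteq> z" by (auto simp: card_2_iff)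
        then show ?thesis using u2 \<open>s \<subseteq> M\<close> by auto
      qed
      then have "?Z x x = (\<Sum>s\<in>J. if s = {x} then u {x} else 0)"
        unfolding Z_M[OF that that] by (intro sum.cong) auto
      then have "(\<Sum>s\<in>J. if s = {x} then u {x} else 0) = 0" by (simp only: Z0)
      then show ?thesis using fJ \<open>{x} \<in> J\<close> by simp
    qed
    show "\<forall>s\<in>J. u s = 0"
      using u1 u2 by (auto simp: J_def card_1_singleton_iff card_2_iff)
  qed
  then have "card J \<le> card (pairs X - B)"
    using indep_family_card(1)[OF fJ] finite_pairs[OF X] by blast
  also have "\<dots> = (card X choose 2) - card B"
    using B finite_pairs[OF X] finite_subset card_pairs[OF X] by (metis card_Diff_subset)
  finally have "card J \<le> (card X choose 2) - card B" .
  moreover have "card B \<le> card X choose 2"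
    using card_mono[OF finite_pairs[OF X] B(1)] card_pairs[OF X] by simp
  ultimately show ?thesis using cJ[unfolded cM] by linarith
qed

lemma twice_choose_two: "2 * int (n choose 2) = int n * (int n - 1)"
proof (induction n)
  case (Suc n)
  have "Suc n choose 2 = n + (n choose 2)" by (simp add: numeral_2_eq_2)
  then show ?case using Suc by (simp add: algebra_simps)
qed simp

lemma rigidity_rank_basis:
  assumes X: "finite (verts H)" and E: "edges H \<subseteq> pairs (verts H)"
  obtains P B where "generic D (verts H) P" "B \<subseteq> edges H" "rigidity_indep D P B"
    "card B = rigidity_rank D H" "\<And>e. e \<in> edges H - B \<Longrightarrow> \<not> rigidity_indep D P (insert e B)"
proof -
  define P where "P = (SOME p. generic D (verts H) p)"
  have P: "generic D (verts H) P" unfolding P_def by (rule someI_ex[OF ex_generic[OF X]])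
  let ?A = "{card F | F. F \<subseteq> edges H \<and> rigidity_indep D P F}"
  have fE: "finite (edges H)" using E finite_pairs[OF X] finite_subset by blast
  have "?A \<subseteq> card ` Pow (edges H)" by auto
  then have fA: "finite ?A" using fE finite_subset by blast
  have "rigidity_indep D P {}" by (simp add: rigidity_indep_iff_family indep_family_def)
  then have "?A \<noteq> {}" by auto
  then have "Max ?A \<in> ?A" using fA by (rule Max_in[rotated])
  moreover have rank: "rigidity_rank D H = Max ?A" by (simp add: rigidity_rank_def P_def Let_def)
  ultimately obtain B where B: "B \<subseteq> edges H" "rigidity_indep D P B" "card B = rigidity_rank D H" by auto
  have fB: "finite B" using B fE finite_subset by blast
  have "\<not> rigidity_indep D P (insert e B)" if "e \<in> edges H - B" for e
  proof
    assume "rigidity_indep D P (insert e B)"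
    then have "card (insert e B) \<in> ?A" using that B by auto
    then have "card (insert e B) \<le> rigidity_rank D H" unfolding rank using fA by (rule Max_ge[rotated])
    then show False using that B fB by simp
  qed
  then show ?thesis using that[OF P B(1,2,3)] by blast
qed

theorem theorem5p4:
  fixes d k l D :: nat and G :: "'a graph" and X :: "'a set"
  assumes "d \<ge> 1" and "k \<ge> 1" and "l \<ge> 1"
    and "fin_simple_graph G"
    and "minimally_globally_rigid_kl k l d G"
    and "D = d + k + l - 2"
    and "X \<subseteq> verts G" and "card X \<ge> D + 2"
  shows "int (card (edges (induced_subgraph G X)))
           \<le> int (rigidity_rank D (induced_subgraph G X)) + int (card X) - int D - 1
       \<and> int (rigidity_rank D (induced_subgraph G X)) + int (card X) - int D - 1
           \<le> (int D + 1) * int (card X) - int ((D + 2) choose 2)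
       \<and> (\<not> is_complete_graph (D + 2) (induced_subgraph G X) \<longrightarrow>
           int (card (edges (induced_subgraph G X)))
             < int (rigidity_rank D (induced_subgraph G X)) + int (card X) - int D - 1)"
proof -
  let ?H = "induced_subgraph G X"
  let ?E = "edges ?H" and ?r = "rigidity_rank D ?H"
  have D: "D = d + (k - 1) + (l - 1)" using assms(2,3,6) by simp
  have vH: "verts ?H = X" by (simp add: induced_subgraph_def)
  have X: "finite X" using assms(4,7) finite_subset by (auto simp: fin_simple_graph_def)
  have E: "?E \<subseteq> pairs X" using assms(4) by (auto simp: fin_simple_graph_def induced_subgraph_def pairs_def)
  have fE: "finite ?E" using E finite_pairs[OF X] finite_subset by blast
  obtain P B where P: "generic D X P" and B: "B \<subseteq> ?E" "rigidity_indep D P B" "card B = ?r"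
    and max: "\<And>e. e \<in> ?E - B \<Longrightarrow> \<not> rigidity_indep D P (insert e B)"
    using rigidity_rank_basis[of ?H D] X E unfolding vH by blast
  have interp: "interpolating D X P" by (rule generic_interpolating[OF X P])
  have cX: "D + 1 \<le> card X" using assms(8) by simp
  have cX': "card X \<ge> d + (k - 1) + (l - 1) + 2" using assms(8) D by simp
  note witness = minimal_edge_witness[OF assms(2,3,4,5,7) cX', folded D, OF P]
  have card_E: "card ?E = ?r + card (?E - B)"
    using B fE by (metis card_Diff_subset card_mono finite_subset le_add_diff_inverse)
  have first: "card (?E - B) + D + 1 \<le> card X" 
    by (rule stress_space_structure(1)[OF X E interp cX B(1,2)]) (erule max, erule (2) witness)
  define m where "m = card X - (D + 1)"
  have n: "card X = m + D + 1" and m1: "m \<ge> 1" using assms(8) by (auto simp: m_def)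
  have "?r + m + (m choose 2) \<le> card X choose 2"
    using independent_card_bound[OF X interp cX _ B(2)] B E unfolding m_def by auto
  then have "int (?r + m + (m choose 2)) \<le> int (card X choose 2)" by (simp only: of_nat_le_iff)
  then have "2 * (int ?r + int m) + 2 * int (m choose 2) \<le> 2 * int (card X choose 2)" by simp
  then have "2 * (int ?r + int m) + int m * (int m - 1) \<le> int (card X) * (int (card X) - 1)"
    by (simp only: twice_choose_two)
  then have rank: "2 * int ?r \<le> 2 * int m * int D + int D * int D + int D"
    unfolding n by (simp add: algebra_simps)
  have "2 * ((int D + 1) * int (card X) - int ((D + 2) choose 2)) =
      2 * ((int D + 1) * int (card X)) - (int D + 2) * (int D + 1)"
    using twice_choose_two[of "D + 2"] by (simp add: algebra_simps)
  then have second: "int ?r + int (card X) - int D - 1 \<le> (int D + 1) * int (card X) - int ((D + 2) choose 2)"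
    using rank unfolding n by (simp add: algebra_simps)
  \<comment> \<open>In the case of equality there are \<open>m\<close> edge-disjoint cliques on at least \<open>D + 2\<close> vertices, which is
    too many edges for the rank bound unless \<open>m = 1\<close>.\<close>
  have third: "is_complete_graph (D + 2) ?H" if "\<not> card ?E < ?r + m"
  proof -
    have tight: "card (?E - B) + D + 1 = card X" using that first card_E n by simp
    have cJ: "card (?E - B) = m" using tight n by simp
    have "\<exists>T. \<forall>e\<in>?E - B. T e \<subseteq> X \<and> D + 2 \<le> card (T e) \<and> pairs (T e) \<subseteq> ?E \<and>
        (\<forall>f\<in>?E - B. f \<noteq> e \<longrightarrow> pairs (T e) \<inter> pairs (T f) = {})"
      by (rule stress_space_structure(2)[OF X E interp cX B(1,2)]) (erule max, erule (2) witness, rule tight)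
    then obtain T where T': "\<forall>e\<in>?E - B. T e \<subseteq> X \<and> D + 2 \<le> card (T e) \<and> pairs (T e) \<subseteq> ?E \<and>
        (\<forall>f\<in>?E - B. f \<noteq> e \<longrightarrow> pairs (T e) \<inter> pairs (T f) = {})" by (elim exE)
    have T: "T e \<subseteq> X" "D + 2 \<le> card (T e)" "pairs (T e) \<subseteq> ?E" if "e \<in> ?E - B" for e
      using bspec[OF T' that] by simp_all
    have disj: "pairs (T e) \<inter> pairs (T f) = {}" if "e \<in> ?E - B" "f \<in> ?E - B" "f \<noteq> e" for e f
      using bspec[OF T' that(1)] that(2,3) by simp
    have fT: "finite (T e)" if "e \<in> ?E - B" for e using T(1)[OF that] X finite_subset by blast
    have "card (\<Union>e\<in>?E - B. pairs (T e)) = (\<Sum>e\<in>?E - B. card (pairs (T e)))"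
      using fE fT disj by (intro card_UN_disjoint) (auto intro: finite_pairs)
    moreover have "card (\<Union>e\<in>?E - B. pairs (T e)) \<le> card ?E"
      using T(3) by (intro card_mono fE) blast
    moreover have big: "(int D + 2) * (int D + 1) \<le> 2 * int (card (pairs (T e)))" if "e \<in> ?E - B" for e
    proof -
      have "(int D + 2) * (int D + 1) \<le> int (card (T e)) * (int (card (T e)) - 1)"
        using T(2)[OF that] by (intro mult_mono) auto
      then show ?thesis using card_pairs[OF fT[OF that]] twice_choose_two by metis
    qed
    ultimately have "(\<Sum>e\<in>?E - B. 2 * int (card (pairs (T e)))) \<le> 2 * int (card ?E)"
      by (simp add: sum_distrib_left[symmetric] flip: of_nat_sum)
    moreover have "(\<Sum>e\<in>?E - B. (int D + 2) * (int D + 1)) \<le> (\<Sum>e\<in>?E - B. 2 * int (card (pairs (T e))))"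
      by (intro sum_mono big)
    ultimately have "int m * ((int D + 2) * (int D + 1)) \<le> 2 * int (card ?E)" by (simp add: cJ)
    also have "\<dots> = 2 * int ?r + 2 * int m" using card_E cJ by simp
    finally have "int m * (int D * (int D + 1)) \<le> 1 * (int D * (int D + 1))"
      using rank by (simp add: algebra_simps)
    moreover have "0 < int D * (int D + 1)" using assms(1) D by simp
    ultimately have "int m \<le> 1" by (simp only: mult_le_cancel_right)
    then have m: "m = 1" using m1 by simp
    then obtain e where e: "e \<in> ?E - B" using cJ by (metis card.empty equals0I zero_neq_one)
    have "T e = X" using T[OF e] X n m by (intro card_seteq) auto
    then have "?E = pairs X" using T[OF e] E by auto
    then show ?thesis using X n m by (auto simp: is_complete_graph_def pairs_def vH)
  qed
  have rhs: "int ?r + int (card X) - int D - 1 = int (?r + m)" using n by simp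
  have "int (card ?E) \<le> int (?r + m)" using first card_E n by simp
  moreover have "int (card ?E) < int (?r + m)" if "\<not> is_complete_graph (D + 2) ?H"
    using third that by (simp only: of_nat_less_iff) blast
  ultimately show ?thesis
    using second unfolding rhs by blast
qed

end
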